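(* Over $\mathsf{ACA}_0^\omega+\mathsf{QF\text{-}AC}^{0,1}+\mathsf{FIN}$, the principle $\mathsf{NIN}_{\mathsf{alt}}$ is equivalent to each of the following: (ii) For every regulated $f:[0,1]\to\mathbb{R}$ that has a supremum functional, there is $x\in[0,1]$ where $f$ is continuous. (iii) For every regulated and lower semi-continuous $f:[0,1]\to\mathbb{R}$ that has a supremum functional, there is $x\in[0,1]$ where $f$ is continuous. (iv) For every regulated and symmetrically continuous $f:[0,1]\to\mathbb{R}$, there is $x\in[0,1]$ where $f$ is continuous.
   Context: Framework: Kohlenbach's higher-order Reverse Mathematics. $\mathsf{ACA}_0^\omega$ is the base theory $\mathsf{RCA}_0^\omega$ plus Kleene's $(\exists^2)$: $(\exists\varphi^2\le_21)(\forall f^1)[(\exists n)(f(n)=0)\leftrightarrow\varphi(f)=0]$. $\mathsf{QF\text{-}AC}^{0,1}$: for quantifier-free $A$, $(\forall n^0)(\exists f^1)A(n,f)\to(\exists g)(\forall n)A(n,g(n))$. Sets of reals are given by characteristic functions. $X\subset\mathbb{R}$ is finite if there is $N$ such that among any distinct reals $x_0,\dots,x_N$ some $x_i\notin X$. $\mathsf{FIN}$: (1) $\bigcup_{n\le k}X_n$ is finite for any sequence of finite sets $(X_n)$ and $k$; (2) every finite set of reals is contained in the range of a finite sequence of reals; (3) for $Y^2,k^0$ with $(\forall n\le k)(\exists f\in2^{\mathbb{N}})(Y(f,n)=0)$ there are $f_0,\dots,f_k$ with $Y(f_n,n)=0$ for $n\le k$. $A\subset\mathbb{R}$ is height countable if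 some $H:\mathbb{R}\to\mathbb{N}$ makes every $\{x\in A:H(x)<n\}$ finite; $\mathsf{NIN}_{\mathsf{alt}}$: $[0,1]$ is not height countable. $f$ is regulated if all one-sided limits exist. A supremum functional for $f$ is $F:\mathbb{Q}^2\to\mathbb{R}$ with $F(p,q)=\sup_{x\in[p,q]}f(x)$ for all rationals $p,q\in[0,1]$. Lower semi-continuous: $f(x_0)\le\liminf_{x\to x_0}f(x)$ for all $x_0$. Symmetrically continuous at $x$: $(\forall\varepsilon>0)(\exists\delta>0)(\forall z)(|z|<\delta\to|f(x+z)-f(x-z)|<\varepsilon)$ (for $z$ with $x\pm z$ in the domain); symmetrically continuous means so at every point. *)

theory Defs
  imports Main
begin

section \<open>The language of all finite types\<close>

datatype ty = T0 | Arr ty ty  (infixr "\<Rrightarrow>" 70)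

abbreviation T1 :: ty where "T1 \<equiv> T0 \<Rrightarrow> T0"
abbreviation T2 :: ty where "T2 \<equiv> T1 \<Rrightarrow> T0"

text \<open>\<open>Rec\<close> is the recursor $R_0$ of type level 0; \<open>CK\<close> and \<open>CS\<close> are the combinators
  $\Pi$ and $\Sigma$.\<close>

datatype cnst = CZero | COne | CPlus | CTimes | CK ty ty | CS ty ty ty | CRec

primrec ty_cnst :: "cnst \<Rightarrow> ty" where
  "ty_cnst CZero = T0"
| "ty_cnst COne = T0"
| "ty_cnst CPlus = T0 \<Rrightarrow> T0 \<Rrightarrow> T0"
| "ty_cnst CTimes = T0 \<Rrightarrow> T0 \<Rrightarrow> T0"
| "ty_cnst (CK \<rho> \<tau>) = \<rho> \<Rrightarrow> \<tau> \<Rrightarrow> \<rho>"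
| "ty_cnst (CS \<rho> \<sigma> \<tau>) = (\<rho> \<Rrightarrow> \<sigma> \<Rrightarrow> \<tau>) \<Rrightarrow> (\<rho> \<Rrightarrow> \<sigma>) \<Rrightarrow> \<rho> \<Rrightarrow> \<tau>"
| "ty_cnst CRec = (T0 \<Rrightarrow> T0 \<Rrightarrow> T0) \<Rrightarrow> T0 \<Rrightarrow> T0 \<Rrightarrow> T0"

text \<open>Locally nameless syntax: \<open>Bnd i\<close> is a bound variable (de Bruijn index), \<open>Par a \<rho>\<close> is the
  \<open>a\<close>-th free variable of type \<open>\<rho>\<close>.  Prime formulas are equations and inequalities
  of type 0 only.\<close>

datatype trm = Bnd nat | Par nat ty | Cn cnst | App trm trm

datatype fm = Bot | Eq trm trm | Less trm trm | Imp fm fm | Forall ty fm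

text \<open>\<open>\<Delta>\<close> lists the types of the bound variables in scope, innermost first.\<close>

fun ty_of :: "ty list \<Rightarrow> trm \<Rightarrow> ty option" where
  "ty_of \<Delta> (Bnd i) = (if i < length \<Delta> then Some (\<Delta> ! i) else None)"
| "ty_of \<Delta> (Par a \<rho>) = Some \<rho>"
| "ty_of \<Delta> (Cn c) = Some (ty_cnst c)"
| "ty_of \<Delta> (App s t) =
     (case ty_of \<Delta> s of
        Some (\<rho> \<Rrightarrow> \<tau>) \<Rightarrow> if ty_of \<Delta> t = Some \<rho> then Some \<tau> else None
      | _ \<Rightarrow> None)"

primrec wff :: "ty list \<Rightarrow> fm \<Rightarrow> bool" where
  "wff \<Delta> Bot = True"
| "wff \<Delta> (Eq s t) = (ty_of \<Delta> s = Some T0 \<and> ty_of \<Delta> t = Some T0)"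
| "wff \<Delta> (Less s t) = (ty_of \<Delta> s = Some T0 \<and> ty_of \<Delta> t = Some T0)"
| "wff \<Delta> (Imp \<phi> \<psi>) = (wff \<Delta> \<phi> \<and> wff \<Delta> \<psi>)"
| "wff \<Delta> (Forall \<rho> \<phi>) = wff (\<rho> # \<Delta>) \<phi>"

primrec qfree :: "fm \<Rightarrow> bool" where
  "qfree Bot = True"
| "qfree (Eq s t) = True"
| "qfree (Less s t) = True"
| "qfree (Imp \<phi> \<psi>) = (qfree \<phi> \<and> qfree \<psi>)"
| "qfree (Forall \<rho> \<phi>) = False"

primrec pars_tm :: "trm \<Rightarrow> (nat \<times> ty) set" where
  "pars_tm (Bnd i) = {}"
| "pars_tm (Par a \<rho>) = {(a, \<rho>)}"
| "pars_tm (Cn c) = {}"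
| "pars_tm (App s t) = pars_tm s \<union> pars_tm t"

primrec pars :: "fm \<Rightarrow> (nat \<times> ty) set" where
  "pars Bot = {}"
| "pars (Eq s t) = pars_tm s \<union> pars_tm t"
| "pars (Less s t) = pars_tm s \<union> pars_tm t"
| "pars (Imp \<phi> \<psi>) = pars \<phi> \<union> pars \<psi>"
| "pars (Forall \<rho> \<phi>) = pars \<phi>"

primrec subst_tm :: "(nat \<Rightarrow> trm) \<Rightarrow> trm \<Rightarrow> trm" where
  "subst_tm \<theta> (Bnd i) = \<theta> i"
| "subst_tm \<theta> (Par a \<rho>) = Par a \<rho>"
| "subst_tm \<theta> (Cn c) = Cn c"
| "subst_tm \<theta> (App s t) = App (subst_tm \<theta> s) (subst_tm \<theta> t)"

definition lift_subst :: "(nat \<Rightarrow> trm) \<Rightarrow> nat \<Rightarrow> trm" where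
  "lift_subst \<theta> i = (case i of 0 \<Rightarrow> Bnd 0 | Suc j \<Rightarrow> subst_tm (\<lambda>k. Bnd (Suc k)) (\<theta> j))"

primrec subst :: "(nat \<Rightarrow> trm) \<Rightarrow> fm \<Rightarrow> fm" where
  "subst \<theta> Bot = Bot"
| "subst \<theta> (Eq s t) = Eq (subst_tm \<theta> s) (subst_tm \<theta> t)"
| "subst \<theta> (Less s t) = Less (subst_tm \<theta> s) (subst_tm \<theta> t)"
| "subst \<theta> (Imp \<phi> \<psi>) = Imp (subst \<theta> \<phi>) (subst \<theta> \<psi>)"
| "subst \<theta> (Forall \<rho> \<phi>) = Forall \<rho> (subst (lift_subst \<theta>) \<phi>)"

definition inst :: "trm \<Rightarrow> fm \<Rightarrow> fm" where
  "inst t = subst (\<lambda>i. case i of 0 \<Rightarrow> t | Suc j \<Rightarrow> Bnd j)"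

section \<open>Classical many-sorted derivability\<close>

text \<open>Natural deduction from a set \<open>T\<close> of axioms.  Free variables in members of \<open>T\<close> are read
  universally, so the eigenvariable condition concerns only the open assumptions \<open>\<Gamma>\<close>.  Typing is
  enforced where it matters, at the instantiation of quantifiers.\<close>

inductive derives :: "fm set \<Rightarrow> fm list \<Rightarrow> fm \<Rightarrow> bool"  ("(_;/ _/ \<turnstile> _)" [50, 50, 50] 50)
  for T :: "fm set" where
  Axm: "\<phi> \<in> T \<Longrightarrow> T; \<Gamma> \<turnstile> \<phi>"
| Asm: "\<phi> \<in> set \<Gamma> \<Longrightarrow> T; \<Gamma> \<turnstile> \<phi>"
| ImpI: "T; \<phi> # \<Gamma> \<turnstile> \<psi> \<Longrightarrow> T; \<Gamma> \<turnstile> Imp \<phi> \<psi>"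
| ImpE: "T; \<Gamma> \<turnstile> Imp \<phi> \<psi> \<Longrightarrow> T; \<Gamma> \<turnstile> \<phi> \<Longrightarrow> T; \<Gamma> \<turnstile> \<psi>"
| RAA: "T; Imp \<phi> Bot # \<Gamma> \<turnstile> Bot \<Longrightarrow> T; \<Gamma> \<turnstile> \<phi>"
| AllI: "T; \<Gamma> \<turnstile> inst (Par a \<rho>) \<phi> \<Longrightarrow> (a, \<rho>) \<notin> pars \<phi> \<Longrightarrow>
    \<forall>\<gamma>\<in>set \<Gamma>. (a, \<rho>) \<notin> pars \<gamma> \<Longrightarrow> T; \<Gamma> \<turnstile> Forall \<rho> \<phi>"
| AllE: "T; \<Gamma> \<turnstile> Forall \<rho> \<phi> \<Longrightarrow> ty_of [] t = Some \<rho> \<Longrightarrow> T; \<Gamma> \<turnstile> inst t \<phi>"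

definition provable :: "fm set \<Rightarrow> fm \<Rightarrow> bool"  (infix "\<turnstile>\<^sub>0" 50) where
  "T \<turnstile>\<^sub>0 \<phi> \<longleftrightarrow> (T; [] \<turnstile> \<phi>)"

section \<open>Notation for writing formulas\<close>

text \<open>To write formulas with named bound variables, terms and formulas are given as functions of
  the number \<open>d\<close> of enclosing quantifiers.  The variable bound by a quantifier at depth \<open>d\<close> has,
  seen from depth \<open>e > d\<close>, the de Bruijn index \<open>e - Suc d\<close>.  A sentence is evaluated at
  depth 0.\<close>

type_synonym otm = "nat \<Rightarrow> trm"
type_synonym ofm = "nat \<Rightarrow> fm"

definition o_cn :: "cnst \<Rightarrow> otm" where "o_cn c = (\<lambda>d. Cn c)"
definition o_app :: "otm \<Rightarrow> otm \<Rightarrow> otm"  (infixl "\<cdot>" 90) where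
  "s \<cdot> t = (\<lambda>d. App (s d) (t d))"

definition o_zero :: otm  ("\<^bold>0") where "\<^bold>0 = o_cn CZero"
definition o_one :: otm  ("\<^bold>1") where "\<^bold>1 = o_cn COne"
definition o_plus :: "otm \<Rightarrow> otm \<Rightarrow> otm"  (infixl "\<^bold>+" 65) where
  "s \<^bold>+ t = o_cn CPlus \<cdot> s \<cdot> t"
definition o_times :: "otm \<Rightarrow> otm \<Rightarrow> otm"  (infixl "\<^bold>*" 70) where
  "s \<^bold>* t = o_cn CTimes \<cdot> s \<cdot> t"

definition o_bot :: ofm where "o_bot = (\<lambda>d. Bot)"
definition o_eq :: "otm \<Rightarrow> otm \<Rightarrow> ofm"  (infix "\<^bold>=" 50) where
  "(s \<^bold>= t) = (\<lambda>d. Eq (s d) (t d))"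
definition o_less :: "otm \<Rightarrow> otm \<Rightarrow> ofm"  (infix "\<^bold><" 50) where
  "(s \<^bold>< t) = (\<lambda>d. Less (s d) (t d))"
definition o_imp :: "ofm \<Rightarrow> ofm \<Rightarrow> ofm"  (infixr "\<^bold>\<longrightarrow>" 25) where
  "(P \<^bold>\<longrightarrow> Q) = (\<lambda>d. Imp (P d) (Q d))"
definition o_not :: "ofm \<Rightarrow> ofm"  ("\<^bold>\<not> _" [40] 40) where
  "(\<^bold>\<not> P) = (P \<^bold>\<longrightarrow> o_bot)"
definition o_or :: "ofm \<Rightarrow> ofm \<Rightarrow> ofm"  (infixr "\<^bold>\<or>" 30) where
  "(P \<^bold>\<or> Q) = (\<^bold>\<not> P \<^bold>\<longrightarrow> Q)"
definition o_and :: "ofm \<Rightarrow> ofm \<Rightarrow> ofm"  (infixr "\<^bold>\<and>" 35) where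
  "(P \<^bold>\<and> Q) = (\<^bold>\<not> (P \<^bold>\<longrightarrow> \<^bold>\<not> Q))"
definition o_iff :: "ofm \<Rightarrow> ofm \<Rightarrow> ofm"  (infixr "\<^bold>\<longleftrightarrow>" 25) where
  "(P \<^bold>\<longleftrightarrow> Q) = ((P \<^bold>\<longrightarrow> Q) \<^bold>\<and> (Q \<^bold>\<longrightarrow> P))"
definition o_le :: "otm \<Rightarrow> otm \<Rightarrow> ofm"  (infix "\<^bold>\<le>" 50) where
  "(s \<^bold>\<le> t) = (s \<^bold>< t \<^bold>\<or> s \<^bold>= t)"

definition o_all :: "ty \<Rightarrow> (otm \<Rightarrow> ofm) \<Rightarrow> ofm" where
  "o_all \<rho> P = (\<lambda>d. Forall \<rho> (P (\<lambda>e. Bnd (e - Suc d)) (Suc d)))"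
definition o_ex :: "ty \<Rightarrow> (otm \<Rightarrow> ofm) \<Rightarrow> ofm" where
  "o_ex \<rho> P = (\<^bold>\<not> o_all \<rho> (\<lambda>x. \<^bold>\<not> P x))"

text \<open>Quantifiers over type 1 objects satisfying a predicate \<open>A\<close>.\<close>

definition o_ball :: "(otm \<Rightarrow> ofm) \<Rightarrow> (otm \<Rightarrow> ofm) \<Rightarrow> ofm" where
  "o_ball A P = o_all T1 (\<lambda>x. A x \<^bold>\<longrightarrow> P x)"
definition o_bex :: "(otm \<Rightarrow> ofm) \<Rightarrow> (otm \<Rightarrow> ofm) \<Rightarrow> ofm" where
  "o_bex A P = o_ex T1 (\<lambda>x. A x \<^bold>\<and> P x)"

syntax
  "_o_all" :: "pttrn \<Rightarrow> ty \<Rightarrow> ofm \<Rightarrow> ofm"  ("(3\<^bold>\<forall>_\<^bold>:_./ _)" [0, 0, 10] 10)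
  "_o_ex" :: "pttrn \<Rightarrow> ty \<Rightarrow> ofm \<Rightarrow> ofm"  ("(3\<^bold>\<exists>_\<^bold>:_./ _)" [0, 0, 10] 10)
  "_o_ball" :: "pttrn \<Rightarrow> (otm \<Rightarrow> ofm) \<Rightarrow> ofm \<Rightarrow> ofm"  ("(3\<^bold>\<forall>_\<^bold>\<in>_./ _)" [0, 0, 10] 10)
  "_o_bex" :: "pttrn \<Rightarrow> (otm \<Rightarrow> ofm) \<Rightarrow> ofm \<Rightarrow> ofm"  ("(3\<^bold>\<exists>_\<^bold>\<in>_./ _)" [0, 0, 10] 10)
translations
  "\<^bold>\<forall>x\<^bold>:\<rho>. P" \<rightleftharpoons> "CONST o_all \<rho> (\<lambda>x. P)"
  "\<^bold>\<exists>x\<^bold>:\<rho>. P" \<rightleftharpoons> "CONST o_ex \<rho> (\<lambda>x. P)"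
  "\<^bold>\<forall>x\<^bold>\<in>A. P" \<rightleftharpoons> "CONST o_ball A (\<lambda>x. P)"
  "\<^bold>\<exists>x\<^bold>\<in>A. P" \<rightleftharpoons> "CONST o_bex A (\<lambda>x. P)"

definition sentence :: "ofm \<Rightarrow> fm" where "sentence P = P 0"

text \<open>\<open>A\<lparr>t\<^sub>0, t\<^sub>1, \<dots>\<rparr>\<close>: the formula \<open>A\<close> with \<open>t\<^sub>i\<close> put for its loose bound variable \<open>Bnd i\<close>.\<close>

definition fill :: "fm \<Rightarrow> otm list \<Rightarrow> ofm" where
  "fill A ts = (\<lambda>d. subst (\<lambda>i. (ts ! i) d) A)"

text \<open>Extensional equality at type \<open>\<rho>\<close>.\<close>

primrec eq_at :: "ty \<Rightarrow> otm \<Rightarrow> otm \<Rightarrow> ofm" where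
  "eq_at T0 = o_eq"
| "eq_at (\<rho> \<Rrightarrow> \<tau>) = (\<lambda>s t. \<^bold>\<forall>x\<^bold>:\<rho>. eq_at \<tau> (s \<cdot> x) (t \<cdot> x))"

section \<open>The base theory and the axioms\<close>

text \<open>The discretely ordered semi-ring axioms, preceded by those for equality of type 0.\<close>

definition arithmetic_axioms :: "ofm set" where
  "arithmetic_axioms =
   {\<^bold>\<forall>x\<^bold>:T0. x \<^bold>= x,
    \<^bold>\<forall>x\<^bold>:T0. \<^bold>\<forall>y\<^bold>:T0. x \<^bold>= y \<^bold>\<longrightarrow> y \<^bold>= x,
    \<^bold>\<forall>x\<^bold>:T0. \<^bold>\<forall>y\<^bold>:T0. \<^bold>\<forall>z\<^bold>:T0. x \<^bold>= y \<^bold>\<and> y \<^bold>= z \<^bold>\<longrightarrow> x \<^bold>= z,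
    \<^bold>\<forall>x\<^bold>:T0. \<^bold>\<forall>y\<^bold>:T0. \<^bold>\<forall>u\<^bold>:T0. \<^bold>\<forall>v\<^bold>:T0. x \<^bold>= y \<^bold>\<and> u \<^bold>= v \<^bold>\<and> x \<^bold>< u \<^bold>\<longrightarrow> y \<^bold>< v,
    \<^bold>\<forall>x\<^bold>:T0. \<^bold>\<forall>y\<^bold>:T0. \<^bold>\<forall>z\<^bold>:T0. (x \<^bold>+ y) \<^bold>+ z \<^bold>= x \<^bold>+ (y \<^bold>+ z),
    \<^bold>\<forall>x\<^bold>:T0. \<^bold>\<forall>y\<^bold>:T0. x \<^bold>+ y \<^bold>= y \<^bold>+ x,
    \<^bold>\<forall>x\<^bold>:T0. x \<^bold>+ \<^bold>0 \<^bold>= x,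
    \<^bold>\<forall>x\<^bold>:T0. \<^bold>\<forall>y\<^bold>:T0. \<^bold>\<forall>z\<^bold>:T0. (x \<^bold>* y) \<^bold>* z \<^bold>= x \<^bold>* (y \<^bold>* z),
    \<^bold>\<forall>x\<^bold>:T0. \<^bold>\<forall>y\<^bold>:T0. x \<^bold>* y \<^bold>= y \<^bold>* x,
    \<^bold>\<forall>x\<^bold>:T0. x \<^bold>* \<^bold>1 \<^bold>= x,
    \<^bold>\<forall>x\<^bold>:T0. x \<^bold>* \<^bold>0 \<^bold>= \<^bold>0,
    \<^bold>\<forall>x\<^bold>:T0. \<^bold>\<forall>y\<^bold>:T0. \<^bold>\<forall>z\<^bold>:T0. x \<^bold>* (y \<^bold>+ z) \<^bold>= x \<^bold>* y \<^bold>+ x \<^bold>* z,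
    \<^bold>\<forall>x\<^bold>:T0. \<^bold>\<not> x \<^bold>< x,
    \<^bold>\<forall>x\<^bold>:T0. \<^bold>\<forall>y\<^bold>:T0. \<^bold>\<forall>z\<^bold>:T0. x \<^bold>< y \<^bold>\<and> y \<^bold>< z \<^bold>\<longrightarrow> x \<^bold>< z,
    \<^bold>\<forall>x\<^bold>:T0. \<^bold>\<forall>y\<^bold>:T0. x \<^bold>< y \<^bold>\<or> x \<^bold>= y \<^bold>\<or> y \<^bold>< x,
    \<^bold>\<forall>x\<^bold>:T0. \<^bold>\<forall>y\<^bold>:T0. \<^bold>\<forall>z\<^bold>:T0. x \<^bold>< y \<^bold>\<longrightarrow> x \<^bold>+ z \<^bold>< y \<^bold>+ z,
    \<^bold>\<forall>x\<^bold>:T0. \<^bold>\<forall>y\<^bold>:T0. \<^bold>\<forall>z\<^bold>:T0. \<^bold>0 \<^bold>< z \<^bold>\<and> x \<^bold>< y \<^bold>\<longrightarrow> x \<^bold>* z \<^bold>< y \<^bold>* z,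
    \<^bold>\<forall>x\<^bold>:T0. \<^bold>\<forall>y\<^bold>:T0. x \<^bold>< y \<^bold>\<longrightarrow> (\<^bold>\<exists>z\<^bold>:T0. x \<^bold>+ z \<^bold>= y),
    \<^bold>\<forall>x\<^bold>:T0. \<^bold>0 \<^bold>\<le> x,
    \<^bold>0 \<^bold>< \<^bold>1,
    \<^bold>\<forall>x\<^bold>:T0. \<^bold>0 \<^bold>< x \<^bold>\<longrightarrow> \<^bold>1 \<^bold>\<le> x}"

definition K_axiom :: "ty \<Rightarrow> ty \<Rightarrow> ofm" where
  "K_axiom \<rho> \<tau> = (\<^bold>\<forall>x\<^bold>:\<rho>. \<^bold>\<forall>y\<^bold>:\<tau>. eq_at \<rho> (o_cn (CK \<rho> \<tau>) \<cdot> x \<cdot> y) x)"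

definition S_axiom :: "ty \<Rightarrow> ty \<Rightarrow> ty \<Rightarrow> ofm" where
  "S_axiom \<rho> \<sigma> \<tau> =
   (\<^bold>\<forall>x\<^bold>:\<rho> \<Rrightarrow> \<sigma> \<Rrightarrow> \<tau>. \<^bold>\<forall>y\<^bold>:\<rho> \<Rrightarrow> \<sigma>. \<^bold>\<forall>z\<^bold>:\<rho>.
      eq_at \<tau> (o_cn (CS \<rho> \<sigma> \<tau>) \<cdot> x \<cdot> y \<cdot> z) (x \<cdot> z \<cdot> (y \<cdot> z)))"

definition Rec_axiom :: ofm where
  "Rec_axiom =
   (\<^bold>\<forall>f\<^bold>:T0 \<Rrightarrow> T0 \<Rrightarrow> T0. \<^bold>\<forall>m\<^bold>:T0.
      o_cn CRec \<cdot> f \<cdot> m \<cdot> \<^bold>0 \<^bold>= m \<^bold>\<and>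
      (\<^bold>\<forall>n\<^bold>:T0. o_cn CRec \<cdot> f \<cdot> m \<cdot> (n \<^bold>+ \<^bold>1) \<^bold>= f \<cdot> n \<cdot> (o_cn CRec \<cdot> f \<cdot> m \<cdot> n)))"

definition extensionality :: "ty \<Rightarrow> ty \<Rightarrow> ofm" where
  "extensionality \<rho> \<tau> =
   (\<^bold>\<forall>x\<^bold>:\<rho>. \<^bold>\<forall>y\<^bold>:\<rho>. \<^bold>\<forall>\<phi>\<^bold>:\<rho> \<Rrightarrow> \<tau>. eq_at \<rho> x y \<^bold>\<longrightarrow> eq_at \<tau> (\<phi> \<cdot> x) (\<phi> \<cdot> y))"

text \<open>In the next two schemes \<open>A\<close> ranges over quantifier-free formulas, which may contain
  parameters of any type.\<close>

definition induction :: "fm \<Rightarrow> ofm" where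
  "induction A =
   (fill A [\<^bold>0] \<^bold>\<and> (\<^bold>\<forall>n\<^bold>:T0. fill A [n] \<^bold>\<longrightarrow> fill A [n \<^bold>+ \<^bold>1]) \<^bold>\<longrightarrow> (\<^bold>\<forall>n\<^bold>:T0. fill A [n]))"

definition choice :: "ty \<Rightarrow> ty \<Rightarrow> fm \<Rightarrow> ofm" where
  "choice \<rho> \<sigma> A =
   ((\<^bold>\<forall>x\<^bold>:\<rho>. \<^bold>\<exists>y\<^bold>:\<sigma>. fill A [x, y]) \<^bold>\<longrightarrow> (\<^bold>\<exists>Y\<^bold>:\<rho> \<Rrightarrow> \<sigma>. \<^bold>\<forall>x\<^bold>:\<rho>. fill A [x, Y \<cdot> x]))"

definition QF_IA :: "fm set" where
  "QF_IA = {sentence (induction A) | A. qfree A \<and> wff [T0] A}"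

definition QF_AC :: "ty \<Rightarrow> ty \<Rightarrow> fm set" where
  "QF_AC \<rho> \<sigma> = {sentence (choice \<rho> \<sigma> A) | A. qfree A \<and> wff [\<rho>, \<sigma>] A}"

definition RCA0_omega :: "fm set" where
  "RCA0_omega =
     sentence ` arithmetic_axioms
   \<union> {sentence (K_axiom \<rho> \<tau>) | \<rho> \<tau>. True}
   \<union> {sentence (S_axiom \<rho> \<sigma> \<tau>) | \<rho> \<sigma> \<tau>. True}
   \<union> {sentence Rec_axiom}
   \<union> {sentence (extensionality \<rho> \<tau>) | \<rho> \<tau>. True}
   \<union> QF_IA
   \<union> QF_AC T1 T0"

text \<open>Kleene's $(\exists^2)$.\<close>

definition Exists2 :: ofm where
  "Exists2 =
   (\<^bold>\<exists>\<phi>\<^bold>:T2. (\<^bold>\<forall>f\<^bold>:T1. \<phi> \<cdot> f \<^bold>\<le> \<^bold>1) \<^bold>\<and>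
      (\<^bold>\<forall>f\<^bold>:T1. (\<^bold>\<exists>n\<^bold>:T0. f \<cdot> n \<^bold>= \<^bold>0) \<^bold>\<longleftrightarrow> \<phi> \<cdot> f \<^bold>= \<^bold>0))"

definition ACA0_omega :: "fm set" where
  "ACA0_omega = RCA0_omega \<union> {sentence Exists2}"

section \<open>Rational and real numbers\<close>

text \<open>A triple \<open>(P, M, D)\<close> of type 0 terms stands for the rational number $(P - M)/D$ (with
  \<open>D\<close> positive).\<close>

type_synonym rexp = "otm \<times> otm \<times> otm"

fun radd :: "rexp \<Rightarrow> rexp \<Rightarrow> rexp" where
  "radd (P, M, D) (P', M', D') = (P \<^bold>* D' \<^bold>+ P' \<^bold>* D, M \<^bold>* D' \<^bold>+ M' \<^bold>* D, D \<^bold>* D')"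
fun rneg :: "rexp \<Rightarrow> rexp" where
  "rneg (P, M, D) = (M, P, D)"
fun rless :: "rexp \<Rightarrow> rexp \<Rightarrow> ofm" where
  "rless (P, M, D) (P', M', D') = (P \<^bold>* D' \<^bold>+ M' \<^bold>* D \<^bold>< P' \<^bold>* D \<^bold>+ M \<^bold>* D')"

definition rsub :: "rexp \<Rightarrow> rexp \<Rightarrow> rexp" where
  "rsub r s = radd r (rneg s)"
definition rle :: "rexp \<Rightarrow> rexp \<Rightarrow> ofm" where
  "rle r s = (\<^bold>\<not> rless s r)"
definition rabs_less :: "rexp \<Rightarrow> rexp \<Rightarrow> ofm" where
  "rabs_less r e = (rless r e \<^bold>\<and> rless (rneg r) e)"
definition rabs_le :: "rexp \<Rightarrow> rexp \<Rightarrow> ofm" where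
  "rabs_le r e = (rle r e \<^bold>\<and> rle (rneg r) e)"

text \<open>$2^n = R_0(\lambda k\, y.\, y + y, 1, n)$.\<close>

definition o_ident :: otm where
  "o_ident = o_cn (CS T0 T1 T0) \<cdot> o_cn (CK T0 T1) \<cdot> o_cn (CK T0 T0)"
definition o_double :: otm where
  "o_double = o_cn (CS T0 T0 T0) \<cdot> o_cn CPlus \<cdot> o_ident"
definition o_pow2 :: "otm \<Rightarrow> otm" where
  "o_pow2 n = o_cn CRec \<cdot> (o_cn (CK T1 T0) \<cdot> o_double) \<cdot> \<^bold>1 \<cdot> n"

text \<open>The rational number $c \cdot 2^{-n}$.\<close>

definition dyad :: "otm \<Rightarrow> otm \<Rightarrow> rexp" where
  "dyad c n = (c, \<^bold>0, o_pow2 n)"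

text \<open>Rationals are coded by numbers: \<open>rat_code a b c\<close> codes $(a - b)/(c + 1)$.  The pairing
  $(m + n)^2 + m$ is injective, so a number codes at most one triple; one rational has many codes.
  \<open>decode q \<phi>\<close> says that \<open>q\<close> is a code and that \<open>\<phi>\<close> holds of the rational it codes.\<close>

definition o_pair :: "otm \<Rightarrow> otm \<Rightarrow> otm" where
  "o_pair m n = (m \<^bold>+ n) \<^bold>* (m \<^bold>+ n) \<^bold>+ m"
definition rat_code :: "otm \<Rightarrow> otm \<Rightarrow> otm \<Rightarrow> otm" where
  "rat_code a b c = o_pair (o_pair a b) c"
definition decode :: "otm \<Rightarrow> (rexp \<Rightarrow> ofm) \<Rightarrow> ofm" where
  "decode q \<phi> = (\<^bold>\<exists>a\<^bold>:T0. \<^bold>\<exists>b\<^bold>:T0. \<^bold>\<exists>c\<^bold>:T0. q \<^bold>= rat_code a b c \<^bold>\<and> \<phi> (a, b, c \<^bold>+ \<^bold>1))"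
definition is_rat :: "otm \<Rightarrow> ofm" where
  "is_rat q = (\<^bold>\<exists>a\<^bold>:T0. \<^bold>\<exists>b\<^bold>:T0. \<^bold>\<exists>c\<^bold>:T0. q \<^bold>= rat_code a b c)"

text \<open>Reals are fast-converging Cauchy sequences of rationals:
  $|x_n - x_{n+i}| < 2^{-n}$ for all $n, i$.\<close>

definition Real :: "otm \<Rightarrow> ofm" where
  "Real x = (\<^bold>\<forall>n\<^bold>:T0. \<^bold>\<forall>i\<^bold>:T0.
     decode (x \<cdot> n) (\<lambda>p. decode (x \<cdot> (n \<^bold>+ i)) (\<lambda>q. rabs_less (rsub p q) (dyad \<^bold>1 n))))"

text \<open>$x =_{\mathbb{R}} y$ iff $|x_n - y_n| \le 2^{-n+1}$ for all $n$.\<close>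

definition real_eq :: "otm \<Rightarrow> otm \<Rightarrow> ofm"  (infix "\<^bold>=\<^sub>R" 50) where
  "(x \<^bold>=\<^sub>R y) = (\<^bold>\<forall>n\<^bold>:T0.
     decode (x \<cdot> n) (\<lambda>p. decode (y \<cdot> n) (\<lambda>q. rabs_le (rsub p q) (dyad (\<^bold>1 \<^bold>+ \<^bold>1) n))))"

text \<open>$x <_{\mathbb{R}} y$ iff $x_n + 2^{-n+1} < y_n$ for some $n$.\<close>

definition real_less :: "otm \<Rightarrow> otm \<Rightarrow> ofm"  (infix "\<^bold><\<^sub>R" 50) where
  "(x \<^bold><\<^sub>R y) = (\<^bold>\<exists>n\<^bold>:T0.
     decode (x \<cdot> n) (\<lambda>p. decode (y \<cdot> n) (\<lambda>q. rless (radd p (dyad (\<^bold>1 \<^bold>+ \<^bold>1) n)) q)))"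

definition real_le :: "otm \<Rightarrow> otm \<Rightarrow> ofm"  (infix "\<^bold>\<le>\<^sub>R" 50) where
  "(x \<^bold>\<le>\<^sub>R y) = (\<^bold>\<not> y \<^bold><\<^sub>R x)"

text \<open>The next two predicates express $|x - y| <_{\mathbb{R}} e$ and $x + y =_{\mathbb{R}} z$
  directly on the approximations.  As $|x - x_n| \le 2^{-n}$, three approximations are off by at
  most $3 \cdot 2^{-n}$ in total.\<close>

definition dist_less :: "otm \<Rightarrow> otm \<Rightarrow> otm \<Rightarrow> ofm" where
  "dist_less x y e = (\<^bold>\<exists>n\<^bold>:T0. decode (x \<cdot> n) (\<lambda>p. decode (y \<cdot> n) (\<lambda>q. decode (e \<cdot> n) (\<lambda>r.
     rabs_less (rsub p q) (rsub r (dyad (\<^bold>1 \<^bold>+ \<^bold>1 \<^bold>+ \<^bold>1) n))))))"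

definition is_sum :: "otm \<Rightarrow> otm \<Rightarrow> otm \<Rightarrow> ofm" where
  "is_sum x y z = (\<^bold>\<forall>n\<^bold>:T0. decode (x \<cdot> n) (\<lambda>p. decode (y \<cdot> n) (\<lambda>q. decode (z \<cdot> n) (\<lambda>r.
     rabs_le (rsub (radd p q) r) (dyad (\<^bold>1 \<^bold>+ \<^bold>1 \<^bold>+ \<^bold>1) n)))))"

text \<open>The real given by the constant sequence of a rational.\<close>

definition of_rat :: "otm \<Rightarrow> otm" where
  "of_rat q = o_cn (CK T0 T0) \<cdot> q"
definition real0 :: otm  ("\<^bold>0\<^sub>R") where "\<^bold>0\<^sub>R = of_rat (rat_code \<^bold>0 \<^bold>0 \<^bold>0)"
definition real1 :: otm  ("\<^bold>1\<^sub>R") where "\<^bold>1\<^sub>R = of_rat (rat_code \<^bold>1 \<^bold>0 \<^bold>0)"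

definition interval :: "otm \<Rightarrow> otm \<Rightarrow> otm \<Rightarrow> ofm" where
  "interval a b x = (Real x \<^bold>\<and> a \<^bold>\<le>\<^sub>R x \<^bold>\<and> x \<^bold>\<le>\<^sub>R b)"

abbreviation Unit :: "otm \<Rightarrow> ofm" where
  "Unit \<equiv> interval \<^bold>0\<^sub>R \<^bold>1\<^sub>R"

definition PosReal :: "otm \<Rightarrow> ofm" where
  "PosReal x = (Real x \<^bold>\<and> \<^bold>0\<^sub>R \<^bold><\<^sub>R x)"

section \<open>Sets of reals and finiteness\<close>

text \<open>\<open>X\<close> of type 2 is the characteristic function of a set of reals.\<close>

definition is_set :: "otm \<Rightarrow> ofm" where
  "is_set X =
   ((\<^bold>\<forall>x\<^bold>\<in>Real. X \<cdot> x \<^bold>= \<^bold>0 \<^bold>\<or> X \<cdot> x \<^bold>= \<^bold>1) \<^bold>\<and>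
    (\<^bold>\<forall>x\<^bold>\<in>Real. \<^bold>\<forall>y\<^bold>\<in>Real. x \<^bold>=\<^sub>R y \<^bold>\<longrightarrow> X \<cdot> x \<^bold>= X \<cdot> y))"

definition elem :: "otm \<Rightarrow> otm \<Rightarrow> ofm" where
  "elem X x = (X \<cdot> x \<^bold>= \<^bold>1)"

text \<open>Finite sequences of type 1 objects are given by initial segments of \<open>w\<close> of type
  \<open>T0 \<Rrightarrow> T1\<close>.\<close>

definition finite_set :: "(otm \<Rightarrow> ofm) \<Rightarrow> ofm" where
  "finite_set A =
   (\<^bold>\<exists>N\<^bold>:T0. \<^bold>\<forall>w\<^bold>:T0 \<Rrightarrow> T1.
      (\<^bold>\<forall>i\<^bold>:T0. i \<^bold>\<le> N \<^bold>\<longrightarrow> Real (w \<cdot> i)) \<^bold>\<and>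
      (\<^bold>\<forall>i\<^bold>:T0. \<^bold>\<forall>j\<^bold>:T0. i \<^bold>< j \<^bold>\<and> j \<^bold>\<le> N \<^bold>\<longrightarrow> \<^bold>\<not> w \<cdot> i \<^bold>=\<^sub>R w \<cdot> j)
      \<^bold>\<longrightarrow> (\<^bold>\<exists>i\<^bold>:T0. i \<^bold>\<le> N \<^bold>\<and> \<^bold>\<not> A (w \<cdot> i)))"

definition FIN_union :: ofm where
  "FIN_union =
   (\<^bold>\<forall>X\<^bold>:T0 \<Rrightarrow> T2. (\<^bold>\<forall>n\<^bold>:T0. is_set (X \<cdot> n) \<^bold>\<and> finite_set (elem (X \<cdot> n))) \<^bold>\<longrightarrow>
      (\<^bold>\<forall>k\<^bold>:T0. finite_set (\<lambda>x. \<^bold>\<exists>n\<^bold>:T0. n \<^bold>\<le> k \<^bold>\<and> elem (X \<cdot> n) x)))"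

definition FIN_enum :: ofm where
  "FIN_enum =
   (\<^bold>\<forall>X\<^bold>:T2. is_set X \<^bold>\<and> finite_set (elem X) \<^bold>\<longrightarrow>
      (\<^bold>\<exists>w\<^bold>:T0 \<Rrightarrow> T1. \<^bold>\<exists>m\<^bold>:T0.
         (\<^bold>\<forall>i\<^bold>:T0. i \<^bold>< m \<^bold>\<longrightarrow> Real (w \<cdot> i)) \<^bold>\<and>
         (\<^bold>\<forall>x\<^bold>\<in>Real. elem X x \<^bold>\<longrightarrow> (\<^bold>\<exists>i\<^bold>:T0. i \<^bold>< m \<^bold>\<and> x \<^bold>=\<^sub>R w \<cdot> i))))"

definition Cantor :: "otm \<Rightarrow> ofm" where
  "Cantor f = (\<^bold>\<forall>n\<^bold>:T0. f \<cdot> n \<^bold>= \<^bold>0 \<^bold>\<or> f \<cdot> n \<^bold>= \<^bold>1)"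

definition FIN_choice :: ofm where
  "FIN_choice =
   (\<^bold>\<forall>Y\<^bold>:T1 \<Rrightarrow> T0 \<Rrightarrow> T0. \<^bold>\<forall>k\<^bold>:T0.
      (\<^bold>\<forall>n\<^bold>:T0. n \<^bold>\<le> k \<^bold>\<longrightarrow> (\<^bold>\<exists>f\<^bold>\<in>Cantor. Y \<cdot> f \<cdot> n \<^bold>= \<^bold>0)) \<^bold>\<longrightarrow>
      (\<^bold>\<exists>w\<^bold>:T0 \<Rrightarrow> T1. \<^bold>\<forall>n\<^bold>:T0. n \<^bold>\<le> k \<^bold>\<longrightarrow> Y \<cdot> (w \<cdot> n) \<cdot> n \<^bold>= \<^bold>0))"

definition FIN :: "fm set" where
  "FIN = {sentence FIN_union, sentence FIN_enum, sentence FIN_choice}"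

definition height_countable :: "(otm \<Rightarrow> ofm) \<Rightarrow> ofm" where
  "height_countable A =
   (\<^bold>\<exists>H\<^bold>:T2. (\<^bold>\<forall>x\<^bold>\<in>Real. \<^bold>\<forall>y\<^bold>\<in>Real. x \<^bold>=\<^sub>R y \<^bold>\<longrightarrow> H \<cdot> x \<^bold>= H \<cdot> y) \<^bold>\<and>
      (\<^bold>\<forall>n\<^bold>:T0. finite_set (\<lambda>x. A x \<^bold>\<and> H \<cdot> x \<^bold>< n)))"

definition NIN_alt :: ofm where
  "NIN_alt = (\<^bold>\<not> height_countable Unit)"

section \<open>Functions on the unit interval\<close>

text \<open>\<open>f\<close> of type \<open>T1 \<Rrightarrow> T1\<close> represents a function $[0,1] \to \mathbb{R}$.\<close>

definition unit_fun :: "otm \<Rightarrow> ofm" where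
  "unit_fun f =
   ((\<^bold>\<forall>x\<^bold>\<in>Unit. Real (f \<cdot> x)) \<^bold>\<and>
    (\<^bold>\<forall>x\<^bold>\<in>Unit. \<^bold>\<forall>y\<^bold>\<in>Unit. x \<^bold>=\<^sub>R y \<^bold>\<longrightarrow> f \<cdot> x \<^bold>=\<^sub>R f \<cdot> y))"

definition continuous_at :: "otm \<Rightarrow> otm \<Rightarrow> ofm" where
  "continuous_at f x =
   (\<^bold>\<forall>\<epsilon>\<^bold>\<in>PosReal. \<^bold>\<exists>\<delta>\<^bold>\<in>PosReal. \<^bold>\<forall>y\<^bold>\<in>Unit. dist_less x y \<delta> \<^bold>\<longrightarrow> dist_less (f \<cdot> x) (f \<cdot> y) \<epsilon>)"

definition right_limit :: "otm \<Rightarrow> otm \<Rightarrow> otm \<Rightarrow> ofm" where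
  "right_limit f x l =
   (\<^bold>\<forall>\<epsilon>\<^bold>\<in>PosReal. \<^bold>\<exists>\<delta>\<^bold>\<in>PosReal. \<^bold>\<forall>y\<^bold>\<in>Unit.
      x \<^bold><\<^sub>R y \<^bold>\<and> dist_less x y \<delta> \<^bold>\<longrightarrow> dist_less (f \<cdot> y) l \<epsilon>)"

definition left_limit :: "otm \<Rightarrow> otm \<Rightarrow> otm \<Rightarrow> ofm" where
  "left_limit f x l =
   (\<^bold>\<forall>\<epsilon>\<^bold>\<in>PosReal. \<^bold>\<exists>\<delta>\<^bold>\<in>PosReal. \<^bold>\<forall>y\<^bold>\<in>Unit.
      y \<^bold><\<^sub>R x \<^bold>\<and> dist_less x y \<delta> \<^bold>\<longrightarrow> dist_less (f \<cdot> y) l \<epsilon>)"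

definition regulated :: "otm \<Rightarrow> ofm" where
  "regulated f =
   (\<^bold>\<forall>x\<^bold>\<in>Unit. (x \<^bold><\<^sub>R \<^bold>1\<^sub>R \<^bold>\<longrightarrow> (\<^bold>\<exists>l\<^bold>\<in>Real. right_limit f x l)) \<^bold>\<and>
             (\<^bold>0\<^sub>R \<^bold><\<^sub>R x \<^bold>\<longrightarrow> (\<^bold>\<exists>l\<^bold>\<in>Real. left_limit f x l)))"

definition is_supremum :: "otm \<Rightarrow> otm \<Rightarrow> otm \<Rightarrow> otm \<Rightarrow> ofm" where
  "is_supremum f a b s =
   ((\<^bold>\<forall>x\<^bold>\<in>interval a b. f \<cdot> x \<^bold>\<le>\<^sub>R s) \<^bold>\<and>
    (\<^bold>\<forall>t\<^bold>\<in>Real. (\<^bold>\<forall>x\<^bold>\<in>interval a b. f \<cdot> x \<^bold>\<le>\<^sub>R t) \<^bold>\<longrightarrow> s \<^bold>\<le>\<^sub>R t))"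

text \<open>$F : \mathbb{Q}^2 \to \mathbb{R}$; as rationals have several codes, \<open>F\<close> must respect
  equality of rationals.  The supremum is required for $p \le q$, where $[p,q]$ is inhabited.\<close>

definition rat_fun2 :: "otm \<Rightarrow> ofm" where
  "rat_fun2 F =
   (\<^bold>\<forall>p\<^bold>:T0. \<^bold>\<forall>q\<^bold>:T0. is_rat p \<^bold>\<and> is_rat q \<^bold>\<longrightarrow> Real (F \<cdot> p \<cdot> q) \<^bold>\<and>
      (\<^bold>\<forall>p'\<^bold>:T0. \<^bold>\<forall>q'\<^bold>:T0. is_rat p' \<^bold>\<and> is_rat q' \<^bold>\<and> of_rat p \<^bold>=\<^sub>R of_rat p' \<^bold>\<and> of_rat q \<^bold>=\<^sub>R of_rat q'
         \<^bold>\<longrightarrow> F \<cdot> p \<cdot> q \<^bold>=\<^sub>R F \<cdot> p' \<cdot> q'))"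

definition supremum_functional :: "otm \<Rightarrow> otm \<Rightarrow> ofm" where
  "supremum_functional f F =
   (rat_fun2 F \<^bold>\<and>
    (\<^bold>\<forall>p\<^bold>:T0. \<^bold>\<forall>q\<^bold>:T0. is_rat p \<^bold>\<and> is_rat q \<^bold>\<and> Unit (of_rat p) \<^bold>\<and> Unit (of_rat q) \<^bold>\<and> of_rat p \<^bold>\<le>\<^sub>R of_rat q
       \<^bold>\<longrightarrow> is_supremum f (of_rat p) (of_rat q) (F \<cdot> p \<cdot> q)))"

definition has_supremum_functional :: "otm \<Rightarrow> ofm" where
  "has_supremum_functional f = (\<^bold>\<exists>F\<^bold>:T0 \<Rrightarrow> T0 \<Rrightarrow> T1. supremum_functional f F)"

text \<open>$f(x) \le \liminf_{y \to x} f(y) = \sup_{\delta > 0} \inf_{0 < |x - y| < \delta} f(y)$, where the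
  right-hand side is an extended real: each $a < f(x)$ is a lower bound of \<open>f\<close> on some punctured
  neighbourhood of \<open>x\<close>.\<close>

definition lower_semicontinuous :: "otm \<Rightarrow> ofm" where
  "lower_semicontinuous f =
   (\<^bold>\<forall>x\<^bold>\<in>Unit. \<^bold>\<forall>a\<^bold>\<in>Real. a \<^bold><\<^sub>R f \<cdot> x \<^bold>\<longrightarrow>
      (\<^bold>\<exists>\<delta>\<^bold>\<in>PosReal. \<^bold>\<forall>y\<^bold>\<in>Unit. \<^bold>\<not> y \<^bold>=\<^sub>R x \<^bold>\<and> dist_less x y \<delta> \<^bold>\<longrightarrow> a \<^bold>\<le>\<^sub>R f \<cdot> y))"

text \<open>In the following definition $u = x + z$ and $v = x - z$.\<close>

definition symmetrically_continuous :: "otm \<Rightarrow> ofm" where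
  "symmetrically_continuous f =
   (\<^bold>\<forall>x\<^bold>\<in>Unit. \<^bold>\<forall>\<epsilon>\<^bold>\<in>PosReal. \<^bold>\<exists>\<delta>\<^bold>\<in>PosReal. \<^bold>\<forall>z\<^bold>\<in>Real. \<^bold>\<forall>u\<^bold>\<in>Unit. \<^bold>\<forall>v\<^bold>\<in>Unit.
      dist_less z \<^bold>0\<^sub>R \<delta> \<^bold>\<and> is_sum x z u \<^bold>\<and> is_sum v z x \<^bold>\<longrightarrow> dist_less (f \<cdot> u) (f \<cdot> v) \<epsilon>)"

section \<open>The three continuity principles\<close>

definition cont_point_sup :: ofm where
  "cont_point_sup =
   (\<^bold>\<forall>f\<^bold>:T1 \<Rrightarrow> T1. unit_fun f \<^bold>\<and> regulated f \<^bold>\<and> has_supremum_functional f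
      \<^bold>\<longrightarrow> (\<^bold>\<exists>x\<^bold>\<in>Unit. continuous_at f x))"

definition cont_point_lsc_sup :: ofm where
  "cont_point_lsc_sup =
   (\<^bold>\<forall>f\<^bold>:T1 \<Rrightarrow> T1. unit_fun f \<^bold>\<and> regulated f \<^bold>\<and> lower_semicontinuous f \<^bold>\<and> has_supremum_functional f
      \<^bold>\<longrightarrow> (\<^bold>\<exists>x\<^bold>\<in>Unit. continuous_at f x))"

definition cont_point_symm :: ofm where
  "cont_point_symm =
   (\<^bold>\<forall>f\<^bold>:T1 \<Rrightarrow> T1. unit_fun f \<^bold>\<and> regulated f \<^bold>\<and> symmetrically_continuous f
      \<^bold>\<longrightarrow> (\<^bold>\<exists>x\<^bold>\<in>Unit. continuous_at f x))"

end

theory Submission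
  imports Defs "HOL-Library.Countable" "HOL-Computational_Algebra.Fraction_Field"
begin

text \<open>Derivability is reduced to truth in models: the calculus admits Henkin's construction, and as
  all open assumptions are finite lists a fresh parameter is always at hand, so no weakening or
  renaming of derivations is needed.  By the extensionality axioms the term model may be divided by
  extensional equality.  Its numbers form a discretely ordered semiring, over which rational
  numbers are the elements of an honest ordered field, and arithmetical comprehension (from the
  combinators, \<open>Exists2\<close> and \<open>QF_AC T1 T0\<close>) becomes a closure property of a class of
  definable functions.

  In a model let \<open>f\<close> be regulated and nowhere continuous.  Its one-sided limits make the
  oscillation at \<open>x\<close> visible on rational points, so that the set of points with oscillation at least
  \<open>2\<^sup>-\<^sup>n\<close> is arithmetical in \<open>f\<close>.  If such a set were not finite, \<open>FIN_union\<close> applied to the cells of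
  a grid would give two distinct members at distance less than \<open>2\<^sup>-\<^sup>k\<close> for every \<open>k\<close>; choosing such
  pairs with \<open>QF_AC T0 T1\<close> and passing to a cluster point contradicts the existence of one-sided
  limits there.  Hence the least \<open>n\<close> with oscillation at least \<open>2\<^sup>-\<^sup>n\<close> is a height function on the unit
  interval.

  Conversely, let \<open>H\<close> be a height function on the unit interval.  Then \<open>f(x) = -1/(H(x) + 1)\<close> tends to
  \<open>0\<close> at every point, as \<open>FIN_enum\<close> keeps the finite set \<open>H(x) < n\<close> away from a punctured neighbourhood.
  So \<open>f\<close> is regulated, lower semi-continuous, symmetrically continuous and nowhere continuous, and
  its supremum is \<open>0\<close> on every nondegenerate interval.\<close>

section \<open>Henkin's construction\<close>

text \<open>The obstacle is that a model need not have standard numbers. Every induction, every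
  least element and every choice must go through a predicate known to be represented in the model.
  The predicates \<open>dfn\<close>, \<open>dn\<close>, \<open>dp\<close> and \<open>dq\<close>
  derive this from the shape of the expression. This is why relations between reals occur in two
  forms: an arithmetical one with codes and dyadic bounds \<open>hh k\<close>, which is definable,
  and one with arbitrary rational bounds, which is convenient for estimates.

  The axiom schemes range over formulas and not over subsets of the model. As each element of the
  countermodel is the value of a closed term, an arbitrary represented function can be inserted as a
  parameter, and the single equation saying that its value is 1 yields the scheme for all definable
  predicates.\<close>

instance ty :: countable by countable_datatype
instance cnst :: countable by countable_datatype
instance trm :: countable by countable_datatype
instance fm :: countable by countable_datatype

lemma finite_pars_tm: "finite (pars_tm t)"
  by (induction t) auto

lemma finite_pars: "finite (pars \<phi>)"
  by (induction \<phi>) (auto simp: finite_pars_tm)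

lemma fresh_par: "\<exists>a. (a, \<rho>) \<notin> pars \<phi> \<and> (\<forall>\<gamma>\<in>set \<Gamma>. (a, \<rho>) \<notin> pars \<gamma>)"
proof -
  have "finite (fst ` (pars \<phi> \<union> (\<Union>\<gamma>\<in>set \<Gamma>. pars \<gamma>)))"
    by (simp add: finite_pars)
  then obtain a where "a \<notin> fst ` (pars \<phi> \<union> (\<Union>\<gamma>\<in>set \<Gamma>. pars \<gamma>))"
    using ex_new_if_finite infinite_UNIV_nat by blast
  then show ?thesis by force
qed

text \<open>A universal formula that is refused gets its counterexample at the same stage: the
  negated instance at a fresh parameter enters together with the negation. The limit is then closed
  under witnesses without separate Henkin axioms.\<close>

definition add_neg :: "fm \<Rightarrow> fm list \<Rightarrow> fm list" where
  "add_neg \<psi> \<Gamma> = (case \<psi> of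
     Forall \<rho> \<chi> \<Rightarrow>
       Imp (inst (Par (SOME a. (a, \<rho>) \<notin> pars \<chi> \<and> (\<forall>\<gamma>\<in>set (Imp \<psi> Bot # \<Gamma>). (a, \<rho>) \<notin> pars \<gamma>)) \<rho>) \<chi>) Bot
       # Imp \<psi> Bot # \<Gamma>
   | _ \<Rightarrow> Imp \<psi> Bot # \<Gamma>)"

text \<open>The enumeration \<open>from_nat\<close> reaches every formula, ill-typed ones included,
  so maximality of the limit involves no typing condition.\<close>

primrec henkin :: "fm set \<Rightarrow> fm \<Rightarrow> nat \<Rightarrow> fm list" where
  "henkin T \<phi> 0 = [Imp \<phi> Bot]"
| "henkin T \<phi> (Suc n) =
     (if T; from_nat n # henkin T \<phi> n \<turnstile> Bot then add_neg (from_nat n) (henkin T \<phi> n)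
      else from_nat n # henkin T \<phi> n)"

text \<open>If the negated instance led to a contradiction, \<open>RAA\<close> would derive the
  instance itself; its parameter is fresh, so \<open>AllI\<close> would derive the universal
  formula, against its negation.\<close>

lemma not_derives_add_neg:
  assumes "\<not> (T; \<Gamma> \<turnstile> Bot)" and "T; \<psi> # \<Gamma> \<turnstile> Bot"
  shows "\<not> (T; add_neg \<psi> \<Gamma> \<turnstile> Bot)"
proof -
  have *: "\<not> (T; Imp \<psi> Bot # \<Gamma> \<turnstile> Bot)"
    using assms derives.ImpI derives.ImpE derives.RAA by metis
  show ?thesis
  proof (cases "\<exists>\<rho> \<chi>. \<psi> = Forall \<rho> \<chi>")
    case True
    then obtain \<rho> \<chi> where \<psi>: "\<psi> = Forall \<rho> \<chi>" by blast
    define a where "a = (SOME a. (a, \<rho>) \<notin> pars \<chi> \<and> (\<forall>\<gamma>\<in>set (Imp \<psi> Bot # \<Gamma>). (a, \<rho>) \<notin> pars \<gamma>))"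
    have a: "(a, \<rho>) \<notin> pars \<chi> \<and> (\<forall>\<gamma>\<in>set (Imp \<psi> Bot # \<Gamma>). (a, \<rho>) \<notin> pars \<gamma>)"
      unfolding a_def by (rule someI_ex) (rule fresh_par)
    have r: "add_neg \<psi> \<Gamma> = Imp (inst (Par a \<rho>) \<chi>) Bot # Imp \<psi> Bot # \<Gamma>"
      unfolding add_neg_def a_def by (simp add: \<psi>)
    show ?thesis
    proof
      assume "T; add_neg \<psi> \<Gamma> \<turnstile> Bot"
      then have "T; Imp \<psi> Bot # \<Gamma> \<turnstile> inst (Par a \<rho>) \<chi>" unfolding r by (rule derives.RAA)
      then have "T; Imp \<psi> Bot # \<Gamma> \<turnstile> \<psi>" unfolding \<psi> using a \<psi> by (intro derives.AllI) auto
      moreover have "T; Imp \<psi> Bot # \<Gamma> \<turnstile> Imp \<psi> Bot" by (rule derives.Asm) simp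
      ultimately show False using * derives.ImpE by metis
    qed
  next
    case False
    then have "add_neg \<psi> \<Gamma> = Imp \<psi> Bot # \<Gamma>" unfolding add_neg_def by (cases \<psi>) auto
    with * show ?thesis by simp
  qed
qed

locale unprovable =
  fixes T :: "fm set" and \<phi> :: fm
  assumes unprovable: "\<not> T \<turnstile>\<^sub>0 \<phi>"
begin

definition M :: "fm set" where "M = (\<Union>n. set (henkin T \<phi> n))"

lemma henkin_consistent: "\<not> (T; henkin T \<phi> n \<turnstile> Bot)"
proof (induction n)
  case 0
  then show ?case using unprovable derives.RAA unfolding provable_def by auto
next
  case (Suc n)
  then show ?case by (auto simp: not_derives_add_neg)
qed

lemma add_neg_superset: "insert (Imp \<psi> Bot) (set \<Gamma>) \<subseteq> set (add_neg \<psi> \<Gamma>)"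
  unfolding add_neg_def by (cases \<psi>) auto

lemma henkin_mono: "m \<le> n \<Longrightarrow> set (henkin T \<phi> m) \<subseteq> set (henkin T \<phi> n)"
  by (induction n rule: dec_induct) (use add_neg_superset in \<open>auto\<close>)

lemma M_finite_subset:
  assumes "finite F" "F \<subseteq> M"
  obtains n where "F \<subseteq> set (henkin T \<phi> n)"
proof -
  have "\<exists>n. F \<subseteq> set (henkin T \<phi> n)"
    using assms
  proof (induction F)
    case (insert \<psi> F)
    then obtain n m where "F \<subseteq> set (henkin T \<phi> n)" "\<psi> \<in> set (henkin T \<phi> m)" by (auto simp: M_def)
    then have "insert \<psi> F \<subseteq> set (henkin T \<phi> (max n m))"
      using henkin_mono[of n "max n m"] henkin_mono[of m "max n m"] by auto
    then show ?case by blast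
  qed auto
  then show thesis using that by blast
qed

text \<open>The derivation is demanded from every list containing \<Delta> because it is applied to
  the whole stage at which all of \<Delta> has been collected. This takes the place of an admissible
  weakening rule.\<close>

lemma M_derives:
  assumes "set \<Delta> \<subseteq> M" "\<And>\<Gamma>. set \<Delta> \<subseteq> set \<Gamma> \<Longrightarrow> T; \<Gamma> \<turnstile> Bot"
  shows False
  using M_finite_subset[OF _ assms(1)] assms(2) henkin_consistent by (metis List.finite_set)

lemma M_Bot: "Bot \<notin> M"
  using M_derives[of "[Bot]"] derives.Asm by auto

lemma M_cases: "\<psi> \<in> M \<or> Imp \<psi> Bot \<in> M"
proof -
  obtain n where "\<psi> = from_nat n" by (metis from_nat_to_nat)
  then have "\<psi> \<in> set (henkin T \<phi> (Suc n)) \<or> Imp \<psi> Bot \<in> set (henkin T \<phi> (Suc n))"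
    using add_neg_superset[of \<psi> "henkin T \<phi> n"] by auto
  then show ?thesis unfolding M_def by blast
qed

lemma M_not: "Imp \<psi> Bot \<in> M \<longleftrightarrow> \<psi> \<notin> M"
proof -
  have "T; \<Gamma> \<turnstile> Bot" if "set [\<psi>, Imp \<psi> Bot] \<subseteq> set \<Gamma>" for \<Gamma>
    by (rule derives.ImpE[where \<phi> = \<psi>, OF derives.Asm derives.Asm]) (use that in auto)
  then show ?thesis using M_derives[of "[\<psi>, Imp \<psi> Bot]"] M_cases[of \<psi>] by auto
qed

lemma M_closed:
  assumes "set \<Delta> \<subseteq> M" "\<And>\<Gamma>. set \<Delta> \<subseteq> set \<Gamma> \<Longrightarrow> T; \<Gamma> \<turnstile> \<psi>"
  shows "\<psi> \<in> M"
proof (rule ccontr)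
  assume "\<psi> \<notin> M"
  then have "set (Imp \<psi> Bot # \<Delta>) \<subseteq> M" using assms(1) M_not by auto
  moreover have "T; \<Gamma> \<turnstile> Bot" if "set (Imp \<psi> Bot # \<Delta>) \<subseteq> set \<Gamma>" for \<Gamma>
    by (rule derives.ImpE[of T \<Gamma> \<psi> Bot, OF derives.Asm]) (use that assms(2)[of \<Gamma>] in auto)
  ultimately show False using M_derives by blast
qed

lemma M_axioms: "T \<subseteq> M"
  using M_closed[of "[]"] derives.Axm by auto

lemma M_Imp: "Imp \<psi> \<chi> \<in> M \<longleftrightarrow> (\<psi> \<in> M \<longrightarrow> \<chi> \<in> M)"
proof (intro iffI impI)
  assume "Imp \<psi> \<chi> \<in> M" "\<psi> \<in> M"
  moreover have "T; \<Gamma> \<turnstile> \<chi>" if "set [Imp \<psi> \<chi>, \<psi>] \<subseteq> set \<Gamma>" for \<Gamma>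
    by (rule derives.ImpE[where \<phi> = \<psi>, OF derives.Asm derives.Asm]) (use that in auto)
  ultimately show "\<chi> \<in> M" using M_closed[of "[Imp \<psi> \<chi>, \<psi>]"] by auto
next
  assume *: "\<psi> \<in> M \<longrightarrow> \<chi> \<in> M"
  show "Imp \<psi> \<chi> \<in> M"
  proof (cases "\<chi> \<in> M")
    case True
    moreover have "T; \<Gamma> \<turnstile> Imp \<psi> \<chi>" if "set [\<chi>] \<subseteq> set \<Gamma>" for \<Gamma>
      using that by (intro derives.ImpI derives.Asm) auto
    ultimately show ?thesis using M_closed[of "[\<chi>]"] by auto
  next
    case False
    then have "Imp \<psi> Bot \<in> M" using * M_not by auto
    moreover have "T; \<Gamma> \<turnstile> Imp \<psi> \<chi>" if "set [Imp \<psi> Bot] \<subseteq> set \<Gamma>" for \<Gamma>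
    proof -
      have "T; Imp \<chi> Bot # \<psi> # \<Gamma> \<turnstile> Bot"
        by (rule derives.ImpE[where \<phi> = \<psi>, OF derives.Asm derives.Asm]) (use that in auto)
      then show ?thesis by (rule derives.ImpI[OF derives.RAA])
    qed
    ultimately show ?thesis using M_closed[of "[Imp \<psi> Bot]"] by auto
  qed
qed

lemma M_Forall: "Forall \<rho> \<chi> \<in> M \<longleftrightarrow> (\<forall>t. ty_of [] t = Some \<rho> \<longrightarrow> inst t \<chi> \<in> M)"
proof (intro iffI allI impI)
  fix t assume "Forall \<rho> \<chi> \<in> M" "ty_of [] t = Some \<rho>"
  then show "inst t \<chi> \<in> M"
    using M_closed[of "[Forall \<rho> \<chi>]" "inst t \<chi>"] derives.AllE[OF derives.Asm] by auto
next
  assume *: "\<forall>t. ty_of [] t = Some \<rho> \<longrightarrow> inst t \<chi> \<in> M"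
  show "Forall \<rho> \<chi> \<in> M"
  proof (rule ccontr)
    assume nin: "Forall \<rho> \<chi> \<notin> M"
    obtain n where n: "Forall \<rho> \<chi> = from_nat n" by (metis from_nat_to_nat)
    \<comment> \<open>A formula accepted at its own stage would lie in \<open>M\<close>. So this one
      was refused, and the refusal supplied a witness.\<close>
    have "T; from_nat n # henkin T \<phi> n \<turnstile> Bot"
    proof (rule ccontr)
      assume "\<not> ?thesis"
      then have "Forall \<rho> \<chi> \<in> set (henkin T \<phi> (Suc n))" by (simp add: n)
      with nin show False unfolding M_def by blast
    qed
    then have "henkin T \<phi> (Suc n) = add_neg (Forall \<rho> \<chi>) (henkin T \<phi> n)" by (simp add: n)
    then obtain a where "Imp (inst (Par a \<rho>) \<chi>) Bot \<in> set (henkin T \<phi> (Suc n))"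
      unfolding add_neg_def by auto
    then have "Imp (inst (Par a \<rho>) \<chi>) Bot \<in> M" unfolding M_def by blast
    with * show False by (simp add: M_not)
  qed
qed

lemma goal_notin_M: "\<phi> \<notin> M"
proof -
  have "Imp \<phi> Bot \<in> set (henkin T \<phi> 0)" by simp
  then have "Imp \<phi> Bot \<in> M" unfolding M_def by (rule UN_I[OF UNIV_I])
  then show ?thesis by (simp add: M_not)
qed

end

section \<open>Structures for the language of all finite types\<close>

text \<open>All object types share one carrier and \<open>dm\<close> cuts out the domain of each,
  since a HOL type cannot depend on a \<open>ty\<close>. Application is total but meaningful only on
  matching domains.\<close>

record 'u struct =
  dm :: "ty \<Rightarrow> 'u set"
  ap :: "'u \<Rightarrow> 'u \<Rightarrow> 'u"
  cn :: "cnst \<Rightarrow> 'u"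
  pr :: "nat \<Rightarrow> ty \<Rightarrow> 'u"
  eqr :: "'u \<Rightarrow> 'u \<Rightarrow> bool"
  lsr :: "'u \<Rightarrow> 'u \<Rightarrow> bool"

primrec eval :: "'u struct \<Rightarrow> 'u list \<Rightarrow> trm \<Rightarrow> 'u" where
  "eval S e (Bnd i) = e ! i"
| "eval S e (Par a \<rho>) = pr S a \<rho>"
| "eval S e (Cn c) = cn S c"
| "eval S e (App s t) = ap S (eval S e s) (eval S e t)"

primrec sat :: "'u struct \<Rightarrow> 'u list \<Rightarrow> fm \<Rightarrow> bool" where
  "sat S e Bot = False"
| "sat S e (Eq s t) = eqr S (eval S e s) (eval S e t)"
| "sat S e (Less s t) = lsr S (eval S e s) (eval S e t)"
| "sat S e (Imp \<phi> \<psi>) = (sat S e \<phi> \<longrightarrow> sat S e \<psi>)"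
| "sat S e (Forall \<rho> \<phi>) = (\<forall>v\<in>dm S \<rho>. sat S (v # e) \<phi>)"

text \<open>A depth-indexed term or formula is interpreted under an environment by taking the length
  of the environment as the depth.  \<open>stab S e x\<close> says that \<open>x\<close> keeps its meaning under
  additional quantifiers.\<close>

definition den :: "'u struct \<Rightarrow> 'u list \<Rightarrow> otm \<Rightarrow> 'u" where
  "den S e x = eval S e (x (length e))"
definition hol :: "'u struct \<Rightarrow> 'u list \<Rightarrow> ofm \<Rightarrow> bool" where
  "hol S e P = sat S e (P (length e))"
definition var :: "nat \<Rightarrow> otm" where
  "var d = (\<lambda>e. Bnd (e - Suc d))"
definition stab :: "'u struct \<Rightarrow> 'u list \<Rightarrow> otm \<Rightarrow> bool" where
  "stab S e x \<longleftrightarrow> (\<forall>vs. den S (vs @ e) x = den S e x)"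

named_theorems hol_simps

lemma den_simps [hol_simps]:
  "den S e (o_cn c) = cn S c"
  "den S e (s \<cdot> t) = ap S (den S e s) (den S e t)"
  "den S (v # e) (var (length e)) = v"
  by (simp_all add: den_def o_cn_def o_app_def var_def)

lemma den_Cons [hol_simps]: "stab S e x \<Longrightarrow> den S (v # e) x = den S e x"
  unfolding stab_def by (metis append_Cons append_Nil)

lemma stab_simps [hol_simps]:
  "k < length e \<Longrightarrow> stab S e (var k)"
  "stab S e (o_cn c)"
  "stab S e s \<Longrightarrow> stab S e t \<Longrightarrow> stab S e (s \<cdot> t)"
    apply (simp_all add: stab_def den_simps)
  apply (auto simp: den_def var_def nth_append)
  done

lemma stab_Cons [hol_simps]: "stab S e x \<Longrightarrow> stab S (v # e) x"
  unfolding stab_def by (metis append_Cons append_Nil append_assoc)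

lemma hol_connectives [hol_simps]:
  "hol S e o_bot = False"
  "hol S e (s \<^bold>= t) = eqr S (den S e s) (den S e t)"
  "hol S e (s \<^bold>< t) = lsr S (den S e s) (den S e t)"
  "hol S e (P \<^bold>\<longrightarrow> Q) = (hol S e P \<longrightarrow> hol S e Q)"
  "hol S e (\<^bold>\<not> P) = (\<not> hol S e P)"
  "hol S e (P \<^bold>\<or> Q) = (hol S e P \<or> hol S e Q)"
  "hol S e (P \<^bold>\<and> Q) = (hol S e P \<and> hol S e Q)"
  "hol S e (P \<^bold>\<longleftrightarrow> Q) = (hol S e P \<longleftrightarrow> hol S e Q)"
  by (auto simp: hol_def den_def o_bot_def o_eq_def o_less_def o_imp_def o_not_def o_or_def
      o_and_def o_iff_def)

lemma hol_all [hol_simps]: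
  "hol S e (o_all \<rho> F) = (\<forall>v\<in>dm S \<rho>. hol S (v # e) (F (var (length e))))"
  by (simp add: hol_def o_all_def var_def)

lemma hol_ex [hol_simps]:
  "hol S e (o_ex \<rho> F) = (\<exists>v\<in>dm S \<rho>. hol S (v # e) (F (var (length e))))"
  by (simp add: o_ex_def hol_all hol_simps)

lemma hol_ball [hol_simps]:
  "hol S e (o_ball A P) = (\<forall>v\<in>dm S T1. hol S (v # e) (A (var (length e))) \<longrightarrow> hol S (v # e) (P (var (length e))))"
  by (simp add: o_ball_def hol_all hol_simps)

lemma hol_bex [hol_simps]:
  "hol S e (o_bex A P) = (\<exists>v\<in>dm S T1. hol S (v # e) (A (var (length e))) \<and> hol S (v # e) (P (var (length e))))"
  by (simp add: o_bex_def hol_ex hol_simps)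

lemma sat_sentence: "sat S [] (sentence P) = hol S [] P"
  by (simp add: hol_def sentence_def)

primrec ext_eq :: "'u struct \<Rightarrow> ty \<Rightarrow> 'u \<Rightarrow> 'u \<Rightarrow> bool" where
  "ext_eq S T0 s t = eqr S s t"
| "ext_eq S (\<rho> \<Rrightarrow> \<tau>) s t = (\<forall>x\<in>dm S \<rho>. ext_eq S \<tau> (ap S s x) (ap S t x))"

lemma hol_eq_at:
  "stab S e s \<Longrightarrow> stab S e t \<Longrightarrow> hol S e (eq_at \<rho> s t) = ext_eq S \<rho> (den S e s) (den S e t)"
proof (induction \<rho> arbitrary: e s t)
  case (Arr \<rho> \<tau>)
  then show ?case by (simp add: hol_simps)
qed (simp add: hol_simps)

lemma hol_extensionality:
  "hol S [] (extensionality \<rho> \<tau>) =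
   (\<forall>x\<in>dm S \<rho>. \<forall>y\<in>dm S \<rho>. \<forall>f\<in>dm S (\<rho> \<Rrightarrow> \<tau>). ext_eq S \<rho> x y \<longrightarrow> ext_eq S \<tau> (ap S f x) (ap S f y))"
  using den_simps(3)[of S _ "[]"] den_simps(3)[of S _ "[_]"] den_simps(3)[of S _ "[_,_]"]
  by (simp add: extensionality_def hol_simps hol_eq_at)

section \<open>Countermodels\<close>

lemma subst_tm_comp: "subst_tm \<sigma> (subst_tm \<theta> t) = subst_tm (\<lambda>i. subst_tm \<sigma> (\<theta> i)) t"
  by (induction t) auto

lemma lift_subst_comp: "subst_tm (lift_subst \<sigma>) (lift_subst \<theta> i) = lift_subst (\<lambda>i. subst_tm \<sigma> (\<theta> i)) i"
  by (cases i) (auto simp: lift_subst_def subst_tm_comp)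

lemma subst_comp: "subst \<sigma> (subst \<theta> \<phi>) = subst (\<lambda>i. subst_tm \<sigma> (\<theta> i)) \<phi>"
proof (induction \<phi> arbitrary: \<sigma> \<theta>)
  case (Forall \<rho> \<phi>)
  have "(\<lambda>i. subst_tm (lift_subst \<sigma>) (lift_subst \<theta> i)) = lift_subst (\<lambda>i. subst_tm \<sigma> (\<theta> i))"
    by (rule ext) (rule lift_subst_comp)
  with Forall show ?case by simp
qed (auto simp: subst_tm_comp)

lemma subst_tm_Bnd [simp]: "subst_tm Bnd t = t"
  by (induction t) auto

lemma lift_subst_Bnd [simp]: "lift_subst Bnd = Bnd"
  by (rule ext) (auto simp: lift_subst_def split: nat.split)

lemma subst_Bnd [simp]: "subst Bnd \<phi> = \<phi>"
  by (induction \<phi>) auto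

text \<open>A simultaneous substitution is used so that going under a quantifier merely extends the
  list. Indices beyond the list are lowered, which makes the empty list act as the identity.\<close>

definition env_subst :: "trm list \<Rightarrow> nat \<Rightarrow> trm" where
  "env_subst e i = (if i < length e then e ! i else Bnd (i - length e))"

lemma inst_lift_env_subst: "inst t (subst (lift_subst (env_subst e)) \<phi>) = subst (env_subst (t # e)) \<phi>"
proof -
  have "subst_tm (\<lambda>i. case i of 0 \<Rightarrow> t | Suc j \<Rightarrow> Bnd j) (lift_subst (env_subst e) i) = env_subst (t # e) i" for i
    by (cases i) (auto simp: lift_subst_def env_subst_def subst_tm_comp)
  then show ?thesis unfolding inst_def subst_comp by presburger
qed

lemma ty_of_App: "ty_of \<Delta> (App s t) = Some \<tau> \<longleftrightarrow> (\<exists>\<rho>. ty_of \<Delta> s = Some (\<rho> \<Rrightarrow> \<tau>) \<and> ty_of \<Delta> t = Some \<rho>)"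
  by (auto split: option.splits ty.splits)

text \<open>The last clause names every element by a term without loose variables, possibly with
  free parameters. It is what allows an arbitrary element to occur in an instance of induction or
  choice.\<close>

definition normal :: "'u struct \<Rightarrow> bool" where
  "normal S \<longleftrightarrow> eqr S = (=)
    \<and> (\<forall>\<rho> \<tau>. \<forall>f\<in>dm S (\<rho> \<Rrightarrow> \<tau>). \<forall>x\<in>dm S \<rho>. ap S f x \<in> dm S \<tau>)
    \<and> (\<forall>c. cn S c \<in> dm S (ty_cnst c))
    \<and> (\<forall>\<rho> \<tau>. \<forall>f\<in>dm S (\<rho> \<Rrightarrow> \<tau>). \<forall>g\<in>dm S (\<rho> \<Rrightarrow> \<tau>). (\<forall>x\<in>dm S \<rho>. ap S f x = ap S g x) \<longrightarrow> f = g)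
    \<and> (\<forall>\<rho>. \<forall>c\<in>dm S \<rho>. \<exists>t. ty_of [] t = Some \<rho> \<and> eval S [] t = c)"

section \<open>The term model and its truth lemma\<close>

context unprovable
begin

definition term_struct :: "trm struct" where
  "term_struct = \<lparr>dm = (\<lambda>\<rho>. {t. ty_of [] t = Some \<rho>}), ap = App, cn = Cn, pr = Par,
     eqr = (\<lambda>s t. Eq s t \<in> M), lsr = (\<lambda>s t. Less s t \<in> M)\<rparr>"

lemma term_struct_simps [simp]:
  "dm term_struct \<rho> = {t. ty_of [] t = Some \<rho>}" "ap term_struct = App"
  "cn term_struct = Cn" "pr term_struct = Par"
  "eqr term_struct s t = (Eq s t \<in> M)" "lsr term_struct s t = (Less s t \<in> M)"
  by (simp_all add: term_struct_def)

lemma eval_term_struct: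
  "ty_of \<Delta> t = Some \<tau> \<Longrightarrow> length e = length \<Delta> \<Longrightarrow> eval term_struct e t = subst_tm (env_subst e) t"
  by (induction t arbitrary: \<tau>) (auto simp: env_subst_def ty_of_App simp del: ty_of.simps(4) split: if_splits)

text \<open>The domain of a type consists of the closed terms of that type, and these are exactly
  the instances over which \<open>M_Forall\<close> quantifies.\<close>

lemma sat_term_struct:
  "wff \<Delta> \<psi> \<Longrightarrow> length e = length \<Delta> \<Longrightarrow> sat term_struct e \<psi> \<longleftrightarrow> subst (env_subst e) \<psi> \<in> M"
  by (induction \<psi> arbitrary: \<Delta> e)
    (auto simp: eval_term_struct M_Bot M_Imp M_Forall inst_lift_env_subst)

lemma sat_term_struct_closed: "wff [] \<psi> \<Longrightarrow> sat term_struct [] \<psi> \<longleftrightarrow> \<psi> \<in> M"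
proof -
  have "env_subst [] = Bnd" by (rule ext) (simp add: env_subst_def)
  then show "wff [] \<psi> \<Longrightarrow> ?thesis" by (simp add: sat_term_struct)
qed

end

section \<open>The quotient of the term model by extensional equality\<close>

locale unprovable_ext = unprovable +
  assumes eq_refl: "hol term_struct [] (\<^bold>\<forall>x\<^bold>:T0. x \<^bold>= x)"
    and eq_sym: "hol term_struct [] (\<^bold>\<forall>x\<^bold>:T0. \<^bold>\<forall>y\<^bold>:T0. x \<^bold>= y \<^bold>\<longrightarrow> y \<^bold>= x)"
    and eq_trans: "hol term_struct [] (\<^bold>\<forall>x\<^bold>:T0. \<^bold>\<forall>y\<^bold>:T0. \<^bold>\<forall>z\<^bold>:T0. x \<^bold>= y \<^bold>\<and> y \<^bold>= z \<^bold>\<longrightarrow> x \<^bold>= z)"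
    and less_cong: "hol term_struct [] (\<^bold>\<forall>x\<^bold>:T0. \<^bold>\<forall>y\<^bold>:T0. \<^bold>\<forall>u\<^bold>:T0. \<^bold>\<forall>v\<^bold>:T0.
          x \<^bold>= y \<^bold>\<and> u \<^bold>= v \<^bold>\<and> x \<^bold>< u \<^bold>\<longrightarrow> y \<^bold>< v)"
    and extens: "\<And>\<rho> \<tau>. hol term_struct [] (extensionality \<rho> \<tau>)"
begin

abbreviation tm :: "ty \<Rightarrow> trm set" where "tm \<rho> \<equiv> {t. ty_of [] t = Some \<rho>}"
abbreviation teq :: "ty \<Rightarrow> trm \<Rightarrow> trm \<Rightarrow> bool" where "teq \<equiv> ext_eq term_struct"

lemma den_var_list [simp]:
  "den S [v0] (var 0) = v0" 
  "den S [v1,v0] (var 0) = v0" "den S [v1,v0] (var (Suc 0)) = v1" 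
  "den S [v2,v1,v0] (var 0) = v0" "den S [v2,v1,v0] (var (Suc 0)) = v1" "den S [v2,v1,v0] (var (Suc (Suc 0))) = v2"
  "den S [v3,v2,v1,v0] (var 0) = v0" "den S [v3,v2,v1,v0] (var (Suc 0)) = v1"
  "den S [v3,v2,v1,v0] (var (Suc (Suc 0))) = v2" "den S [v3,v2,v1,v0] (var (Suc (Suc (Suc 0)))) = v3"
  by (simp_all add: den_def var_def)

lemma teq_T0:
  "x \<in> tm T0 \<Longrightarrow> teq T0 x x"
  "x \<in> tm T0 \<Longrightarrow> y \<in> tm T0 \<Longrightarrow> teq T0 x y \<Longrightarrow> teq T0 y x"
  "x \<in> tm T0 \<Longrightarrow> y \<in> tm T0 \<Longrightarrow> z \<in> tm T0 \<Longrightarrow> teq T0 x y \<Longrightarrow> teq T0 y z \<Longrightarrow> teq T0 x z"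
proof -
  have "hol term_struct [] (\<^bold>\<forall>x\<^bold>:T0. x \<^bold>= x) = (\<forall>x\<in>tm T0. teq T0 x x)"
    by (simp add: hol_all hol_connectives)
  then show "x \<in> tm T0 \<Longrightarrow> teq T0 x x" using eq_refl by blast
  have "hol term_struct [] (\<^bold>\<forall>x\<^bold>:T0. \<^bold>\<forall>y\<^bold>:T0. x \<^bold>= y \<^bold>\<longrightarrow> y \<^bold>= x)
    = (\<forall>x\<in>tm T0. \<forall>y\<in>tm T0. teq T0 x y \<longrightarrow> teq T0 y x)"
    by (simp add: hol_all hol_connectives)
  then show "x \<in> tm T0 \<Longrightarrow> y \<in> tm T0 \<Longrightarrow> teq T0 x y \<Longrightarrow> teq T0 y x" using eq_sym by blast
  have "hol term_struct [] (\<^bold>\<forall>x\<^bold>:T0. \<^bold>\<forall>y\<^bold>:T0. \<^bold>\<forall>z\<^bold>:T0. x \<^bold>= y \<^bold>\<and> y \<^bold>= z \<^bold>\<longrightarrow> x \<^bold>= z)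
    = (\<forall>x\<in>tm T0. \<forall>y\<in>tm T0. \<forall>z\<in>tm T0. teq T0 x y \<and> teq T0 y z \<longrightarrow> teq T0 x z)"
    by (simp add: hol_all hol_connectives)
  then show "x \<in> tm T0 \<Longrightarrow> y \<in> tm T0 \<Longrightarrow> z \<in> tm T0 \<Longrightarrow> teq T0 x y \<Longrightarrow> teq T0 y z \<Longrightarrow> teq T0 x z"
    using eq_trans by blast
qed

lemma App_tm: "f \<in> tm (\<rho> \<Rrightarrow> \<tau>) \<Longrightarrow> x \<in> tm \<rho> \<Longrightarrow> App f x \<in> tm \<tau>"
  by simp

lemma teq_refl: "x \<in> tm \<rho> \<Longrightarrow> teq \<rho> x x"
proof (induction \<rho> arbitrary: x)
  case T0
  then show ?case using teq_T0(1) by blast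
qed simp

lemma teq_sym: "x \<in> tm \<rho> \<Longrightarrow> y \<in> tm \<rho> \<Longrightarrow> teq \<rho> x y \<Longrightarrow> teq \<rho> y x"
proof (induction \<rho> arbitrary: x y)
  case T0
  then show ?case using teq_T0(2) by blast
qed simp

lemma teq_trans: "x \<in> tm \<rho> \<Longrightarrow> y \<in> tm \<rho> \<Longrightarrow> z \<in> tm \<rho> \<Longrightarrow> teq \<rho> x y \<Longrightarrow> teq \<rho> y z \<Longrightarrow> teq \<rho> x z"
proof (induction \<rho> arbitrary: x y z)
  case (Arr \<rho> \<tau>)
  show ?case
    unfolding ext_eq.simps
  proof
    fix v assume v: "v \<in> dm term_struct \<rho>"
    show "teq \<tau> (ap term_struct x v) (ap term_struct z v)"
      by (rule Arr.IH(2)[of _ "App y v"]) (use v Arr.prems in auto)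
  qed
qed (use teq_T0(3) in blast)

text \<open>Replacing the function is covered by the definition of extensional equality at an arrow
  type; replacing the argument is the extensionality axiom.\<close>

lemma teq_App:
  assumes "f \<in> tm (\<rho> \<Rrightarrow> \<tau>)" "g \<in> tm (\<rho> \<Rrightarrow> \<tau>)" "x \<in> tm \<rho>" "y \<in> tm \<rho>"
    and "teq (\<rho> \<Rrightarrow> \<tau>) f g" "teq \<rho> x y"
  shows "teq \<tau> (App f x) (App g y)"
proof (rule teq_trans[of _ _ "App g x"])
  show "teq \<tau> (App f x) (App g x)" using assms by auto
  show "teq \<tau> (App g x) (App g y)"
    using extens[of \<rho> \<tau>] assms unfolding hol_extensionality by auto
qed (use assms in auto)

definition cl :: "trm \<Rightarrow> trm set" where
  "cl t = {s. ty_of [] s = ty_of [] t \<and> teq (the (ty_of [] t)) s t}"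

definition rep :: "trm set \<Rightarrow> trm" where "rep C = (SOME s. s \<in> C)"

lemma cl_eq: "s \<in> tm \<rho> \<Longrightarrow> t \<in> tm \<rho> \<Longrightarrow> cl s = cl t \<longleftrightarrow> teq \<rho> s t"
proof
  assume st: "s \<in> tm \<rho>" "t \<in> tm \<rho>"
  have "s \<in> cl s" using st teq_refl by (simp add: cl_def)
  then show "cl s = cl t \<Longrightarrow> teq \<rho> s t" using st by (simp add: cl_def)
  assume "teq \<rho> s t"
  then have "teq \<rho> u s = teq \<rho> u t" if "u \<in> tm \<rho>" for u
    using st that teq_sym[of s \<rho> t] teq_trans[of u \<rho> s t] teq_trans[of u \<rho> t s] by blast
  then show "cl s = cl t" using st unfolding cl_def by auto
qed

lemma rep_cl: "t \<in> tm \<rho> \<Longrightarrow> rep (cl t) \<in> tm \<rho> \<and> teq \<rho> (rep (cl t)) t"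
proof -
  assume t: "t \<in> tm \<rho>"
  then have "t \<in> cl t" using teq_refl by (simp add: cl_def)
  then have "rep (cl t) \<in> cl t" unfolding rep_def by (rule someI)
  with t show ?thesis by (simp add: cl_def)
qed

definition quot :: "trm set struct" where
  "quot = \<lparr>dm = (\<lambda>\<rho>. cl ` tm \<rho>), ap = (\<lambda>A B. cl (App (rep A) (rep B))), cn = (\<lambda>c. cl (Cn c)),
     pr = (\<lambda>a \<rho>. cl (Par a \<rho>)), eqr = (=), lsr = (\<lambda>A B. Less (rep A) (rep B) \<in> M)\<rparr>"

lemma quot_simps [simp]:
  "dm quot \<rho> = cl ` tm \<rho>" "cn quot c = cl (Cn c)" "pr quot a \<rho> = cl (Par a \<rho>)" "eqr quot = (=)"
  by (simp_all add: quot_def)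

lemma ap_quot: "f \<in> tm (\<rho> \<Rrightarrow> \<tau>) \<Longrightarrow> x \<in> tm \<rho> \<Longrightarrow> ap quot (cl f) (cl x) = cl (App f x)"
proof -
  assume fx: "f \<in> tm (\<rho> \<Rrightarrow> \<tau>)" "x \<in> tm \<rho>"
  then have "teq \<tau> (App (rep (cl f)) (rep (cl x))) (App f x)"
    using rep_cl[OF fx(1)] rep_cl[OF fx(2)] teq_App by blast
  then show ?thesis
    using cl_eq[OF App_tm App_tm] rep_cl[OF fx(1)] rep_cl[OF fx(2)] fx by (simp add: quot_def)
qed

lemma lsr_quot: "x \<in> tm T0 \<Longrightarrow> y \<in> tm T0 \<Longrightarrow> lsr quot (cl x) (cl y) \<longleftrightarrow> Less x y \<in> M"
proof -
  assume xy: "x \<in> tm T0" "y \<in> tm T0"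
  have "hol term_struct [] (\<^bold>\<forall>x\<^bold>:T0. \<^bold>\<forall>y\<^bold>:T0. \<^bold>\<forall>u\<^bold>:T0. \<^bold>\<forall>v\<^bold>:T0.
          x \<^bold>= y \<^bold>\<and> u \<^bold>= v \<^bold>\<and> x \<^bold>< u \<^bold>\<longrightarrow> y \<^bold>< v)
      = (\<forall>x\<in>tm T0. \<forall>y\<in>tm T0. \<forall>u\<in>tm T0. \<forall>v\<in>tm T0.
          teq T0 x y \<and> teq T0 u v \<and> Less x u \<in> M \<longrightarrow> Less y v \<in> M)" (is "?H = _")
    by (simp add: hol_all hol_connectives)
  then have *: "Less u v \<in> M" if "Less x y \<in> M" "teq T0 x u" "teq T0 y v"
      "x \<in> tm T0" "y \<in> tm T0" "u \<in> tm T0" "v \<in> tm T0" for x y u v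
    using less_cong that by blast
  then show ?thesis
    using * rep_cl[OF xy(1)] rep_cl[OF xy(2)] xy teq_sym[of "rep (cl x)" T0 x] teq_sym[of "rep (cl y)" T0 y]
    unfolding quot_def struct.simps by blast
qed

lemma eval_quot:
  assumes "list_all2 (\<lambda>s \<rho>. s \<in> tm \<rho>) e \<Delta>"
  shows "ty_of \<Delta> t = Some \<tau> \<Longrightarrow> eval term_struct e t \<in> tm \<tau> \<and> eval quot (map cl e) t = cl (eval term_struct e t)"
proof (induction t arbitrary: \<tau>)
  case (Bnd i)
  then show ?case using assms by (auto simp: list_all2_conv_all_nth split: if_splits)
next
  case (App s t)
  then obtain \<rho> where "ty_of \<Delta> s = Some (\<rho> \<Rrightarrow> \<tau>)" "ty_of \<Delta> t = Some \<rho>" by (auto simp: ty_of_App simp del: ty_of.simps)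
  with App.IH show ?case using ap_quot App_tm by auto
qed auto

text \<open>Prime formulas speak of type 0 only, where being in the same class is the equality
  already interpreted by the term model. Passing to classes makes this equality genuine without
  changing any truth value.\<close>

lemma sat_quot:
  assumes "list_all2 (\<lambda>s \<rho>. s \<in> tm \<rho>) e \<Delta>" "wff \<Delta> \<psi>"
  shows "sat quot (map cl e) \<psi> \<longleftrightarrow> sat term_struct e \<psi>"
  using assms
proof (induction \<psi> arbitrary: e \<Delta>)
  case (Eq s t)
  then show ?case using eval_quot[OF Eq.prems(1)] cl_eq[of _ T0] by auto
next
  case (Less s t)
  then show ?case using eval_quot[OF Less.prems(1)] lsr_quot by auto
next
  case (Forall \<rho> \<psi>)
  have "sat quot (map cl (s # e)) \<psi> \<longleftrightarrow> sat term_struct (s # e) \<psi>" if "s \<in> tm \<rho>" for s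
    using Forall.IH[of "s # e" "\<rho> # \<Delta>"] Forall.prems that by auto
  then show ?case by auto
qed auto

lemma sat_quot_closed: "wff [] \<psi> \<Longrightarrow> sat quot [] \<psi> \<longleftrightarrow> \<psi> \<in> M"
  using sat_quot[of "[]" "[]" \<psi>] by (simp add: sat_term_struct_closed)

lemma normal_quot: "normal quot"
proof -
  have "f = g" if fg: "f \<in> dm quot (\<rho> \<Rrightarrow> \<tau>)" "g \<in> dm quot (\<rho> \<Rrightarrow> \<tau>)" "\<forall>x\<in>dm quot \<rho>. ap quot f x = ap quot g x"
    for f g \<rho> \<tau>
  proof -
    obtain s t where st: "s \<in> tm (\<rho> \<Rrightarrow> \<tau>)" "t \<in> tm (\<rho> \<Rrightarrow> \<tau>)" "f = cl s" "g = cl t" using fg by auto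
    have "teq \<tau> (App s x) (App t x)" if "x \<in> tm \<rho>" for x
    proof -
      have "cl (App s x) = cl (App t x)"
        using \<open>\<forall>x\<in>dm quot \<rho>. ap quot f x = ap quot g x\<close> st that ap_quot by auto
      then show ?thesis using cl_eq[OF App_tm App_tm] st that by blast
    qed
    then show ?thesis using cl_eq st by auto
  qed
  moreover have "\<exists>t. ty_of [] t = Some \<rho> \<and> eval quot [] t = c" if c: "c \<in> dm quot \<rho>" for c \<rho>
  proof -
    obtain t where t: "t \<in> tm \<rho>" "c = cl t" using c by auto
    have "eval term_struct [] t = t"
    proof -
      have "env_subst [] = Bnd" by (rule ext) (simp add: env_subst_def)
      then show ?thesis using eval_term_struct[of "[]" t \<rho> "[]"] t(1) by simp
    qed
    then show ?thesis using eval_quot[of "[]" "[]" t \<rho>] t by auto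
  qed
  moreover have "ap quot f x \<in> dm quot \<tau>" if "f \<in> dm quot (\<rho> \<Rrightarrow> \<tau>)" "x \<in> dm quot \<rho>" for f x \<rho> \<tau>
    using that ap_quot App_tm by auto
  ultimately show ?thesis
    unfolding normal_def by (simp only: quot_simps) auto
qed

end

text \<open>Completeness in contraposed form. Truth is claimed for the well-formed axioms only,
  because membership in \<open>M\<close> and truth in the term model are linked through
  typing.\<close>

theorem countermodel:
  assumes "\<not> T \<turnstile>\<^sub>0 \<phi>" "wff [] \<phi>"
    and "sentence ` arithmetic_axioms \<subseteq> T" "\<And>\<rho> \<tau>. sentence (extensionality \<rho> \<tau>) \<in> T"
    and wff_ext: "\<And>\<rho> \<tau>. wff [] (sentence (extensionality \<rho> \<tau>))"
  obtains S :: "trm set struct" where "normal S" "\<And>\<psi>. \<psi> \<in> T \<Longrightarrow> wff [] \<psi> \<Longrightarrow> sat S [] \<psi>" "\<not> sat S [] \<phi>"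
proof -
  interpret unprovable T \<phi> by standard (rule assms)
  have *: "hol term_struct [] P" if "sentence P \<in> T" "wff [] (sentence P)" for P
    using that M_axioms sat_term_struct_closed unfolding sat_sentence[symmetric] by auto
  interpret unprovable_ext T \<phi>
  proof
    show "hol term_struct [] (\<^bold>\<forall>x\<^bold>:T0. x \<^bold>= x)"
      by (rule *) (use assms(3) in \<open>auto simp: arithmetic_axioms_def sentence_def o_all_def o_eq_def\<close>)
    show "hol term_struct [] (\<^bold>\<forall>x\<^bold>:T0. \<^bold>\<forall>y\<^bold>:T0. x \<^bold>= y \<^bold>\<longrightarrow> y \<^bold>= x)"
      by (rule *) (use assms(3) in \<open>auto simp: arithmetic_axioms_def sentence_def o_all_def o_eq_def o_imp_def\<close>)
    show "hol term_struct [] (\<^bold>\<forall>x\<^bold>:T0. \<^bold>\<forall>y\<^bold>:T0. \<^bold>\<forall>z\<^bold>:T0. x \<^bold>= y \<^bold>\<and> y \<^bold>= z \<^bold>\<longrightarrow> x \<^bold>= z)"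
      by (rule *) (use assms(3) in \<open>auto simp: arithmetic_axioms_def sentence_def o_all_def o_eq_def
            o_imp_def o_and_def o_not_def o_bot_def\<close>)
    show "hol term_struct [] (\<^bold>\<forall>x\<^bold>:T0. \<^bold>\<forall>y\<^bold>:T0. \<^bold>\<forall>u\<^bold>:T0. \<^bold>\<forall>v\<^bold>:T0.
          x \<^bold>= y \<^bold>\<and> u \<^bold>= v \<^bold>\<and> x \<^bold>< u \<^bold>\<longrightarrow> y \<^bold>< v)"
      by (rule *) (use assms(3) in \<open>auto simp: arithmetic_axioms_def sentence_def o_all_def o_eq_def
            o_imp_def o_and_def o_not_def o_bot_def o_less_def\<close>)
    show "hol term_struct [] (extensionality \<rho> \<tau>)" for \<rho> \<tau>
      by (rule *) (use assms(4) wff_ext in auto)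
  qed
  show thesis
  proof (rule that[OF normal_quot])
    show "sat quot [] \<psi>" if "\<psi> \<in> T" "wff [] \<psi>" for \<psi>
      using that M_axioms by (auto simp: sat_quot_closed)
    show "\<not> sat quot [] \<phi>" using goal_notin_M assms(2) by (simp add: sat_quot_closed)
  qed
qed

section \<open>The ordered field over a discretely ordered semiring\<close>

text \<open>A type class, so that the ring of differences and its field of fractions can be formed
  as types and inherit linear arithmetic.\<close>

class discrete_semiring = comm_semiring_1 + linorder +
  assumes ds_add_less: "a < b \<Longrightarrow> a + c < b + c"
    and ds_mult_less: "0 < c \<Longrightarrow> a < b \<Longrightarrow> a * c < b * c"
    and ds_diff: "a < b \<Longrightarrow> \<exists>c. a + c = b"
    and ds_nonneg: "0 \<le> a"
    and ds_zero_less_one: "0 < 1"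
    and ds_discrete: "0 < a \<Longrightarrow> 1 \<le> a"
begin

lemma ds_add_less_iff [simp]: "a + c < b + c \<longleftrightarrow> a < b" "c + a < c + b \<longleftrightarrow> a < b"
  using ds_add_less by (metis add_commute less_asym less_linear)+

lemma ds_add_le_iff [simp]: "a + c \<le> b + c \<longleftrightarrow> a \<le> b" "c + a \<le> c + b \<longleftrightarrow> a \<le> b"
  by (simp_all add: not_less[symmetric])

lemma ds_add_eq_iff [simp]: "a + c = b + c \<longleftrightarrow> a = b" "c + a = c + b \<longleftrightarrow> a = b"
  by (simp_all add: order.eq_iff)

end

text \<open>This is \<open>(b - a) * (d - c) > 0\<close> written without subtraction. It makes
  multiplication of differences strictly monotone.\<close>

lemma ds_mult_cross:
  fixes a b :: "'a::discrete_semiring"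
  assumes "a < b" "c < d"
  shows "a * d + b * c < a * c + b * d"
proof -
  obtain u where u: "a + u = b" using ds_diff assms(1) by blast
  then have "0 < u" using assms(1) ds_nonneg[of u] by (metis add.right_neutral ds_add_less_iff(2))
  then have "c * u < d * u" using assms(2) ds_mult_less by blast
  then have "(a * c + a * d) + c * u < (a * c + a * d) + d * u" by simp
  then show ?thesis by (simp add: u[symmetric] algebra_simps)
qed

\<comment> \<open>The ring of differences, where (a, b) stands for a - b\<close>
quotient_type (overloaded) 'a zz = "'a \<times> 'a::discrete_semiring" / "\<lambda>(a, b) (c, d). a + d = c + b"
proof (rule equivpI)
  show "transp (\<lambda>(a, b) (c, d). a + d = c + (b :: 'a))"
  proof (rule transpI, clarify)
    fix a b c d e f :: 'a
    assume "a + d = c + b" "c + f = e + d"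
    then have "(a + f) + (c + d) = (e + b) + (c + d)" by (metis add.assoc add.commute)
    then show "a + f = e + b" by simp
  qed
qed (auto simp: reflp_def symp_def)

lemma zz_exhaust: obtains a b where "z = abs_zz (a, b)"
  by (induction z rule: zz.abs_induct) auto

instantiation zz :: (discrete_semiring) linordered_idom
begin

lift_definition zero_zz :: "'a zz" is "(0, 0)" .
lift_definition one_zz :: "'a zz" is "(1, 0)" .
lift_definition plus_zz :: "'a zz \<Rightarrow> 'a zz \<Rightarrow> 'a zz" is "\<lambda>(a, b) (c, d). (a + c, b + d)"
  by clarsimp (metis (no_types, opaque_lifting) add.assoc add.commute)
lift_definition uminus_zz :: "'a zz \<Rightarrow> 'a zz" is "\<lambda>(a, b). (b, a)"
  by (auto simp: add.commute)
lift_definition times_zz :: "'a zz \<Rightarrow> 'a zz \<Rightarrow> 'a zz" is "\<lambda>(a, b) (c, d). (a * c + b * d, a * d + b * c)"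
proof (clarsimp)
  fix s t u v w x y z :: 'a
  assume a: "s + v = u + t" and b: "w + z = y + x"
  \<comment> \<open>The products of the two representatives become comparable after adding
    \<open>u * x + v * w\<close> to both sides; the summand is cancelled at the end.\<close>
  have "(s * w + t * x) + (u * x + v * w) = (s + v) * w + (t + u) * x" by (simp add: algebra_simps)
  also have "\<dots> = (u + t) * (w + x)" by (simp add: a algebra_simps)
  finally have "(s * w + t * x) + (u * x + v * w) + (u * z + v * y)
      = ((u + t) * (w + x)) + (u * z + v * y)" by simp
  also have "\<dots> = (s * x + t * w) + u * (w + z) + v * (y + x)"
  proof -
    have "(u + t) * (w + x) + (u * z + v * y) = (u + t) * x + t * w + u * (w + z) + v * y"
      by (simp add: algebra_simps)
    also have "\<dots> = (s + v) * x + t * w + u * (w + z) + v * y" by (simp add: a)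
    finally show ?thesis by (simp add: algebra_simps)
  qed
  also have "\<dots> = (s * x + t * w) + u * (y + x) + v * (w + z)" by (simp add: b)
  finally have "(s * w + t * x + (u * z + v * y)) + (u * x + v * w)
      = (u * y + v * z + (s * x + t * w)) + (u * x + v * w)"
    by (simp add: algebra_simps)
  then show "s * w + t * x + (u * z + v * y) = u * y + v * z + (s * x + t * w)" by simp
qed
definition minus_zz :: "'a zz \<Rightarrow> 'a zz \<Rightarrow> 'a zz" where "minus_zz x y = x + - y"
lift_definition less_eq_zz :: "'a zz \<Rightarrow> 'a zz \<Rightarrow> bool" is "\<lambda>(a, b) (c, d). a + d \<le> c + b"
proof (clarsimp)
  fix s t u v w x y z :: 'a
  assume a: "s + v = u + t" and b: "w + z = y + x"
  have "s + x \<le> w + t \<longleftrightarrow> (s + x) + (v + z) \<le> (w + t) + (v + z)" by simp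
  also have "(s + x) + (v + z) = (s + v) + (x + z)" by (simp add: algebra_simps)
  also have "\<dots> = (u + z) + (t + x)" by (simp add: a algebra_simps)
  also have "(w + t) + (v + z) = (w + z) + (t + v)" by (simp add: algebra_simps)
  also have "\<dots> = (y + v) + (t + x)" by (simp add: b algebra_simps)
  finally show "s + x \<le> w + t \<longleftrightarrow> u + z \<le> y + v" by simp
qed
definition less_zz :: "'a zz \<Rightarrow> 'a zz \<Rightarrow> bool" where "less_zz x y = (x \<le> y \<and> \<not> y \<le> x)"
definition abs_zz_inst: "\<bar>i :: 'a zz\<bar> = (if i < 0 then - i else i)"
definition sgn_zz_inst: "sgn (i :: 'a zz) = (if i = 0 then 0 else if 0 < i then 1 else - 1)"

lemma less_zz_transfer: "abs_zz (a, b) < abs_zz (c, d) \<longleftrightarrow> a + d < c + (b :: 'a)"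
  by (auto simp: less_zz_def less_eq_zz.abs_eq)

instance
proof
  fix a b c :: "'a zz"
  show "a + b + c = a + (b + c)" by transfer (auto simp: algebra_simps)
  show "a + b = b + a" by transfer (auto simp: algebra_simps)
  show "0 + a = a" by transfer auto
  show "- a + a = 0" by transfer (auto simp: algebra_simps)
  show "a - b = a + - b" by (simp add: minus_zz_def)
  show "a * b * c = a * (b * c)" by transfer (auto simp: algebra_simps)
  show "a * b = b * a" by transfer (auto simp: algebra_simps)
  show "1 * a = a" by transfer auto
  show "(a + b) * c = a * c + b * c" by transfer (auto simp: algebra_simps)
  show "(0 :: 'a zz) \<noteq> 1" by transfer auto
  show "(a < b) = (a \<le> b \<and> \<not> b \<le> a)" by (simp add: less_zz_def)
  show "a \<le> a" by transfer auto
  show "a \<le> b \<or> b \<le> a" by transfer auto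
  show "a \<le> b \<Longrightarrow> b \<le> a \<Longrightarrow> a = b" by transfer auto
  obtain a1 a2 b1 b2 c1 c2 where [simp]: "a = abs_zz (a1, a2)" "b = abs_zz (b1, b2)" "c = abs_zz (c1, c2)"
    using zz_exhaust[of a] zz_exhaust[of b] zz_exhaust[of c] by metis
  show "a \<le> b \<Longrightarrow> c + a \<le> c + b"
  proof -
    have "(c1 + a1) + (c2 + b2) = (c1 + c2) + (a1 + b2)" "(c1 + b1) + (c2 + a2) = (c1 + c2) + (b1 + a2)"
      by (simp_all add: algebra_simps)
    then show "a \<le> b \<Longrightarrow> c + a \<le> c + b" by (simp add: less_eq_zz.abs_eq plus_zz.abs_eq)
  qed
  show "a \<le> b \<Longrightarrow> b \<le> c \<Longrightarrow> a \<le> c"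
  proof (simp add: less_eq_zz.abs_eq)
    assume "a1 + b2 \<le> b1 + a2" "b1 + c2 \<le> c1 + b2"
    then have "(a1 + b2) + c2 \<le> (b1 + a2) + c2" "(b1 + c2) + a2 \<le> (c1 + b2) + a2" by simp_all
    then have "(a1 + c2) + b2 \<le> (c1 + a2) + b2" by (simp only: ac_simps) 
    then show "a1 + c2 \<le> c1 + a2" by simp
  qed
  show "a < b \<Longrightarrow> 0 < c \<Longrightarrow> c * a < c * b"
  proof -
    assume "a < b" "0 < c"
    then have "a1 + b2 < b1 + a2" "c2 < c1" by (simp_all add: zero_zz_def less_zz_transfer)
    then have "(a1 + b2) * c1 + (b1 + a2) * c2 < (a1 + b2) * c2 + (b1 + a2) * c1" by (rule ds_mult_cross)
    then show ?thesis by (simp add: times_zz.abs_eq less_zz_transfer algebra_simps)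
  qed
  show "a + b - a = b" "a - b - c = a - (b + c)"
    by (simp_all add: minus_zz_def uminus_zz.abs_eq plus_zz.abs_eq zz.abs_eq_iff algebra_simps)
  show "0 * a = 0" "a * 0 = 0" by (transfer; auto)+
  show "\<bar>a\<bar> = (if a < 0 then - a else a)" by (rule abs_zz_inst)
  show "sgn a = (if a = 0 then 0 else if 0 < a then 1 else - 1)" by (rule sgn_zz_inst)
qed

end

section \<open>The semiring inside its field of fractions\<close>

abbreviation zn :: "'a::discrete_semiring \<Rightarrow> 'a zz" where "zn a \<equiv> abs_zz (a, 0)"

definition rn :: "'a::discrete_semiring \<Rightarrow> 'a zz fract" where "rn a = Fract (zn a) 1"

lemma rn_simps [simp]:
  "rn 0 = 0" "rn 1 = 1" "rn (a + b) = rn a + rn b" "rn (a * b) = rn a * rn b"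
  "rn a < rn b \<longleftrightarrow> a < b" "rn a \<le> rn b \<longleftrightarrow> a \<le> b" "rn a = rn b \<longleftrightarrow> a = b"
  by (simp_all add: rn_def Zero_fract_def One_fract_def zero_zz_def one_zz_def plus_zz.abs_eq
      times_zz.abs_eq less_zz_transfer less_eq_zz.abs_eq zz.abs_eq_iff eq_fract)

lemma rn_nonneg [simp]: "0 \<le> rn a"
  using rn_simps(6)[of 0 a] ds_nonneg by simp

lemma rn_pos_iff [simp]: "0 < rn a \<longleftrightarrow> 0 < a"
  using rn_simps(5)[of 0 a] by simp

lemma rn_zero_iff [simp]: "rn a = 0 \<longleftrightarrow> a = 0"
  using rn_simps(7)[of a 0] by simp

text \<open>Discreteness: a number above b exceeds it by a nonzero number, hence by at least 1.
  Strict inequalities in the field are turned into weak ones between numbers in this way.\<close>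

lemma rn_less_Suc_iff: "rn a < rn b + 1 \<longleftrightarrow> a \<le> b"
proof -
  have "a < b + 1 \<longleftrightarrow> a \<le> b"
  proof
    assume *: "a < b + 1"
    show "a \<le> b"
    proof (rule ccontr)
      assume "\<not> a \<le> b"
      then obtain c where c: "b + c = a" using ds_diff[of b a] not_le by blast
      with \<open>\<not> a \<le> b\<close> have "c \<noteq> 0" by auto
      then have "1 \<le> c" using ds_nonneg[of c] ds_discrete[of c] by auto
      with * c show False by auto
    qed
  next
    assume "a \<le> b"
    also have "b < b + 1" using ds_add_less_iff(2)[of b 0 1] ds_zero_less_one by simp
    finally show "a < b + 1" .
  qed
  then show ?thesis using rn_simps(5)[of a "b + 1"] by simp
qed

text \<open>This is the shape that \<open>rat_code\<close> can express, so every element of the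
  field has a code. Any positive denominator is a successor by discreteness.\<close>

lemma fract_rn_exhaust:
  fixes q :: "'a::discrete_semiring zz fract"
  obtains a b c where "q = (rn a - rn b) / (rn c + 1)"
proof -
  have "\<exists>x y. q = Fract x y \<and> 0 < y" by (induction q rule: fract_induct_pos) blast
  then obtain x y where q: "q = Fract x y" "0 < y" by blast
  obtain a b where x: "x = abs_zz (a, b)" by (rule zz_exhaust)
  obtain c d where y: "y = abs_zz (c, d)" by (rule zz_exhaust)
  have "d < c" using q(2) y by (simp add: zero_zz_def less_zz_transfer)
  then obtain e where e: "d + e = c" using ds_diff by blast
  with \<open>d < c\<close> have "0 < e" by (metis add.right_neutral ds_add_less_iff(2))
  then have "1 \<le> e" by (rule ds_discrete)
  then obtain f where f: "e = f + 1" by (metis add.commute ds_diff ds_zero_less_one le_less add_0)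
  have "x = zn a - zn b" by (simp add: x minus_zz_def uminus_zz.abs_eq plus_zz.abs_eq)
  moreover have "y = zn f + 1"
    by (simp add: y one_zz_def plus_zz.abs_eq zz.abs_eq_iff e[symmetric] f add.commute)
  ultimately have "q = Fract (zn a - zn b) (zn f + 1)" using q by simp
  also have "\<dots> = (rn a - rn b) / (rn f + 1)"
    using q(2) \<open>y = zn f + 1\<close> by (simp add: rn_def One_fract_def)
  finally show thesis using that by blast
qed

section \<open>Definable functions in a model\<close>

text \<open>The numbers form a type \<open>'n\<close> of their own, identified with the domain of
  type 0 by \<open>un\<close>. They thereby carry the algebra of \<open>discrete_semiring\<close>
  and have a field of fractions, while the higher types remain subsets of the carrier.\<close>

locale model =
  fixes S :: "'u struct" and un :: "'n::discrete_semiring \<Rightarrow> 'u"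
  assumes normal: "normal S"
    and dm_T0: "dm S T0 = range un" and inj_un: "inj un"
    and lsr_un: "lsr S (un a) (un b) \<longleftrightarrow> a < b"
    and cn_zero: "cn S CZero = un 0" and cn_one: "cn S COne = un 1"
    and cn_plus: "ap S (ap S (cn S CPlus) (un a)) (un b) = un (a + b)"
    and cn_times: "ap S (ap S (cn S CTimes) (un a)) (un b) = un (a * b)"
    and hol_K: "hol S [] (K_axiom \<rho> \<tau>)" and hol_S: "hol S [] (S_axiom \<rho> \<sigma> \<tau>)"
    and hol_Rec: "hol S [] Rec_axiom"
    and hol_induction: "qfree A \<Longrightarrow> wff [T0] A \<Longrightarrow> hol S [] (induction A)"
    and hol_choice_10: "qfree A \<Longrightarrow> wff [T1, T0] A \<Longrightarrow> hol S [] (choice T1 T0 A)"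
    and hol_choice_01: "qfree A \<Longrightarrow> wff [T0, T1] A \<Longrightarrow> hol S [] (choice T0 T1 A)"
    and hol_Exists2: "hol S [] Exists2"
    and hol_FIN_union: "hol S [] FIN_union" and hol_FIN_enum: "hol S [] FIN_enum"
begin

abbreviation D :: "ty \<Rightarrow> 'u set" where "D \<equiv> dm S"
abbreviation app :: "'u \<Rightarrow> 'u \<Rightarrow> 'u" (infixl "\<bullet>" 90) where "f \<bullet> x \<equiv> ap S f x"
definition nm :: "'u \<Rightarrow> 'n" where "nm = inv un"
definition fn :: "'u \<Rightarrow> 'n \<Rightarrow> 'n" where "fn x n = nm (x \<bullet> un n)"

lemma nm_un [simp]: "nm (un a) = a"
  unfolding nm_def using inj_un by simp

lemma un_nm: "x \<in> D T0 \<Longrightarrow> un (nm x) = x"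
  using dm_T0 by auto

lemma un_in [simp, intro]: "un a \<in> D T0"
  using dm_T0 by simp

lemma un_eq_iff [simp]: "un a = un b \<longleftrightarrow> a = b"
  using inj_un by (simp add: inj_eq)

lemma ball_T0: "(\<forall>v\<in>D T0. P v) \<longleftrightarrow> (\<forall>n. P (un n))"
  using dm_T0 by auto

lemma bex_T0: "(\<exists>v\<in>D T0. P v) \<longleftrightarrow> (\<exists>n. P (un n))"
  using dm_T0 by auto

lemma eqr_eq: "eqr S = (=)"
  using normal by (simp add: normal_def)

lemma app_in [intro]: "f \<in> D (\<rho> \<Rrightarrow> \<tau>) \<Longrightarrow> x \<in> D \<rho> \<Longrightarrow> f \<bullet> x \<in> D \<tau>"
  using normal by (simp add: normal_def)

lemma cn_in: "cn S c \<in> D (ty_cnst c)"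
  using normal by (simp add: normal_def)

lemma CK_in [simp]: "cn S (CK \<rho> \<tau>) \<in> D (\<rho> \<Rrightarrow> \<tau> \<Rrightarrow> \<rho>)"
  using cn_in[of "CK \<rho> \<tau>"] by simp

lemma CRec_in: "cn S CRec \<in> D ((T0 \<Rrightarrow> T0 \<Rrightarrow> T0) \<Rrightarrow> T0 \<Rrightarrow> T0 \<Rrightarrow> T0)"
  using cn_in[of CRec] by simp

lemma D_ext: "f \<in> D (\<rho> \<Rrightarrow> \<tau>) \<Longrightarrow> g \<in> D (\<rho> \<Rrightarrow> \<tau>) \<Longrightarrow> (\<And>x. x \<in> D \<rho> \<Longrightarrow> f \<bullet> x = g \<bullet> x) \<Longrightarrow> f = g"
  using normal unfolding normal_def by blast

lemma ext_eq_iff: "s \<in> D \<rho> \<Longrightarrow> t \<in> D \<rho> \<Longrightarrow> ext_eq S \<rho> s t \<longleftrightarrow> s = t"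
proof (induction \<rho> arbitrary: s t)
  case (Arr \<rho> \<tau>)
  then have "ext_eq S (\<rho> \<Rrightarrow> \<tau>) s t \<longleftrightarrow> (\<forall>x\<in>D \<rho>. s \<bullet> x = t \<bullet> x)" by (simp add: app_in)
  with Arr.prems show ?case using D_ext by blast
qed (simp add: eqr_eq)

lemma un_fn: "x \<in> D T1 \<Longrightarrow> x \<bullet> un n = un (fn x n)"
  unfolding fn_def using un_nm app_in un_in by metis

lemma fn_ext: "x \<in> D T1 \<Longrightarrow> y \<in> D T1 \<Longrightarrow> (\<And>n. fn x n = fn y n) \<Longrightarrow> x = y"
  by (rule D_ext) (auto simp: dm_T0 un_fn)

lemma CK_app [simp]: "x \<in> D \<rho> \<Longrightarrow> y \<in> D \<tau> \<Longrightarrow> cn S (CK \<rho> \<tau>) \<bullet> x \<bullet> y = x"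
proof -
  assume xy: "x \<in> D \<rho>" "y \<in> D \<tau>"
  have "cn S (CK \<rho> \<tau>) \<bullet> x \<bullet> y \<in> D \<rho>" using cn_in[of "CK \<rho> \<tau>"] xy app_in by (metis ty_cnst.simps(5))
  moreover have "ext_eq S \<rho> (cn S (CK \<rho> \<tau>) \<bullet> x \<bullet> y) x"
    using hol_K[of \<rho> \<tau>] xy den_simps(3)[of S _ "[]"] den_simps(3)[of S _ "[_]"]
    by (simp add: K_axiom_def hol_simps hol_eq_at)
  ultimately show ?thesis using ext_eq_iff xy by blast
qed

lemma CS_app [simp]:
  assumes "x \<in> D (\<rho> \<Rrightarrow> \<sigma> \<Rrightarrow> \<tau>)" "y \<in> D (\<rho> \<Rrightarrow> \<sigma>)" "z \<in> D \<rho>"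
  shows "cn S (CS \<rho> \<sigma> \<tau>) \<bullet> x \<bullet> y \<bullet> z = x \<bullet> z \<bullet> (y \<bullet> z)"
proof -
  have "cn S (CS \<rho> \<sigma> \<tau>) \<bullet> x \<bullet> y \<bullet> z \<in> D \<tau>"
    using cn_in[of "CS \<rho> \<sigma> \<tau>"] assms app_in by (metis ty_cnst.simps(6))
  moreover have "x \<bullet> z \<bullet> (y \<bullet> z) \<in> D \<tau>" using assms app_in by metis
  moreover have "ext_eq S \<tau> (cn S (CS \<rho> \<sigma> \<tau>) \<bullet> x \<bullet> y \<bullet> z) (x \<bullet> z \<bullet> (y \<bullet> z))"
    using hol_S[of \<rho> \<sigma> \<tau>] assms den_simps(3)[of S _ "[]"] den_simps(3)[of S _ "[_]"] den_simps(3)[of S _ "[_,_]"]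
    by (simp add: S_axiom_def hol_simps hol_eq_at)
  ultimately show ?thesis using ext_eq_iff by blast
qed

lemma CRec_app:
  assumes "f \<in> D (T0 \<Rrightarrow> T0 \<Rrightarrow> T0)"
  shows "cn S CRec \<bullet> f \<bullet> un m \<bullet> un 0 = un m"
    and "cn S CRec \<bullet> f \<bullet> un m \<bullet> un (n + 1) = f \<bullet> un n \<bullet> (cn S CRec \<bullet> f \<bullet> un m \<bullet> un n)"
  using hol_Rec assms den_simps(3)[of S _ "[]"] den_simps(3)[of S _ "[_]"] den_simps(3)[of S _ "[_,_]"]
  by (simp_all add: Rec_axiom_def hol_simps ball_T0 eqr_eq o_zero_def o_one_def o_plus_def cn_zero cn_one cn_plus)

definition envs :: "ty list \<Rightarrow> 'u list set" where
  "envs \<Gamma> = {e. list_all2 (\<lambda>v \<rho>. v \<in> D \<rho>) e \<Gamma>}"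

lemma envs_Nil [simp]: "e \<in> envs [] \<longleftrightarrow> e = []"
  by (simp add: envs_def)

lemma envs_Cons: "e \<in> envs (\<rho> # \<Gamma>) \<longleftrightarrow> (\<exists>v e'. e = v # e' \<and> v \<in> D \<rho> \<and> e' \<in> envs \<Gamma>)"
  by (auto simp: envs_def list_all2_Cons2)

lemma envs_Cons_Cons [simp]: "v # e \<in> envs (\<rho> # \<Gamma>) \<longleftrightarrow> v \<in> D \<rho> \<and> e \<in> envs \<Gamma>"
  by (simp add: envs_def)

text \<open>\<open>dfn \<Gamma> \<tau> F\<close>: as a function of the environments for \<open>\<Gamma>\<close>, \<open>F\<close> is represented by an element of
  the model, curried with the head of the environment as last argument.\<close>

primrec dfn :: "ty list \<Rightarrow> ty \<Rightarrow> ('u list \<Rightarrow> 'u) \<Rightarrow> bool" where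
  "dfn [] \<tau> F \<longleftrightarrow> F [] \<in> D \<tau>"
| "dfn (\<rho> # \<Gamma>) \<tau> F \<longleftrightarrow>
     (\<exists>G. dfn \<Gamma> (\<rho> \<Rrightarrow> \<tau>) G \<and> (\<forall>e\<in>envs \<Gamma>. \<forall>v\<in>D \<rho>. F (v # e) = G e \<bullet> v))"

named_theorems dfn_intros

lemma dfn_cong: "dfn \<Gamma> \<tau> F \<Longrightarrow> (\<And>e. e \<in> envs \<Gamma> \<Longrightarrow> F e = G e) \<Longrightarrow> dfn \<Gamma> \<tau> G"
  by (cases \<Gamma>) (auto simp: envs_Cons)

lemma dfn_in: "dfn \<Gamma> \<tau> F \<Longrightarrow> e \<in> envs \<Gamma> \<Longrightarrow> F e \<in> D \<tau>"
proof (induction \<Gamma> arbitrary: \<tau> F e)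
  case (Cons \<rho> \<Gamma>)
  then show ?case by (auto simp: envs_Cons) (metis app_in)
qed simp

lemma dfn_const [dfn_intros]: "c \<in> D \<tau> \<Longrightarrow> dfn \<Gamma> \<tau> (\<lambda>_. c)"
proof (induction \<Gamma> arbitrary: \<tau> c)
  case (Cons \<rho> \<Gamma>)
  have "cn S (CK \<tau> \<rho>) \<bullet> c \<in> D (\<rho> \<Rrightarrow> \<tau>)" using cn_in[of "CK \<tau> \<rho>"] Cons.prems app_in by (metis ty_cnst.simps(5))
  from Cons.IH[OF this] show ?case
    by (simp, intro exI[of _ "\<lambda>_. cn S (CK \<tau> \<rho>) \<bullet> c"]) (simp add: Cons.prems)
qed simp

lemma dfn_cn: "ty_cnst c = \<tau> \<Longrightarrow> dfn \<Gamma> \<tau> (\<lambda>_. cn S c)"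
  using cn_in dfn_const by metis

text \<open>Bracket abstraction: \<open>CS\<close> passes the last variable on to both parts of an
  application, as \<open>CK\<close> discards it in \<open>dfn_const\<close>. By induction on the
  context, all applicative expressions in variables and elements of the model are
  represented.\<close>

lemma dfn_app: "dfn \<Gamma> (\<sigma> \<Rrightarrow> \<tau>) F \<Longrightarrow> dfn \<Gamma> \<sigma> A \<Longrightarrow> dfn \<Gamma> \<tau> (\<lambda>e. F e \<bullet> A e)"
proof (induction \<Gamma> arbitrary: \<sigma> \<tau> F A)
  case Nil
  then show ?case by (auto intro: app_in)
next
  case (Cons \<rho> \<Gamma>)
  then obtain G B where G: "dfn \<Gamma> (\<rho> \<Rrightarrow> \<sigma> \<Rrightarrow> \<tau>) G" "\<forall>e\<in>envs \<Gamma>. \<forall>v\<in>D \<rho>. F (v # e) = G e \<bullet> v"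
    and B: "dfn \<Gamma> (\<rho> \<Rrightarrow> \<sigma>) B" "\<forall>e\<in>envs \<Gamma>. \<forall>v\<in>D \<rho>. A (v # e) = B e \<bullet> v" by auto
  have "dfn \<Gamma> (\<rho> \<Rrightarrow> \<tau>) (\<lambda>e. cn S (CS \<rho> \<sigma> \<tau>) \<bullet> G e \<bullet> B e)"
    by (rule Cons.IH[OF Cons.IH[OF dfn_cn G(1)] B(1)]) simp
  moreover have "F (v # e) \<bullet> A (v # e) = cn S (CS \<rho> \<sigma> \<tau>) \<bullet> G e \<bullet> B e \<bullet> v" if "e \<in> envs \<Gamma>" "v \<in> D \<rho>" for e v
    using that G(2) B(2) dfn_in[OF G(1)] dfn_in[OF B(1)] by simp
  ultimately show ?case by auto
qed

lemma dfn1E: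
  assumes "dfn [\<rho>] \<tau> F"
  obtains f where "f \<in> D (\<rho> \<Rrightarrow> \<tau>)" "\<And>x. x \<in> D \<rho> \<Longrightarrow> f \<bullet> x = F [x]"
  using assms by auto

lemma dfn2E:
  assumes "dfn [\<sigma>, \<rho>] \<tau> F"
  obtains f where "f \<in> D (\<rho> \<Rrightarrow> \<sigma> \<Rrightarrow> \<tau>)" "\<And>x y. x \<in> D \<rho> \<Longrightarrow> y \<in> D \<sigma> \<Longrightarrow> f \<bullet> x \<bullet> y = F [y, x]"
proof -
  obtain G where G: "dfn [\<rho>] (\<sigma> \<Rrightarrow> \<tau>) G" "\<forall>e\<in>envs [\<rho>]. \<forall>v\<in>D \<sigma>. F (v # e) = G e \<bullet> v" using assms by auto
  then obtain f where "f \<in> D (\<rho> \<Rrightarrow> \<sigma> \<Rrightarrow> \<tau>)" "\<And>x. x \<in> D \<rho> \<Longrightarrow> f \<bullet> x = G [x]" using dfn1E by metis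
  with G(2) that show thesis by simp
qed

lemma dfn3E:
  assumes "dfn [\<upsilon>, \<sigma>, \<rho>] \<tau> F"
  obtains f where "f \<in> D (\<rho> \<Rrightarrow> \<sigma> \<Rrightarrow> \<upsilon> \<Rrightarrow> \<tau>)"
    "\<And>x y z. x \<in> D \<rho> \<Longrightarrow> y \<in> D \<sigma> \<Longrightarrow> z \<in> D \<upsilon> \<Longrightarrow> f \<bullet> x \<bullet> y \<bullet> z = F [z, y, x]"
proof -
  obtain G where G: "dfn [\<sigma>, \<rho>] (\<upsilon> \<Rrightarrow> \<tau>) G" "\<forall>e\<in>envs [\<sigma>, \<rho>]. \<forall>v\<in>D \<upsilon>. F (v # e) = G e \<bullet> v" using assms by auto
  obtain f where "f \<in> D (\<rho> \<Rrightarrow> \<sigma> \<Rrightarrow> \<upsilon> \<Rrightarrow> \<tau>)" "\<And>x y. x \<in> D \<rho> \<Longrightarrow> y \<in> D \<sigma> \<Longrightarrow> f \<bullet> x \<bullet> y = G [y, x]"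
    using dfn2E[OF G(1)] by metis
  with G(2) that show thesis by simp
qed

lemma dfn_tl: "dfn \<Gamma> \<tau> F \<Longrightarrow> dfn (\<rho> # \<Gamma>) \<tau> (\<lambda>e. F (tl e))"
proof -
  assume F: "dfn \<Gamma> \<tau> F"
  have "dfn \<Gamma> (\<rho> \<Rrightarrow> \<tau>) (\<lambda>e. cn S (CK \<tau> \<rho>) \<bullet> F e)"
    by (rule dfn_app[OF dfn_cn F]) simp
  then show ?thesis using dfn_in[OF F] by auto
qed

lemma dfn_hd: "dfn (\<rho> # \<Gamma>) \<rho> hd"
proof -
  \<comment> \<open>The combinator S K K, at the types that make it the identity of type
    \<rho>.\<close>
  let ?I = "cn S (CS \<rho> (\<rho> \<Rrightarrow> \<rho>) \<rho>) \<bullet> cn S (CK \<rho> (\<rho> \<Rrightarrow> \<rho>)) \<bullet> cn S (CK \<rho> \<rho>)"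
  have "dfn \<Gamma> (\<rho> \<Rrightarrow> \<rho>) (\<lambda>_. ?I)"
    by (rule dfn_app[OF dfn_app[OF dfn_cn dfn_cn] dfn_cn]) simp_all
  moreover have "?I \<bullet> v = v" if "v \<in> D \<rho>" for v
  proof -
    have "?I \<bullet> v = cn S (CK \<rho> (\<rho> \<Rrightarrow> \<rho>)) \<bullet> v \<bullet> (cn S (CK \<rho> \<rho>) \<bullet> v)"
      using that by (intro CS_app) simp_all
    also have "\<dots> = v" by (rule CK_app[OF that app_in[OF CK_in that]])
    finally show ?thesis .
  qed
  ultimately show ?thesis by auto
qed

lemma dfn_vars [dfn_intros]:
  "dfn (\<rho> # \<Gamma>) \<rho> (\<lambda>e. hd e)"
  "dfn (\<rho>1 # \<rho> # \<Gamma>) \<rho> (\<lambda>e. hd (tl e))"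
  "dfn (\<rho>1 # \<rho>2 # \<rho> # \<Gamma>) \<rho> (\<lambda>e. hd (tl (tl e)))"
  "dfn (\<rho>1 # \<rho>2 # \<rho>3 # \<rho> # \<Gamma>) \<rho> (\<lambda>e. hd (tl (tl (tl e))))"
  "dfn (\<rho>1 # \<rho>2 # \<rho>3 # \<rho>4 # \<rho> # \<Gamma>) \<rho> (\<lambda>e. hd (tl (tl (tl (tl e)))))"
  "dfn (\<rho>1 # \<rho>2 # \<rho>3 # \<rho>4 # \<rho>5 # \<rho> # \<Gamma>) \<rho> (\<lambda>e. hd (tl (tl (tl (tl (tl e))))))"
  "dfn (\<rho>1 # \<rho>2 # \<rho>3 # \<rho>4 # \<rho>5 # \<rho>6 # \<rho> # \<Gamma>) \<rho> (\<lambda>e. hd (tl (tl (tl (tl (tl (tl e)))))))"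
  "dfn (\<rho>1 # \<rho>2 # \<rho>3 # \<rho>4 # \<rho>5 # \<rho>6 # \<rho>7 # \<rho> # \<Gamma>) \<rho> (\<lambda>e. hd (tl (tl (tl (tl (tl (tl (tl e))))))))"
  by (intro dfn_tl dfn_hd)+

section \<open>Definable number-valued functions and predicates\<close>

definition dn :: "ty list \<Rightarrow> ('u list \<Rightarrow> 'n) \<Rightarrow> bool" where
  "dn \<Gamma> F \<longleftrightarrow> dfn \<Gamma> T0 (\<lambda>e. un (F e))"

definition dp :: "ty list \<Rightarrow> ('u list \<Rightarrow> bool) \<Rightarrow> bool" where
  "dp \<Gamma> P \<longleftrightarrow> dn \<Gamma> (\<lambda>e. if P e then 1 else 0)"

lemma dn_cong: "dn \<Gamma> F \<Longrightarrow> (\<And>e. e \<in> envs \<Gamma> \<Longrightarrow> F e = G e) \<Longrightarrow> dn \<Gamma> G"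
  unfolding dn_def by (erule dfn_cong) simp

lemma dp_cong: "dp \<Gamma> P \<Longrightarrow> (\<And>e. e \<in> envs \<Gamma> \<Longrightarrow> P e = Q e) \<Longrightarrow> dp \<Gamma> Q"
  unfolding dp_def by (erule dn_cong) simp

lemma dn_const [dfn_intros]: "dn \<Gamma> (\<lambda>_. c)"
  unfolding dn_def by (rule dfn_const) simp

lemma dn_nm [dfn_intros]: "dfn \<Gamma> T0 F \<Longrightarrow> dn \<Gamma> (\<lambda>e. nm (F e))"
  unfolding dn_def by (rule dfn_cong, assumption) (simp add: un_nm dfn_in)

lemma dfn_un [dfn_intros]: "dn \<Gamma> F \<Longrightarrow> dfn \<Gamma> T0 (\<lambda>e. un (F e))"
  by (simp add: dn_def)

lemma dn_fn [dfn_intros]: "dfn \<Gamma> T1 X \<Longrightarrow> dn \<Gamma> N \<Longrightarrow> dn \<Gamma> (\<lambda>e. fn (X e) (N e))"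
  unfolding fn_def by (intro dn_nm dfn_app[of \<Gamma> T0] dfn_un)

lemma dn_app [dfn_intros]: "H \<in> D T2 \<Longrightarrow> dfn \<Gamma> T1 X \<Longrightarrow> dn \<Gamma> (\<lambda>e. nm (H \<bullet> X e))"
  by (intro dn_nm dfn_app[of \<Gamma> T1] dfn_const)

lemma dfn_seq [dfn_intros]: "w \<in> D (T0 \<Rrightarrow> T1) \<Longrightarrow> dn \<Gamma> N \<Longrightarrow> dfn \<Gamma> T1 (\<lambda>e. w \<bullet> un (N e))"
  by (intro dfn_app[of \<Gamma> T0] dfn_const dfn_un)

lemma dfn_fun [dfn_intros]: "f \<in> D (T1 \<Rrightarrow> T1) \<Longrightarrow> dfn \<Gamma> T1 X \<Longrightarrow> dfn \<Gamma> T1 (\<lambda>e. f \<bullet> X e)"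
  by (intro dfn_app[of \<Gamma> T1] dfn_const)

lemma dn_add [dfn_intros]: "dn \<Gamma> F \<Longrightarrow> dn \<Gamma> G \<Longrightarrow> dn \<Gamma> (\<lambda>e. F e + G e)"
  unfolding dn_def cn_plus[symmetric] by (rule dfn_app[OF dfn_app[OF dfn_cn]]) auto

lemma dn_mult [dfn_intros]: "dn \<Gamma> F \<Longrightarrow> dn \<Gamma> G \<Longrightarrow> dn \<Gamma> (\<lambda>e. F e * G e)"
  unfolding dn_def cn_times[symmetric] by (rule dfn_app[OF dfn_app[OF dfn_cn]]) auto

text \<open>The recursor with a constant step is a table of two entries. It serves as a case
  distinction on a truth value, which gives negation, and as a container that hands two numbers to a
  functional of type 2.\<close>

lemma rec_const:
  assumes "a \<in> D T0" "b \<in> D T0"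
  defines "f \<equiv> cn S CRec \<bullet> (cn S (CK T1 T0) \<bullet> (cn S (CK T0 T0) \<bullet> b)) \<bullet> a"
  shows "f \<in> D T1" "f \<bullet> un 0 = a" "f \<bullet> un 1 = b"
proof -
  have K: "cn S (CK T0 T0) \<bullet> b \<in> D T1" by (rule app_in[OF CK_in assms(2)])
  then have KK: "cn S (CK T1 T0) \<bullet> (cn S (CK T0 T0) \<bullet> b) \<in> D (T0 \<Rrightarrow> T0 \<Rrightarrow> T0)"
    by (rule app_in[OF CK_in])
  then show f: "f \<in> D T1" unfolding f_def using assms(1) by (intro app_in[OF app_in[OF CRec_in]])
  show "f \<bullet> un 0 = a" using CRec_app(1)[OF KK, of "nm a"] assms by (simp add: un_nm)
  have "f \<bullet> un 0 \<in> D T0" using f by auto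
  then show "f \<bullet> un 1 = b" using CRec_app(2)[OF KK, of "nm a" 0] assms K by (simp add: un_nm f_def)
qed

lemma dfn_rec_const: "dfn \<Gamma> T0 A \<Longrightarrow> dfn \<Gamma> T0 B \<Longrightarrow>
   dfn \<Gamma> T1 (\<lambda>e. cn S CRec \<bullet> (cn S (CK T1 T0) \<bullet> (cn S (CK T0 T0) \<bullet> B e)) \<bullet> A e)"
  by (rule dfn_app[OF dfn_app[OF dfn_cn dfn_app[OF dfn_cn dfn_app[OF dfn_cn]]]]) auto

lemma dp_not [dfn_intros]: "dp \<Gamma> P \<Longrightarrow> dp \<Gamma> (\<lambda>e. \<not> P e)"
proof -
  assume P: "dp \<Gamma> P"
  have "dfn \<Gamma> T0 (\<lambda>e. cn S CRec \<bullet> (cn S (CK T1 T0) \<bullet> (cn S (CK T0 T0) \<bullet> un 0)) \<bullet> un 1 \<bullet> un (if P e then 1 else 0))"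
    by (rule dfn_app[OF dfn_rec_const[OF dfn_const dfn_const]]) (use P in \<open>auto simp: dp_def dn_def\<close>)
  then have "dfn \<Gamma> T0 (\<lambda>e. un (if \<not> P e then 1 else 0))"
    by (rule dfn_cong) (use rec_const in auto)
  then show ?thesis by (simp add: dp_def dn_def)
qed

lemma dp_conj [dfn_intros]: "dp \<Gamma> P \<Longrightarrow> dp \<Gamma> Q \<Longrightarrow> dp \<Gamma> (\<lambda>e. P e \<and> Q e)"
proof -
  assume "dp \<Gamma> P" "dp \<Gamma> Q"
  then have "dn \<Gamma> (\<lambda>e. (if P e then 1 else 0) * (if Q e then 1 else 0))"
    unfolding dp_def by (rule dn_mult)
  then show ?thesis unfolding dp_def by (rule dn_cong) auto
qed

lemma dp_disj [dfn_intros]: "dp \<Gamma> P \<Longrightarrow> dp \<Gamma> Q \<Longrightarrow> dp \<Gamma> (\<lambda>e. P e \<or> Q e)"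
proof -
  assume "dp \<Gamma> P" "dp \<Gamma> Q"
  then have "dp \<Gamma> (\<lambda>e. \<not> (\<not> P e \<and> \<not> Q e))" by (intro dp_not dp_conj)
  then show ?thesis by simp
qed

lemma dp_imp [dfn_intros]: "dp \<Gamma> P \<Longrightarrow> dp \<Gamma> Q \<Longrightarrow> dp \<Gamma> (\<lambda>e. P e \<longrightarrow> Q e)"
  unfolding imp_conv_disj by (intro dp_disj dp_not)

lemma dn_if [dfn_intros]:
  "dp \<Gamma> P \<Longrightarrow> dn \<Gamma> F \<Longrightarrow> dn \<Gamma> G \<Longrightarrow> dn \<Gamma> (\<lambda>e. if P e then F e else G e)"
proof -
  assume *: "dp \<Gamma> P" "dn \<Gamma> F" "dn \<Gamma> G"
  then have "dn \<Gamma> (\<lambda>e. (if P e then 1 else 0) * F e + (if \<not> P e then 1 else 0) * G e)"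
    using dp_not[OF *(1)] unfolding dp_def by (intro dn_add dn_mult)
  then show ?thesis by (rule dn_cong) auto
qed

text \<open>Typability in the empty context excludes loose variables, so neither substitution nor
  the environment affects the term. Hence \<open>fill\<close> leaves it alone and it acts as a name
  for \<open>c\<close> inside a scheme.\<close>

lemma closed_term:
  assumes "c \<in> D \<rho>"
  obtains t where "\<And>\<Delta>. ty_of \<Delta> t = Some \<rho>" "\<And>e. eval S e t = c" "\<And>\<theta>. subst_tm \<theta> t = t"
proof -
  have "\<exists>t. ty_of [] t = Some \<rho> \<and> eval S [] t = c" using normal assms unfolding normal_def by blast
  then obtain t where t: "ty_of [] t = Some \<rho>" "eval S [] t = c" by blast
  have "ty_of \<Delta> t = Some \<tau> \<and> eval S e t = eval S [] t \<and> subst_tm \<theta> t = t" if "ty_of [] t = Some \<tau>" for t \<tau> e \<Delta> \<theta>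
    using that by (induction t arbitrary: \<tau>) (auto simp: ty_of_App simp del: ty_of.simps(4))
  with t that show thesis by metis
qed

lemma fn_induct:
  assumes "x \<in> D T1" "fn x 0 = 1" "\<And>n. fn x n = 1 \<Longrightarrow> fn x (n + 1) = 1"
  shows "fn x n = 1"
proof -
  obtain t where t: "\<And>\<Delta>. ty_of \<Delta> t = Some T1" "\<And>e. eval S e t = x" "\<And>\<theta>. subst_tm \<theta> t = t"
    using closed_term[OF assms(1)] by blast
  have ind: "hol S [] (induction (Eq (App t (Bnd 0)) (Cn COne)))"
    by (rule hol_induction) (simp_all add: t)
  have fill_iff: "hol S e (fill (Eq (App t (Bnd 0)) (Cn COne)) [y]) \<longleftrightarrow> x \<bullet> den S e y = un 1" for e y
    by (simp add: hol_def fill_def t den_def eqr_eq cn_one)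
  have "x \<bullet> un 0 = un 1 \<and> (\<forall>n. x \<bullet> un n = un 1 \<longrightarrow> x \<bullet> un (n + 1) = un 1) \<longrightarrow> (\<forall>n. x \<bullet> un n = un 1)"
    using ind unfolding induction_def hol_all hol_connectives ball_T0 o_zero_def o_one_def o_plus_def
      fill_iff den_simps cn_zero cn_one cn_plus .
  moreover have "x \<bullet> un k = un 1 \<longleftrightarrow> fn x k = 1" for k by (simp add: un_fn assms(1))
  ultimately show ?thesis using assms(2,3) by blast
qed

text \<open>Definability replaces the predicate by its characteristic function, an object of type 1.
  Quantifier-free induction is then applied to the equation saying that its value is 1, whatever the
  logical complexity of the predicate.\<close>

lemma internal_induct:
  assumes "dp [T0] (\<lambda>e. P (nm (hd e)))" "P 0" "\<And>n. P n \<Longrightarrow> P (n + 1)"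
  shows "P n"
proof -
  obtain x where x: "x \<in> D T1" "\<forall>v\<in>D T0. un (if P (nm v) then 1 else 0) = x \<bullet> v"
    using assms(1) by (auto simp: dp_def dn_def)
  have f: "fn x n = (if P n then 1 else 0)" for n
  proof -
    have "x \<bullet> un n = un (if P (nm (un n)) then 1 else 0)" using x(2) un_in by metis
    then show ?thesis by (simp add: fn_def)
  qed
  have "fn x n = 1"
  proof (rule fn_induct[OF x(1)])
    show "fn x 0 = 1" using assms(2) by (simp add: f)
    show "fn x (n + 1) = 1" if "fn x n = 1" for n
      using that assms(3)[of n] by (cases "P n") (simp_all add: f)
  qed
  then show ?thesis by (cases "P n") (simp_all add: f)
qed

lemma choice_10:
  assumes "c \<in> D (T1 \<Rrightarrow> T0 \<Rrightarrow> T0)" "\<And>x. x \<in> D T1 \<Longrightarrow> \<exists>n. c \<bullet> x \<bullet> un n = un 1"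
  obtains Y where "Y \<in> D T2" "\<And>x. x \<in> D T1 \<Longrightarrow> c \<bullet> x \<bullet> (Y \<bullet> x) = un 1"
proof -
  obtain t where t: "\<And>\<Delta>. ty_of \<Delta> t = Some (T1 \<Rrightarrow> T0 \<Rrightarrow> T0)" "\<And>e. eval S e t = c" "\<And>\<theta>. subst_tm \<theta> t = t"
    using closed_term[OF assms(1)] by blast
  let ?A = "Eq (App (App t (Bnd 0)) (Bnd 1)) (Cn COne)"
  have "hol S [] (choice T1 T0 ?A)"
    by (rule hol_choice_10) (simp_all add: t)
  moreover have "hol S e (fill ?A [x, y]) \<longleftrightarrow> c \<bullet> den S e x \<bullet> den S e y = un 1" for e x y
    by (simp add: hol_def fill_def t den_def eqr_eq cn_one)
  ultimately have "\<exists>Y\<in>D T2. \<forall>x\<in>D T1. c \<bullet> x \<bullet> (Y \<bullet> x) = un 1"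
    using assms(2) den_simps(3)[of S _ "[]"] den_simps(3)[of S _ "[_]"]
    by (simp add: choice_def hol_all hol_ex hol_connectives bex_T0 den_simps den_Cons stab_simps)
  with that show thesis by blast
qed

lemma choice_01:
  assumes "c \<in> D (T0 \<Rrightarrow> T1 \<Rrightarrow> T0)" "\<And>n. \<exists>x\<in>D T1. c \<bullet> un n \<bullet> x = un 1"
  obtains Y where "Y \<in> D (T0 \<Rrightarrow> T1)" "\<And>n. c \<bullet> un n \<bullet> (Y \<bullet> un n) = un 1"
proof -
  obtain t where t: "\<And>\<Delta>. ty_of \<Delta> t = Some (T0 \<Rrightarrow> T1 \<Rrightarrow> T0)" "\<And>e. eval S e t = c" "\<And>\<theta>. subst_tm \<theta> t = t"
    using closed_term[OF assms(1)] by blast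
  let ?A = "Eq (App (App t (Bnd 0)) (Bnd 1)) (Cn COne)"
  have "hol S [] (choice T0 T1 ?A)"
    by (rule hol_choice_01) (simp_all add: t)
  moreover have "hol S e (fill ?A [x, y]) \<longleftrightarrow> c \<bullet> den S e x \<bullet> den S e y = un 1" for e x y
    by (simp add: hol_def fill_def t den_def eqr_eq cn_one)
  ultimately have "\<exists>Y\<in>D (T0 \<Rrightarrow> T1). \<forall>n. c \<bullet> un n \<bullet> (Y \<bullet> un n) = un 1"
    using assms(2) den_simps(3)[of S _ "[]"] den_simps(3)[of S _ "[_]"]
    by (simp add: choice_def hol_all hol_ex hol_connectives ball_T0 den_simps den_Cons stab_simps)
  with that show thesis by blast
qed

text \<open>The order is a relation symbol and has no term for its characteristic function.
  Quantifier-free choice provides one, the two numbers being stored as the values of a type 1 object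
  at 0 and 1.\<close>

lemma less_functional:
  obtains Y where "Y \<in> D T2" "\<And>x. x \<in> D T1 \<Longrightarrow> Y \<bullet> x = un (if fn x 0 < fn x 1 then 1 else 0)"
proof -
  let ?L = "Less (App (Bnd 0) (Cn CZero)) (App (Bnd 0) (Cn COne))"
  \<comment> \<open>A conjunction spelled out with \<open>Imp\<close> and \<open>Bot\<close>: the
    value is 1 if the inequality holds and 0 if it fails.\<close>
  let ?A = "Imp (Imp (Imp ?L (Eq (Bnd 1) (Cn COne)))
              (Imp (Imp (Imp ?L Bot) (Eq (Bnd 1) (Cn CZero))) Bot)) Bot"
  have "hol S [] (choice T1 T0 ?A)"
    by (rule hol_choice_10) simp_all
  moreover have A: "hol S e (fill ?A [x, y]) \<longleftrightarrow> den S e y = un (if fn (den S e x) 0 < fn (den S e x) 1 then 1 else 0)"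
    if "den S e x \<in> D T1" for e x y
    using that by (auto simp: hol_def fill_def den_def eqr_eq cn_one cn_zero lsr_un un_fn)
  ultimately have "\<exists>Y\<in>D T2. \<forall>x\<in>D T1. Y \<bullet> x = un (if fn x 0 < fn x 1 then 1 else 0)"
    using den_simps(3)[of S _ "[]"] den_simps(3)[of S _ "[_]"]
    by (simp add: choice_def hol_all hol_ex hol_connectives bex_T0 den_simps den_Cons stab_simps A)
  with that show thesis by blast
qed

lemma dp_less [dfn_intros]: "dn \<Gamma> F \<Longrightarrow> dn \<Gamma> G \<Longrightarrow> dp \<Gamma> (\<lambda>e. F e < G e)"
proof -
  assume FG: "dn \<Gamma> F" "dn \<Gamma> G"
  obtain Y where Y: "Y \<in> D T2" "\<And>x. x \<in> D T1 \<Longrightarrow> Y \<bullet> x = un (if fn x 0 < fn x 1 then 1 else 0)"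
    using less_functional by blast
  have "dfn \<Gamma> T0 (\<lambda>e. Y \<bullet> (cn S CRec \<bullet> (cn S (CK T1 T0) \<bullet> (cn S (CK T0 T0) \<bullet> un (G e))) \<bullet> un (F e)))"
    by (rule dfn_app[OF dfn_const[OF Y(1)] dfn_rec_const]) (use FG in \<open>auto simp: dn_def\<close>)
  then show ?thesis
    unfolding dp_def dn_def
    by (rule dfn_cong) (simp add: Y(2) rec_const fn_def)
qed

lemma dp_le [dfn_intros]: "dn \<Gamma> F \<Longrightarrow> dn \<Gamma> G \<Longrightarrow> dp \<Gamma> (\<lambda>e. F e \<le> G e)"
  unfolding not_less[symmetric] by (intro dfn_intros)

lemma dp_eq [dfn_intros]: "dn \<Gamma> F \<Longrightarrow> dn \<Gamma> G \<Longrightarrow> dp \<Gamma> (\<lambda>e. F e = G e)"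
  unfolding order.eq_iff by (intro dfn_intros)

section \<open>Arithmetical comprehension and minimization\<close>

lemma Exists2E:
  obtains \<phi> where "\<phi> \<in> D T2" "\<And>f. f \<in> D T1 \<Longrightarrow> \<phi> \<bullet> f = un (if \<exists>n. f \<bullet> un n = un 0 then 0 else 1)"
proof -
  have "\<exists>\<phi>\<in>D T2. (\<forall>f\<in>D T1. lsr S (\<phi> \<bullet> f) (un 1) \<or> \<phi> \<bullet> f = un 1) \<and>
      (\<forall>f\<in>D T1. (\<exists>n. f \<bullet> un n = un 0) \<longleftrightarrow> \<phi> \<bullet> f = un 0)"
    using hol_Exists2 den_simps(3)[of S _ "[]"] den_simps(3)[of S _ "[_]"] den_simps(3)[of S _ "[_,_]"]
    by (simp add: Exists2_def hol_simps bex_T0 eqr_eq o_le_def o_zero_def o_one_def cn_zero cn_one)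
  then obtain \<phi> where \<phi>: "\<phi> \<in> D T2" "\<And>f. f \<in> D T1 \<Longrightarrow> lsr S (\<phi> \<bullet> f) (un 1) \<or> \<phi> \<bullet> f = un 1"
      "\<And>f. f \<in> D T1 \<Longrightarrow> (\<exists>n. f \<bullet> un n = un 0) \<longleftrightarrow> \<phi> \<bullet> f = un 0" by blast
  have "\<phi> \<bullet> f = un (if \<exists>n. f \<bullet> un n = un 0 then 0 else 1)" if f: "f \<in> D T1" for f
  proof -
    obtain a where a: "\<phi> \<bullet> f = un a" using app_in[OF \<phi>(1) f] dm_T0 by auto
    have "a < 1 \<Longrightarrow> a = 0" using ds_discrete[of a] ds_nonneg[of a] by (metis leD le_less)
    then show ?thesis using \<phi>(2)[OF f] \<phi>(3)[OF f] a by (auto simp: lsr_un)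
  qed
  with \<phi>(1) that show thesis by blast
qed

text \<open>Kleene's functional looks for zeros. It is applied to the characteristic function of the
  negated predicate, which vanishes exactly where the predicate holds; its value 1 then means that
  there is no witness.\<close>

lemma dp_ex [dfn_intros]:
  assumes "dp (T0 # \<Gamma>) (\<lambda>e. P (tl e) (nm (hd e)))"
  shows "dp \<Gamma> (\<lambda>e. \<exists>n. P e n)"
proof -
  obtain \<phi> where \<phi>: "\<phi> \<in> D T2" "\<And>f. f \<in> D T1 \<Longrightarrow> \<phi> \<bullet> f = un (if \<exists>n. f \<bullet> un n = un 0 then 0 else 1)"
    using Exists2E by blast
  obtain G where G: "dfn \<Gamma> T1 G" "\<And>e v. e \<in> envs \<Gamma> \<Longrightarrow> v \<in> D T0 \<Longrightarrow> un (if \<not> P e (nm v) then 1 else 0) = G e \<bullet> v"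
    using dp_not[OF assms] by (auto simp: dp_def dn_def)
  have "dfn \<Gamma> T0 (\<lambda>e. \<phi> \<bullet> G e)" by (intro dfn_app[of \<Gamma> T1] dfn_const \<phi> G)
  then have "dp \<Gamma> (\<lambda>e. \<not> (\<exists>n. P e n))"
    unfolding dp_def dn_def
    by (rule dfn_cong) (auto simp: \<phi>(2) dfn_in[OF G(1)] G(2)[symmetric])
  from dp_not[OF this] show ?thesis by simp
qed

lemma dp_all [dfn_intros]:
  assumes "dp (T0 # \<Gamma>) (\<lambda>e. P (tl e) (nm (hd e)))"
  shows "dp \<Gamma> (\<lambda>e. \<forall>n. P e n)"
  using dp_not[OF dp_ex[OF dp_not[OF assms]]] by simp

text \<open>Feferman's search operator. The second disjunct, that f has no zero, makes the relation
  total, and it is definable by the number quantifier; so choice of a number for each type 1 object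
  applies.\<close>

lemma mu_functional:
  obtains \<mu> where "\<mu> \<in> D T2" "\<And>f. f \<in> D T1 \<Longrightarrow> (\<exists>n. fn f n = 0) \<Longrightarrow> f \<bullet> (\<mu> \<bullet> f) = un 0"
proof -
  have "dp [T0, T1] (\<lambda>e. fn (hd (tl e)) (nm (hd e)) = 0 \<or> (\<forall>n. fn (hd (tl e)) n \<noteq> 0))"
    by (intro dfn_intros)
  from this[unfolded dp_def dn_def] obtain c where c: "c \<in> D (T1 \<Rrightarrow> T0 \<Rrightarrow> T0)"
    "\<And>f v. f \<in> D T1 \<Longrightarrow> v \<in> D T0 \<Longrightarrow> c \<bullet> f \<bullet> v = un (if fn f (nm v) = 0 \<or> (\<forall>n. fn f n \<noteq> 0) then 1 else 0)"
    by (rule dfn2E) simp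
  have "\<exists>n. c \<bullet> f \<bullet> un n = un 1" if "f \<in> D T1" for f using that c(2) by auto
  with c(1) obtain \<mu> where \<mu>: "\<mu> \<in> D T2" "\<And>f. f \<in> D T1 \<Longrightarrow> c \<bullet> f \<bullet> (\<mu> \<bullet> f) = un 1"
    using choice_10 by blast
  have "f \<bullet> (\<mu> \<bullet> f) = un 0" if f: "f \<in> D T1" "\<exists>n. fn f n = 0" for f
  proof -
    have m: "\<mu> \<bullet> f \<in> D T0" using \<mu>(1) f(1) by auto
    have "fn f (nm (\<mu> \<bullet> f)) = 0" using \<mu>(2)[OF f(1)] c(2)[OF f(1) m] f(2) by (auto split: if_splits)
    then show ?thesis using un_fn[OF f(1), of "nm (\<mu> \<bullet> f)"] un_nm[OF m] by simp
  qed
  with \<mu>(1) that show thesis by blast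
qed

lemma dn_The:
  assumes "dp (T0 # \<Gamma>) (\<lambda>e. P (tl e) (nm (hd e)))" "\<And>e. e \<in> envs \<Gamma> \<Longrightarrow> \<exists>!n. P e n"
  shows "dn \<Gamma> (\<lambda>e. THE n. P e n)"
proof -
  obtain \<mu> where \<mu>: "\<mu> \<in> D T2" "\<And>f. f \<in> D T1 \<Longrightarrow> (\<exists>n. fn f n = 0) \<Longrightarrow> f \<bullet> (\<mu> \<bullet> f) = un 0"
    using mu_functional by blast
  obtain G where G: "dfn \<Gamma> T1 G" "\<And>e v. e \<in> envs \<Gamma> \<Longrightarrow> v \<in> D T0 \<Longrightarrow> G e \<bullet> v = un (if \<not> P e (nm v) then 1 else 0)"
    using dp_not[OF assms(1)] by (auto simp: dp_def dn_def)
  have "dn \<Gamma> (\<lambda>e. nm (\<mu> \<bullet> G e))" by (intro dn_app G \<mu>)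
  then show ?thesis
  proof (rule dn_cong)
    fix e assume e: "e \<in> envs \<Gamma>"
    have G': "G e \<in> D T1" using G(1) e dfn_in by blast
    have *: "fn (G e) n = (if \<not> P e n then 1 else 0)" for n unfolding fn_def using G(2)[OF e] by simp
    obtain n where "P e n" using assms(2)[OF e] by blast
    with * have "fn (G e) n = 0" by simp
    then have "G e \<bullet> (\<mu> \<bullet> G e) = un 0" using \<mu>(2)[OF G'] by blast
    then have "P e (nm (\<mu> \<bullet> G e))" using G(2)[OF e app_in[OF \<mu>(1) G']]
      by (cases "P e (nm (\<mu> \<bullet> G e))") auto
    then show "nm (\<mu> \<bullet> G e) = (THE n. P e n)" using assms(2)[OF e] by (metis the_equality)
  qed
qed

abbreviation dset :: "('n \<Rightarrow> bool) \<Rightarrow> bool" where "dset P \<equiv> dp [T0] (\<lambda>e. P (nm (hd e)))"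

lemma dset_section: "dp (T0 # \<Gamma>) (\<lambda>e. P (tl e) (nm (hd e))) \<Longrightarrow> e \<in> envs \<Gamma> \<Longrightarrow> dset (P e)"
proof -
  assume "dp (T0 # \<Gamma>) (\<lambda>e. P (tl e) (nm (hd e)))" and e: "e \<in> envs \<Gamma>"
  then obtain G where G: "dfn \<Gamma> T1 G" "\<forall>e\<in>envs \<Gamma>. \<forall>v\<in>D T0. un (if P e (nm v) then 1 else 0) = G e \<bullet> v"
    by (auto simp: dp_def dn_def)
  then have "dfn [T0] T0 (\<lambda>e'. un (if P e (nm (hd e')) then 1 else 0))"
    using dfn_in[OF G(1) e] e by (simp del: if_split) (rule exI[of _ "\<lambda>_. G e"], simp)
  then show ?thesis by (simp add: dp_def dn_def)
qed

lemma dset_subst: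
  assumes "dset P" "dn \<Gamma> F"
  shows "dp \<Gamma> (\<lambda>e. P (F e))"
proof -
  obtain x where x: "x \<in> D T1" "\<forall>v\<in>D T0. un (if P (nm v) then 1 else 0) = x \<bullet> v"
    using assms(1) by (auto simp: dp_def dn_def)
  have f: "fn x n = (if P n then 1 else 0)" for n
  proof -
    have "x \<bullet> un n = un (if P (nm (un n)) then 1 else 0)" using x(2) un_in by metis
    then show ?thesis by (simp add: fn_def)
  qed
  have "dn \<Gamma> (\<lambda>e. fn x (F e))" by (intro dn_fn dfn_const x assms(2))
  then show ?thesis unfolding dp_def f .
qed

lemma less_add_one_iff: "(a :: 'n) < b + 1 \<longleftrightarrow> a \<le> b"
  using rn_less_Suc_iff[of a b] by (metis rn_simps(2,3,5))

text \<open>Well-foundedness of the order on \<open>'n\<close> fails in general. A definable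
  predicate without a least element is refuted by internal induction on the bounded statement that
  it fails up to m.\<close>

lemma internal_least:
  assumes "dset P" "P n"
  obtains m where "P m" "\<And>k. k < m \<Longrightarrow> \<not> P k"
proof (rule ccontr)
  assume "\<not> thesis"
  with that have *: "\<And>m. P m \<Longrightarrow> \<exists>k<m. P k" by blast
  have "\<forall>k. k \<le> m \<longrightarrow> \<not> P k" for m
  proof (rule internal_induct[of "\<lambda>m. \<forall>k. k \<le> m \<longrightarrow> \<not> P k"])
    show "dset (\<lambda>m. \<forall>k. k \<le> m \<longrightarrow> \<not> P k)" by (intro dfn_intros dset_subst[OF assms(1)])
    show "\<forall>k. k \<le> 0 \<longrightarrow> \<not> P k" using * ds_nonneg by (metis leD order_antisym)
    show "\<forall>k. k \<le> n + 1 \<longrightarrow> \<not> P k" if "\<forall>k. k \<le> n \<longrightarrow> \<not> P k" for n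
      using that * less_add_one_iff by (metis le_less)
  qed
  with assms(2) show False by blast
qed

lemma internal_Least:
  assumes "dset P" "P n"
  shows "P (LEAST n. P n)" "(LEAST n. P n) \<le> n"
proof -
  obtain m where m: "P m" "\<And>k. k < m \<Longrightarrow> \<not> P k" using internal_least[OF assms] by blast
  then have "(LEAST n. P n) = m" by (intro Least_equality) (auto simp: not_less[symmetric])
  with m assms(2) show "P (LEAST n. P n)" "(LEAST n. P n) \<le> n" by (auto simp: not_less[symmetric])
qed

lemma dn_Least:
  assumes P: "dp (T0 # \<Gamma>) (\<lambda>e. P (tl e) (nm (hd e)))" and ex: "\<And>e. e \<in> envs \<Gamma> \<Longrightarrow> \<exists>n. P e n"
  shows "dn \<Gamma> (\<lambda>e. LEAST n. P e n)"
proof -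
  obtain G where G: "dfn \<Gamma> T1 G" "\<And>e v. e \<in> envs \<Gamma> \<Longrightarrow> v \<in> D T0 \<Longrightarrow> un (if P e (nm v) then 1 else 0) = G e \<bullet> v"
    using P by (auto simp: dp_def dn_def)
  have f: "fn (G e) n = (if P e n then 1 else 0)" if e: "e \<in> envs \<Gamma>" for e n
    using G(2)[OF e un_in, of n] unfolding fn_def by (metis nm_un)
  \<comment> \<open>Minimality is expressed through \<open>G\<close> and not through
    \<open>P\<close>: the inner quantifier adds a variable between n and the context, and
    \<open>dfn_tl\<close> can move \<open>G\<close> past it.\<close>
  let ?Q = "\<lambda>e n. fn (G e) n = 1 \<and> (\<forall>k. k < n \<longrightarrow> fn (G e) k \<noteq> 1)"
  have Q: "?Q e n \<longleftrightarrow> P e n \<and> (\<forall>k<n. \<not> P e k)" if "e \<in> envs \<Gamma>" for e n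
    using that by (auto simp: f)
  have "dn \<Gamma> (\<lambda>e. THE n. ?Q e n)"
  proof (rule dn_The)
    show "dp (T0 # \<Gamma>) (\<lambda>e. ?Q (tl e) (nm (hd e)))"
      by (intro dfn_intros dfn_tl[OF G(1)] dfn_tl[OF dfn_tl[OF G(1)]])
    fix e assume e: "e \<in> envs \<Gamma>"
    obtain n where "P e n" using ex[OF e] by blast
    with dset_section[OF P e] obtain m where "P e m" "\<And>k. k < m \<Longrightarrow> \<not> P e k" using internal_least by blast
    then show "\<exists>!n. ?Q e n" unfolding Q[OF e] by (metis linorder_neqE)
  qed
  then show ?thesis
  proof (rule dn_cong)
    fix e assume e: "e \<in> envs \<Gamma>"
    obtain n where "P e n" using ex[OF e] by blast
    with dset_section[OF P e] obtain m where m: "P e m" "\<And>k. k < m \<Longrightarrow> \<not> P e k" using internal_least by blast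
    have "(LEAST n. P e n) = m" using m by (intro Least_equality) (auto simp: not_less[symmetric])
    moreover have "(THE n. ?Q e n) = m" unfolding Q[OF e] using m by (intro the_equality) (metis linorder_neqE)+
    ultimately show "(THE n. ?Q e n) = (LEAST n. P e n)" by simp
  qed
qed


section \<open>Rational numbers in a model\<close>

lemma den_arith [simp]:
  "den S e \<^bold>0 = un 0" "den S e \<^bold>1 = un 1"
  "den S e s \<in> D T0 \<Longrightarrow> den S e t \<in> D T0 \<Longrightarrow> den S e (s \<^bold>+ t) = un (nm (den S e s) + nm (den S e t))"
  "den S e s \<in> D T0 \<Longrightarrow> den S e t \<in> D T0 \<Longrightarrow> den S e (s \<^bold>* t) = un (nm (den S e s) * nm (den S e t))"
  using cn_plus[of "nm (den S e s)" "nm (den S e t)"] cn_times[of "nm (den S e s)" "nm (den S e t)"]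
  by (simp_all add: o_zero_def o_one_def o_plus_def o_times_def hol_simps cn_zero cn_one un_nm)

lemma stab_arith [simp]:
  "stab S e \<^bold>0" "stab S e \<^bold>1"
  "stab S e s \<Longrightarrow> stab S e t \<Longrightarrow> stab S e (s \<^bold>+ t)"
  "stab S e s \<Longrightarrow> stab S e t \<Longrightarrow> stab S e (s \<^bold>* t)"
  by (simp_all add: o_zero_def o_one_def o_plus_def o_times_def hol_simps)

lemma hol_T0 [simp]:
  "den S e s \<in> D T0 \<Longrightarrow> den S e t \<in> D T0 \<Longrightarrow> hol S e (s \<^bold>\<le> t) \<longleftrightarrow> nm (den S e s) \<le> nm (den S e t)"
  "den S e s \<in> D T0 \<Longrightarrow> den S e t \<in> D T0 \<Longrightarrow> hol S e (s \<^bold>< t) \<longleftrightarrow> nm (den S e s) < nm (den S e t)"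
  by (auto simp: o_le_def hol_simps eqr_eq dm_T0 lsr_un)

section \<open>Powers of two\<close>

definition pow2_fn :: 'u where
  "pow2_fn = den S [] (o_cn CRec \<cdot> (o_cn (CK T1 T0) \<cdot> o_double) \<cdot> \<^bold>1)"

definition pw :: "'n \<Rightarrow> 'n" where "pw n = fn pow2_fn n"

lemma double:
  "cn S (CS T0 T0 T0) \<bullet> cn S CPlus \<bullet> (cn S (CS T0 T1 T0) \<bullet> cn S (CK T0 T1) \<bullet> cn S (CK T0 T0)) \<in> D T1" (is "?d \<in> _")
  "cn S (CS T0 T0 T0) \<bullet> cn S CPlus \<bullet> (cn S (CS T0 T1 T0) \<bullet> cn S (CK T0 T1) \<bullet> cn S (CK T0 T0)) \<bullet> un n = un (n + n)"
proof -
  let ?i = "cn S (CS T0 T1 T0) \<bullet> cn S (CK T0 T1) \<bullet> cn S (CK T0 T0)"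
  have i: "?i \<in> D T1"
    using cn_in[of "CS T0 T1 T0"] by (intro app_in[OF app_in[OF _ CK_in] CK_in]) simp
  have p: "cn S CPlus \<in> D (T0 \<Rrightarrow> T0 \<Rrightarrow> T0)" using cn_in[of CPlus] by simp
  show "?d \<in> D T1"
    using cn_in[of "CS T0 T0 T0"] by (intro app_in[OF app_in[OF _ p] i]) simp
  have "?i \<bullet> un n = cn S (CK T0 T1) \<bullet> un n \<bullet> (cn S (CK T0 T0) \<bullet> un n)" by (intro CS_app) simp_all
  also have "\<dots> = un n" by (intro CK_app app_in[OF CK_in]) simp_all
  finally have "?i \<bullet> un n = un n" .
  moreover have "?d \<bullet> un n = cn S CPlus \<bullet> un n \<bullet> (?i \<bullet> un n)" by (intro CS_app p i) simp
  ultimately show "?d \<bullet> un n = un (n + n)" by (simp add: cn_plus)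
qed

lemma pow2_fn_in: "pow2_fn \<in> D T1"
  unfolding pow2_fn_def o_double_def o_ident_def
  by (simp add: hol_simps app_in[OF app_in[OF CRec_in app_in[OF CK_in double(1)]]])

lemma den_pow2 [simp]: "den S e n \<in> D T0 \<Longrightarrow> den S e (o_pow2 n) = un (pw (nm (den S e n)))"
  using un_fn[OF pow2_fn_in, of "nm (den S e n)"]
  by (simp add: o_pow2_def pow2_fn_def pw_def hol_simps o_double_def o_ident_def un_nm)

lemma stab_pow2 [simp]: "stab S e n \<Longrightarrow> stab S e (o_pow2 n)"
  by (simp add: o_pow2_def o_double_def o_ident_def hol_simps)

lemma pw_0 [simp]: "pw 0 = 1" and pw_Suc: "pw (n + 1) = pw n + pw n"
proof -
  have d: "cn S (CK T1 T0) \<bullet> (cn S (CS T0 T0 T0) \<bullet> cn S CPlus \<bullet> (cn S (CS T0 T1 T0) \<bullet> cn S (CK T0 T1) \<bullet> cn S (CK T0 T0)))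
      \<in> D (T0 \<Rrightarrow> T0 \<Rrightarrow> T0)"
    by (rule app_in[OF CK_in double(1)])
  have p: "pow2_fn \<bullet> un n = un (pw n)" for n by (simp add: un_fn pow2_fn_in pw_def)
  have "un (pw 0) = un 1"
    using CRec_app(1)[OF d, of 1] unfolding p[symmetric] by (simp add: pow2_fn_def hol_simps o_double_def o_ident_def)
  then show "pw 0 = 1" by simp
  have "un (pw (n + 1)) = un (pw n + pw n)"
  proof -
    have "pow2_fn \<bullet> un (n + 1) = cn S (CK T1 T0) \<bullet> (cn S (CS T0 T0 T0) \<bullet> cn S CPlus \<bullet> (cn S (CS T0 T1 T0) \<bullet> cn S (CK T0 T1) \<bullet> cn S (CK T0 T0)))
        \<bullet> un n \<bullet> (pow2_fn \<bullet> un n)"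
      using CRec_app(2)[OF d, of 1 n] by (simp add: pow2_fn_def hol_simps o_double_def o_ident_def)
    then show ?thesis unfolding p by (simp add: double)
  qed
  then show "pw (n + 1) = pw n + pw n" by simp
qed

lemma dn_pw [dfn_intros]: "dn \<Gamma> F \<Longrightarrow> dn \<Gamma> (\<lambda>e. pw (F e))"
  unfolding pw_def by (intro dfn_intros pow2_fn_in)

lemma pw_gt: "n < pw n"
proof (rule internal_induct[of "\<lambda>n. n < pw n"])
  show "dset (\<lambda>n. n < pw n)" by (intro dfn_intros)
  show "n + 1 < pw (n + 1)" if "n < pw n" for n
  proof -
    have "n + 1 \<le> pw n" using that less_add_one_iff[of "n + 1" "pw n"] by simp
    also have "pw n < pw n + pw n" using that ds_nonneg[of n] ds_add_less_iff(2)[of "pw n" 0 "pw n"] by simp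
    finally show ?thesis by (simp add: pw_Suc)
  qed
qed (simp add: ds_zero_less_one)

lemma pw_pos [simp]: "0 < pw n"
  using pw_gt[of n] ds_nonneg[of n] by simp

lemma pw_add: "pw (m + i) = pw m * pw i"
proof (rule internal_induct[of "\<lambda>i. pw (m + i) = pw m * pw i"])
  show "dset (\<lambda>i. pw (m + i) = pw m * pw i)" by (intro dfn_intros)
  show "pw (m + (n + 1)) = pw m * pw (n + 1)" if "pw (m + n) = pw m * pw n" for n
    using that pw_Suc[of "m + n"] by (simp add: pw_Suc add.assoc distrib_left)
qed simp

text \<open>The number \<open>2^-n\<close> in the field; n ranges over all numbers of the model, so
  these are its dyadic bounds and not only the standard ones.\<close>

definition hh :: "'n \<Rightarrow> 'n zz fract" where "hh n = 1 / rn (pw n)"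

lemma hh_pos [simp]: "0 < hh n"
  by (simp add: hh_def)

lemma ds_le_add: "(m::'n) \<le> n \<Longrightarrow> \<exists>i. n = m + i"
  using ds_diff[of m n] by (metis add.right_neutral le_less)

lemma hh_mono: "m \<le> n \<Longrightarrow> hh n \<le> hh m"
proof -
  assume "m \<le> n"
  then obtain i where "n = m + i" using ds_le_add by blast
  moreover have "1 \<le> rn (pw i)" using rn_simps(6)[of 1 "pw i"] ds_discrete[OF pw_pos] by simp
  ultimately have "rn (pw m) \<le> rn (pw n)" by (simp add: pw_add)
  then show ?thesis by (simp add: hh_def field_simps)
qed

lemma rn_less_iff_le: "rn (b::'n) < rn a \<longleftrightarrow> rn b + 1 \<le> rn a"
  using rn_less_Suc_iff[of a b] by (metis leD linorder_not_less rn_simps(5,6))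

text \<open>The field is Archimedean relative to the numbers of the model: a positive element has a
  numerator of at least 1 by discreteness, so it is at least \<open>1 / (c + 1)\<close>, and
  \<open>pw (c + 1)\<close> exceeds \<open>c + 1\<close>.\<close>

lemma hh_small: "0 < d \<Longrightarrow> \<exists>n. hh n < d"
proof -
  assume d: "0 < d"
  obtain a b c :: 'n where abc: "d = (rn a - rn b) / (rn c + 1)" by (rule fract_rn_exhaust)
  have c: "0 < rn c + 1" by (simp add: add_nonneg_pos)
  with d abc have "rn b < rn a" by (simp add: zero_less_divide_iff not_less[symmetric])
  then have "1 \<le> rn a - rn b" using rn_less_iff_le[of b a] by simp
  then have "1 / (rn c + 1) \<le> d" unfolding abc using c by (simp add: divide_right_mono)
  moreover have "rn c + 1 < rn (pw (c + 1))" using rn_simps(5)[of "c + 1" "pw (c + 1)"] pw_gt by simp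
  then have "hh (c + 1) < 1 / (rn c + 1)" unfolding hh_def using c by (intro divide_strict_left_mono) auto
  ultimately show ?thesis by (meson less_le_trans)
qed

text \<open>Stability is included because a triple introduced by one \<open>decode\<close> is used
  again under the quantifiers of the next ones.\<close>

definition tok :: "'u list \<Rightarrow> rexp \<Rightarrow> bool" where
  "tok e t = (case t of (P, M, N) \<Rightarrow> stab S e P \<and> stab S e M \<and> stab S e N \<and>
     den S e P \<in> D T0 \<and> den S e M \<in> D T0 \<and> den S e N \<in> D T0 \<and> 0 < nm (den S e N))"

definition tval :: "'u list \<Rightarrow> rexp \<Rightarrow> 'n zz fract" where
  "tval e t = (case t of (P, M, N) \<Rightarrow> (rn (nm (den S e P)) - rn (nm (den S e M))) / rn (nm (den S e N)))"

lemma tok_append: "tok e t \<Longrightarrow> tok (vs @ e) t" "tok e t \<Longrightarrow> tval (vs @ e) t = tval e t"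
proof -
  have "stab S (vs @ e) x \<and> den S (vs @ e) x = den S e x" if "stab S e x" for x
    using that unfolding stab_def by (metis append.assoc)
  then show "tok e t \<Longrightarrow> tok (vs @ e) t" "tok e t \<Longrightarrow> tval (vs @ e) t = tval e t"
    by (auto simp: tok_def tval_def split: prod.splits)
qed

lemma ds_mult_pos: "0 < a \<Longrightarrow> 0 < b \<Longrightarrow> 0 < a * (b::'n)"
  using ds_mult_less[of b 0 a] by simp

lemma tok_ops [simp]:
  "tok e s \<Longrightarrow> tok e t \<Longrightarrow> tok e (radd s t)" "tok e t \<Longrightarrow> tok e (rneg t)"
  "tok e s \<Longrightarrow> tok e t \<Longrightarrow> tok e (rsub s t)"
  by (auto simp: tok_def rsub_def ds_mult_pos split: prod.splits)

lemma tval_ops [simp]: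
  "tok e s \<Longrightarrow> tok e t \<Longrightarrow> tval e (radd s t) = tval e s + tval e t"
  "tval e (rneg t) = - tval e t"
  "tok e s \<Longrightarrow> tok e t \<Longrightarrow> tval e (rsub s t) = tval e s - tval e t"
proof -
  show *: "tval e (radd s t) = tval e s + tval e t" if "tok e s" "tok e t" for s t
  proof -
    obtain P M N where s: "s = (P, M, N)" by (cases s) auto
    obtain P' M' N' where t: "t = (P', M', N')" by (cases t) auto
    have "rn (nm (den S e N)) \<noteq> 0" "rn (nm (den S e N')) \<noteq> 0" using that by (auto simp: tok_def s t)
    then show ?thesis using that by (simp add: tok_def tval_def s t field_simps)
  qed
  show **: "tval e (rneg t) = - tval e t" for t
    by (auto simp: tval_def minus_divide_left split: prod.splits)
  show "tok e s \<Longrightarrow> tok e t \<Longrightarrow> tval e (rsub s t) = tval e s - tval e t"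
    by (simp add: rsub_def * **)
qed

lemma hol_rless: "tok e s \<Longrightarrow> tok e t \<Longrightarrow> hol S e (rless s t) \<longleftrightarrow> tval e s < tval e t"
proof -
  assume *: "tok e s" "tok e t"
  obtain P M N where s: "s = (P, M, N)" by (cases s) auto
  obtain P' M' N' where t: "t = (P', M', N')" by (cases t) auto
  let ?r = "\<lambda>x. rn (nm (den S e x))"
  have "0 < ?r N" "0 < ?r N'" using * by (auto simp: tok_def s t)
  then have "tval e s < tval e t \<longleftrightarrow> (?r P - ?r M) * ?r N' < (?r P' - ?r M') * ?r N"
    by (simp add: tval_def s t divide_less_eq less_divide_eq)
  also have "\<dots> \<longleftrightarrow> ?r P * ?r N' + ?r M' * ?r N < ?r P' * ?r N + ?r M * ?r N'"
    by (auto simp: algebra_simps)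
  also have "\<dots> \<longleftrightarrow> nm (den S e P) * nm (den S e N') + nm (den S e M') * nm (den S e N)
      < nm (den S e P') * nm (den S e N) + nm (den S e M) * nm (den S e N')"
    by (simp only: rn_simps(3,4)[symmetric] rn_simps(5))
  finally show ?thesis using * by (simp add: tok_def s t hol_connectives lsr_un)
qed

lemma hol_rat_order [simp]:
  "tok e s \<Longrightarrow> tok e t \<Longrightarrow> hol S e (rless s t) \<longleftrightarrow> tval e s < tval e t"
  "tok e s \<Longrightarrow> tok e t \<Longrightarrow> hol S e (rle s t) \<longleftrightarrow> tval e s \<le> tval e t"
  "tok e s \<Longrightarrow> tok e t \<Longrightarrow> hol S e (rabs_less s t) \<longleftrightarrow> \<bar>tval e s\<bar> < tval e t"
  "tok e s \<Longrightarrow> tok e t \<Longrightarrow> hol S e (rabs_le s t) \<longleftrightarrow> \<bar>tval e s\<bar> \<le> tval e t"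
  by (auto simp: hol_rless rle_def rabs_less_def rabs_le_def hol_connectives not_less abs_less_iff abs_le_iff)

lemma tok_dyad [simp]:
  "stab S e c \<Longrightarrow> den S e c \<in> D T0 \<Longrightarrow> stab S e n \<Longrightarrow> den S e n \<in> D T0 \<Longrightarrow> tok e (dyad c n)"
  by (simp add: tok_def dyad_def)

lemma tval_dyad [simp]:
  "den S e n \<in> D T0 \<Longrightarrow> tval e (dyad c n) = rn (nm (den S e c)) * hh (nm (den S e n))"
  by (simp add: tval_def dyad_def hh_def)

section \<open>Codes of rational numbers\<close>

definition pair :: "'n \<Rightarrow> 'n \<Rightarrow> 'n" where "pair m n = (m + n) * (m + n) + m"
definition code :: "'n \<Rightarrow> 'n \<Rightarrow> 'n \<Rightarrow> 'n" where "code a b c = pair (pair a b) c"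

text \<open>With s = m + n the code lies between the square of s and the square of s + 1, the latter
  excluded. So equal codes have equal sums, and then m is the remaining summand.\<close>

lemma pair_inject: "pair m n = pair m' n' \<longleftrightarrow> m = m' \<and> n = n'"
proof
  have *: "\<not> m + n < m' + n'" if "pair m n = pair m' n'" for m n m' n'
  proof
    assume "m + n < m' + n'"
    then have "rn (m + n) + 1 \<le> rn (m' + n')" unfolding rn_simps(5)[symmetric] rn_less_iff_le .
    then have s: "rn m + rn n + 1 \<le> rn m' + rn n'" by simp
    have "0 \<le> rn m" "0 \<le> rn n" "0 \<le> rn m'" "0 \<le> rn n'" by simp_all
    then have "(rn m + rn n + 1) * (rn m + rn n + 1) \<le> (rn m' + rn n') * (rn m' + rn n')"
      using s by (intro mult_mono) auto
    moreover have "rn (pair m n) = rn (pair m' n')" using that by simp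
    then have "(rn m + rn n) * (rn m + rn n) + rn m = (rn m' + rn n') * (rn m' + rn n') + rn m'"
      by (simp add: pair_def)
    ultimately show False using \<open>0 \<le> rn m\<close> \<open>0 \<le> rn n\<close> \<open>0 \<le> rn m'\<close> by (simp add: algebra_simps)
  qed
  assume a: "pair m n = pair m' n'"
  then have "m + n = m' + n'" using * by (metis linorder_neqE)
  with a show "m = m' \<and> n = n'" by (auto simp: pair_def)
qed auto

lemma code_inject: "code a b c = code a' b' c' \<longleftrightarrow> a = a' \<and> b = b' \<and> c = c'"
  by (auto simp: code_def pair_inject)

definition isc :: "'n \<Rightarrow> bool" where "isc k \<longleftrightarrow> (\<exists>a b c. k = code a b c)"
text \<open>The default 0 on non-codes keeps \<open>rt\<close> total and fits the search for its
  components in \<open>dq_rt\<close>, where both parts of the numerator then come out as 0.\<close>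

definition rt :: "'n \<Rightarrow> 'n zz fract" where
  "rt k = (if isc k then THE r. \<exists>a b c. k = code a b c \<and> r = (rn a - rn b) / (rn c + 1) else 0)"

lemma isc_code [simp]: "isc (code a b c)"
  by (auto simp: isc_def)

lemma rt_code [simp]: "rt (code a b c) = (rn a - rn b) / (rn c + 1)"
proof -
  have "(THE r. \<exists>a' b' c'. code a b c = code a' b' c' \<and> r = (rn a' - rn b') / (rn c' + 1)) = (rn a - rn b) / (rn c + 1)"
    by (rule the_equality) (auto simp: code_inject)
  then show ?thesis by (simp add: rt_def)
qed

lemma ex_code: "\<exists>k. isc k \<and> rt k = q"
  using fract_rn_exhaust[of q] by (metis isc_code rt_code)

lemma den_code [simp]:
  "den S e a \<in> D T0 \<Longrightarrow> den S e b \<in> D T0 \<Longrightarrow> den S e c \<in> D T0 \<Longrightarrow>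
   den S e (rat_code a b c) = un (code (nm (den S e a)) (nm (den S e b)) (nm (den S e c)))"
  by (simp add: rat_code_def o_pair_def code_def pair_def)

lemma stab_code [simp]: "stab S e a \<Longrightarrow> stab S e b \<Longrightarrow> stab S e c \<Longrightarrow> stab S e (rat_code a b c)"
  by (simp add: rat_code_def o_pair_def)

lemma hol_is_rat [simp]: "stab S e q \<Longrightarrow> den S e q \<in> D T0 \<Longrightarrow> hol S e (is_rat q) \<longleftrightarrow> isc (nm (den S e q))"
proof -
  assume q: "stab S e q" "den S e q \<in> D T0"
  then obtain k where "den S e q = un k" using dm_T0 by auto
  then show ?thesis using q(1)
    by (simp add: is_rat_def hol_ex hol_connectives bex_T0 eqr_eq hol_simps isc_def
      den_simps(3)[of S _ "_ # _", simplified] den_simps(3)[of S _ "_ # _ # _", simplified])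
qed

text \<open>A code determines its triple, so the existential quantifiers of \<open>decode\<close>
  can only produce the rational \<open>rt k\<close>. The hypothesis on \<phi> is made in the
  environment extended by the three components, where the triple lives.\<close>

lemma hol_decode:
  assumes q: "stab S e q" "den S e q = un k"
    and \<phi>: "\<And>a b c t. tok ([a, b, c] @ e) t \<Longrightarrow> hol S ([a, b, c] @ e) (\<phi> t) \<longleftrightarrow> \<Phi> (tval ([a, b, c] @ e) t)"
  shows "hol S e (decode q \<phi>) \<longleftrightarrow> isc k \<and> \<Phi> (rt k)"
proof -
  let ?t = "(var (length e), var (Suc (length e)), var (Suc (Suc (length e))) \<^bold>+ \<^bold>1)"
  have "0 < c + (1::'n)" for c using ds_zero_less_one ds_nonneg[of c] by (metis add.left_neutral ds_add_le_iff(1) less_le_trans)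
  then have t: "tok ([un c, un b, un a] @ e) ?t" "tval ([un c, un b, un a] @ e) ?t = (rn a - rn b) / (rn c + 1)" for a b c
    by (simp_all add: tok_def tval_def hol_simps den_simps(3)[of S _ "_ # _", simplified] den_simps(3)[of S _ "_ # _ # _", simplified])
  have "hol S e (decode q \<phi>) \<longleftrightarrow> (\<exists>a b c. k = code a b c \<and> hol S ([un c, un b, un a] @ e) (\<phi> ?t))"
    by (simp add: decode_def hol_ex hol_connectives bex_T0 eqr_eq hol_simps q
      den_simps(3)[of S _ "_ # _", simplified] den_simps(3)[of S _ "_ # _ # _", simplified])
  also have "\<dots> \<longleftrightarrow> (\<exists>a b c. k = code a b c \<and> \<Phi> ((rn a - rn b) / (rn c + 1)))"
    using \<phi>[OF t(1)] unfolding t(2) by simp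
  also have "\<dots> \<longleftrightarrow> isc k \<and> \<Phi> (rt k)" by (auto simp: isc_def code_inject)
  finally show ?thesis .
qed

lemma stab_append: "stab S e x \<Longrightarrow> stab S (vs @ e) x"
  unfolding stab_def by (metis append.assoc)

lemma den_append: "stab S e x \<Longrightarrow> den S (vs @ e) x = den S e x"
  unfolding stab_def by blast

lemma hol_decode2:
  assumes q: "stab S e q1" "den S e q1 = un k1" "stab S e q2" "den S e q2 = un k2"
    and \<phi>: "\<And>vs s t. tok (vs @ e) s \<Longrightarrow> tok (vs @ e) t \<Longrightarrow>
      hol S (vs @ e) (\<phi> s t) \<longleftrightarrow> \<Phi> (tval (vs @ e) s) (tval (vs @ e) t)"
  shows "hol S e (decode q1 (\<lambda>s. decode q2 (\<phi> s))) \<longleftrightarrow> isc k1 \<and> isc k2 \<and> \<Phi> (rt k1) (rt k2)"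
proof (rule hol_decode[OF q(1,2), where \<Phi> = "\<lambda>r. isc k2 \<and> \<Phi> r (rt k2)"])
  fix a b c s assume s: "tok ([a, b, c] @ e) s"
  show "hol S ([a, b, c] @ e) (decode q2 (\<phi> s)) \<longleftrightarrow> isc k2 \<and> \<Phi> (tval ([a, b, c] @ e) s) (rt k2)"
  proof (rule hol_decode)
    fix a' b' c' t assume t: "tok ([a', b', c'] @ [a, b, c] @ e) t"
    show "hol S ([a', b', c'] @ [a, b, c] @ e) (\<phi> s t) \<longleftrightarrow> \<Phi> (tval ([a, b, c] @ e) s) (tval ([a', b', c'] @ [a, b, c] @ e) t)"
      using \<phi>[of "[a', b', c'] @ [a, b, c]" s t] t tok_append[OF s, of "[a', b', c']"] by simp
  qed (use q(3,4) stab_append[OF q(3), of "[a, b, c]"] den_append[OF q(3), of "[a, b, c]"] in auto)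
qed

lemma hol_decode3:
  assumes q: "stab S e q1" "den S e q1 = un k1" "stab S e q2" "den S e q2 = un k2" "stab S e q3" "den S e q3 = un k3"
    and \<phi>: "\<And>vs s t u. tok (vs @ e) s \<Longrightarrow> tok (vs @ e) t \<Longrightarrow> tok (vs @ e) u \<Longrightarrow>
      hol S (vs @ e) (\<phi> s t u) \<longleftrightarrow> \<Phi> (tval (vs @ e) s) (tval (vs @ e) t) (tval (vs @ e) u)"
  shows "hol S e (decode q1 (\<lambda>s. decode q2 (\<lambda>t. decode q3 (\<phi> s t)))) \<longleftrightarrow>
    isc k1 \<and> isc k2 \<and> isc k3 \<and> \<Phi> (rt k1) (rt k2) (rt k3)"
proof (rule hol_decode[OF q(1,2), where \<Phi> = "\<lambda>r. isc k2 \<and> isc k3 \<and> \<Phi> r (rt k2) (rt k3)"])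
  fix a b c s assume s: "tok ([a, b, c] @ e) s"
  show "hol S ([a, b, c] @ e) (decode q2 (\<lambda>t. decode q3 (\<phi> s t))) \<longleftrightarrow>
    isc k2 \<and> isc k3 \<and> \<Phi> (tval ([a, b, c] @ e) s) (rt k2) (rt k3)"
  proof (rule hol_decode2)
    fix vs t u assume t: "tok (vs @ [a, b, c] @ e) t" "tok (vs @ [a, b, c] @ e) u"
    show "hol S (vs @ [a, b, c] @ e) (\<phi> s t u) \<longleftrightarrow>
        \<Phi> (tval ([a, b, c] @ e) s) (tval (vs @ [a, b, c] @ e) t) (tval (vs @ [a, b, c] @ e) u)"
      using \<phi>[of "vs @ [a, b, c]" s t u] t tok_append[OF s, of vs] by simp
  qed (use q stab_append[of e _ "[a, b, c]"] den_append[of e _ "[a, b, c]"] in auto)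
qed

end

lemma rn_numeral [simp]: "rn (numeral k :: 'a::discrete_semiring) = numeral k"
  by (induction k) (simp_all only: numeral.simps rn_simps)

context model
begin

section \<open>Real numbers in a model\<close>

definition sq :: "'u \<Rightarrow> 'n \<Rightarrow> 'n zz fract" where "sq x n = rt (fn x n)"

definition RR :: "'u set" where
  "RR = {x \<in> D T1. (\<forall>n. isc (fn x n)) \<and> (\<forall>n i. \<bar>sq x n - sq x (n + i)\<bar> < hh n)}"
definition eqR :: "'u \<Rightarrow> 'u \<Rightarrow> bool" where
  "eqR x y \<longleftrightarrow> (\<forall>n. isc (fn x n) \<and> isc (fn y n) \<and> \<bar>sq x n - sq y n\<bar> \<le> 2 * hh n)"
definition ltR :: "'u \<Rightarrow> 'u \<Rightarrow> bool" where
  "ltR x y \<longleftrightarrow> (\<exists>n. isc (fn x n) \<and> isc (fn y n) \<and> sq x n + 2 * hh n < sq y n)"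
definition dlR :: "'u \<Rightarrow> 'u \<Rightarrow> 'u \<Rightarrow> bool" where
  "dlR x y z \<longleftrightarrow> (\<exists>n. isc (fn x n) \<and> isc (fn y n) \<and> isc (fn z n) \<and> \<bar>sq x n - sq y n\<bar> < sq z n - 3 * hh n)"
definition smR :: "'u \<Rightarrow> 'u \<Rightarrow> 'u \<Rightarrow> bool" where
  "smR x y z \<longleftrightarrow> (\<forall>n. isc (fn x n) \<and> isc (fn y n) \<and> isc (fn z n) \<and> \<bar>sq x n + sq y n - sq z n\<bar> \<le> 3 * hh n)"
definition kst :: "'n \<Rightarrow> 'u" where "kst k = cn S (CK T0 T0) \<bullet> un k"

lemma den_var_last: "den S (v # e) (var (length e)) = v"
  "den S (w # v # e) (var (length e)) = v" "den S (w # v # e) (var (Suc (length e))) = w"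
  using den_simps(3)[of S w "v # e"] by (simp_all add: hol_simps)

lemma hol_Real [simp]: "stab S e x \<Longrightarrow> den S e x \<in> D T1 \<Longrightarrow> hol S e (Real x) \<longleftrightarrow> den S e x \<in> RR"
proof -
  assume x: "stab S e x" "den S e x \<in> D T1"
  let ?x = "den S e x"
  have "hol S (un i # un n # e) (decode (x \<cdot> var (length e)) (\<lambda>p. decode (x \<cdot> (var (length e) \<^bold>+ var (Suc (length e))))
        (\<lambda>q. rabs_less (rsub p q) (dyad \<^bold>1 (var (length e)))))) \<longleftrightarrow>
      isc (fn ?x n) \<and> isc (fn ?x (n + i)) \<and> \<bar>rt (fn ?x n) - rt (fn ?x (n + i))\<bar> < hh n" for n i
    by (rule hol_decode2) (simp_all add: x hol_simps den_var_last un_fn stab_append den_append)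
  then have "hol S e (Real x) \<longleftrightarrow> (\<forall>n i. isc (fn ?x n) \<and> isc (fn ?x (n + i)) \<and> \<bar>sq ?x n - sq ?x (n + i)\<bar> < hh n)"
    by (simp add: Real_def hol_all ball_T0 sq_def)
  then show ?thesis using x(2) by (auto simp: RR_def)
qed

lemma hol_real_eq [simp]:
  assumes x: "stab S e x" "den S e x \<in> D T1" "stab S e y" "den S e y \<in> D T1"
  shows "hol S e (x \<^bold>=\<^sub>R y) \<longleftrightarrow> eqR (den S e x) (den S e y)"
proof -
  have "hol S (un n # e) (decode (x \<cdot> var (length e)) (\<lambda>p. decode (y \<cdot> var (length e))
        (\<lambda>q. rabs_le (rsub p q) (dyad (\<^bold>1 \<^bold>+ \<^bold>1) (var (length e)))))) \<longleftrightarrow>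
      isc (fn (den S e x) n) \<and> isc (fn (den S e y) n) \<and> \<bar>rt (fn (den S e x) n) - rt (fn (den S e y) n)\<bar> \<le> 2 * hh n" for n
    by (rule hol_decode2) (simp_all add: x hol_simps den_var_last un_fn stab_append den_append)
  then show ?thesis by (simp add: real_eq_def hol_all ball_T0 sq_def eqR_def)
qed

lemma hol_real_less [simp]:
  assumes x: "stab S e x" "den S e x \<in> D T1" "stab S e y" "den S e y \<in> D T1"
  shows "hol S e (x \<^bold><\<^sub>R y) \<longleftrightarrow> ltR (den S e x) (den S e y)"
proof -
  have "hol S (un n # e) (decode (x \<cdot> var (length e)) (\<lambda>p. decode (y \<cdot> var (length e))
        (\<lambda>q. rless (radd p (dyad (\<^bold>1 \<^bold>+ \<^bold>1) (var (length e)))) q))) \<longleftrightarrow>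
      isc (fn (den S e x) n) \<and> isc (fn (den S e y) n) \<and> rt (fn (den S e x) n) + 2 * hh n < rt (fn (den S e y) n)" for n
    by (rule hol_decode2) (simp_all add: x hol_simps den_var_last un_fn stab_append den_append)
  then show ?thesis by (simp add: real_less_def hol_ex bex_T0 sq_def ltR_def)
qed

lemma hol_real_le [simp]:
  assumes "stab S e x" "den S e x \<in> D T1" "stab S e y" "den S e y \<in> D T1"
  shows "hol S e (x \<^bold>\<le>\<^sub>R y) \<longleftrightarrow> \<not> ltR (den S e y) (den S e x)"
  using assms by (simp add: real_le_def hol_connectives)

lemma hol_dist_less [simp]:
  assumes x: "stab S e x" "den S e x \<in> D T1" "stab S e y" "den S e y \<in> D T1" "stab S e z" "den S e z \<in> D T1"
  shows "hol S e (dist_less x y z) \<longleftrightarrow> dlR (den S e x) (den S e y) (den S e z)"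
proof -
  have "hol S (un n # e) (decode (x \<cdot> var (length e)) (\<lambda>p. decode (y \<cdot> var (length e)) (\<lambda>q. decode (z \<cdot> var (length e))
        (\<lambda>r. rabs_less (rsub p q) (rsub r (dyad (\<^bold>1 \<^bold>+ \<^bold>1 \<^bold>+ \<^bold>1) (var (length e)))))))) \<longleftrightarrow>
      isc (fn (den S e x) n) \<and> isc (fn (den S e y) n) \<and> isc (fn (den S e z) n) \<and>
      \<bar>rt (fn (den S e x) n) - rt (fn (den S e y) n)\<bar> < rt (fn (den S e z) n) - 3 * hh n" for n
    by (rule hol_decode3) (simp_all add: x hol_simps den_var_last un_fn stab_append den_append)
  then show ?thesis by (simp add: dist_less_def hol_ex bex_T0 sq_def dlR_def)
qed

lemma hol_is_sum [simp]:
  assumes x: "stab S e x" "den S e x \<in> D T1" "stab S e y" "den S e y \<in> D T1" "stab S e z" "den S e z \<in> D T1"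
  shows "hol S e (is_sum x y z) \<longleftrightarrow> smR (den S e x) (den S e y) (den S e z)"
proof -
  have "hol S (un n # e) (decode (x \<cdot> var (length e)) (\<lambda>p. decode (y \<cdot> var (length e)) (\<lambda>q. decode (z \<cdot> var (length e))
        (\<lambda>r. rabs_le (rsub (radd p q) r) (dyad (\<^bold>1 \<^bold>+ \<^bold>1 \<^bold>+ \<^bold>1) (var (length e))))))) \<longleftrightarrow>
      isc (fn (den S e x) n) \<and> isc (fn (den S e y) n) \<and> isc (fn (den S e z) n) \<and>
      \<bar>rt (fn (den S e x) n) + rt (fn (den S e y) n) - rt (fn (den S e z) n)\<bar> \<le> 3 * hh n" for n
    by (rule hol_decode3) (simp_all add: x hol_simps den_var_last un_fn stab_append den_append)
  then show ?thesis by (simp add: is_sum_def hol_all ball_T0 sq_def smR_def)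
qed

lemma den_of_rat [simp]: "den S e q \<in> D T0 \<Longrightarrow> den S e (Defs.of_rat q) = kst (nm (den S e q))"
  by (simp add: Defs.of_rat_def hol_simps kst_def un_nm)

lemma stab_of_rat [simp]: "stab S e q \<Longrightarrow> stab S e (Defs.of_rat q)"
  by (simp add: Defs.of_rat_def hol_simps)

lemma kst_in [simp]: "kst k \<in> D T1"
  unfolding kst_def by (rule app_in[OF CK_in]) simp

lemma fn_kst [simp]: "fn (kst k) n = k"
  by (simp add: fn_def kst_def)

lemma sq_kst [simp]: "sq (kst k) n = rt k"
  by (simp add: sq_def)

lemma kst_RR [simp]: "kst k \<in> RR \<longleftrightarrow> isc k"
  by (auto simp: RR_def)

definition zeroR :: 'u where "zeroR = kst (code 0 0 0)"
definition oneR :: 'u where "oneR = kst (code 1 0 0)"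

lemma den_real01 [simp]:
  "den S e \<^bold>0\<^sub>R = zeroR" "den S e \<^bold>1\<^sub>R = oneR" "stab S e \<^bold>0\<^sub>R" "stab S e \<^bold>1\<^sub>R"
  by (simp_all add: real0_def real1_def zeroR_def oneR_def)

lemma real01_in [simp]: "zeroR \<in> D T1" "oneR \<in> D T1" "zeroR \<in> RR" "oneR \<in> RR"
  "sq zeroR n = 0" "sq oneR n = 1"
  by (simp_all add: zeroR_def oneR_def)

lemma RR_D [dest]: "x \<in> RR \<Longrightarrow> x \<in> D T1"
  by (simp add: RR_def)

lemma RR_isc [simp]: "x \<in> RR \<Longrightarrow> isc (fn x n)"
  by (simp add: RR_def)

lemma RR_cauchy: "x \<in> RR \<Longrightarrow> m \<le> n \<Longrightarrow> \<bar>sq x m - sq x n\<bar> < hh m"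
  using ds_le_add[of m n] unfolding RR_def by blast

definition IV :: "'u \<Rightarrow> 'u \<Rightarrow> 'u set" where "IV a b = {x \<in> RR. \<not> ltR x a \<and> \<not> ltR b x}"
abbreviation UI :: "'u set" where "UI \<equiv> IV zeroR oneR"

lemma hol_interval [simp]:
  assumes "stab S e x" "den S e x \<in> D T1" "stab S e a" "den S e a \<in> D T1" "stab S e b" "den S e b \<in> D T1"
  shows "hol S e (interval a b x) \<longleftrightarrow> den S e x \<in> IV (den S e a) (den S e b)"
  using assms by (auto simp: interval_def IV_def hol_connectives)

lemma hol_PosReal [simp]:
  assumes "stab S e x" "den S e x \<in> D T1"
  shows "hol S e (PosReal x) \<longleftrightarrow> den S e x \<in> RR \<and> ltR zeroR (den S e x)"
  using assms by (auto simp: PosReal_def hol_connectives)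

text \<open>On reals, \<open>lt\<close> is the strict order and \<open>dl x y r\<close> says that \<open>x\<close> and \<open>y\<close> have distance less than
  the rational \<open>r\<close>; unlike \<open>ltR\<close> and \<open>dlR\<close> they combine by linear arithmetic at large indices.\<close>

definition ev :: "('n \<Rightarrow> bool) \<Rightarrow> bool" where "ev P \<longleftrightarrow> (\<exists>m. \<forall>n\<ge>m. P n)"
definition lt :: "'u \<Rightarrow> 'u \<Rightarrow> bool" where
  "lt x y \<longleftrightarrow> (\<exists>d>0. ev (\<lambda>n. sq x n + d < sq y n))"
definition dl :: "'u \<Rightarrow> 'u \<Rightarrow> 'n zz fract \<Rightarrow> bool" where
  "dl x y r \<longleftrightarrow> (\<exists>d>0. ev (\<lambda>n. \<bar>sq x n - sq y n\<bar> + d < r))"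

lemma ev_conj: "ev P \<Longrightarrow> ev Q \<Longrightarrow> ev (\<lambda>n. P n \<and> Q n)"
  unfolding ev_def by (metis max.bounded_iff)

lemma ev_mp: "ev P \<Longrightarrow> (\<And>n. P n \<Longrightarrow> Q n) \<Longrightarrow> ev Q"
  unfolding ev_def by blast

lemma ev_mp2: "ev P \<Longrightarrow> ev Q \<Longrightarrow> (\<And>n. P n \<Longrightarrow> Q n \<Longrightarrow> R n) \<Longrightarrow> ev R"
  using ev_mp[OF ev_conj] by blast

lemma ev_ex: "ev P \<Longrightarrow> \<exists>n. P n"
  unfolding ev_def by blast

lemma ev_hh: "0 < d \<Longrightarrow> ev (\<lambda>n. hh n < d)"
  using hh_small[of d] hh_mono unfolding ev_def by (meson le_less_trans)

lemma ev_cauchy: "x \<in> RR \<Longrightarrow> ev (\<lambda>n. \<bar>sq x m - sq x n\<bar> < hh m)"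
  using RR_cauchy unfolding ev_def by blast

text \<open>A gap larger than \<open>2 * hh n\<close> at one index n survives, because either
  sequence moves by less than \<open>hh n\<close> afterwards. Conversely a fixed gap d eventually
  exceeds \<open>2 * hh n\<close>.\<close>

lemma ltR_iff: "x \<in> RR \<Longrightarrow> y \<in> RR \<Longrightarrow> ltR x y \<longleftrightarrow> lt x y"
proof
  assume xy: "x \<in> RR" "y \<in> RR"
  show "lt x y" if l: "ltR x y"
  proof -
    obtain n where n: "sq x n + 2 * hh n < sq y n" using l by (auto simp: ltR_def)
    have "ev (\<lambda>k. sq x k + (sq y n - sq x n - 2 * hh n) < sq y k)"
      by (rule ev_mp2[OF ev_cauchy[OF xy(1), of n] ev_cauchy[OF xy(2), of n]]) linarith
    then show ?thesis unfolding lt_def using n by (intro exI[of _ "sq y n - sq x n - 2 * hh n"]) auto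
  qed
  show "ltR x y" if l: "lt x y"
  proof -
    obtain d where d: "0 < d" "ev (\<lambda>n. sq x n + d < sq y n)" using l by (auto simp: lt_def)
    have "ev (\<lambda>n. sq x n + 2 * hh n < sq y n)"
      by (rule ev_mp2[OF d(2) ev_hh[of "d / 2"]]) (use d(1) in \<open>auto simp: field_simps\<close>)
    then show ?thesis using ev_ex xy by (fastforce simp: ltR_def)
  qed
qed

lemma eqR_iff: "x \<in> RR \<Longrightarrow> y \<in> RR \<Longrightarrow> eqR x y \<longleftrightarrow> \<not> lt x y \<and> \<not> lt y x"
proof -
  assume xy: "x \<in> RR" "y \<in> RR"
  have "eqR x y \<longleftrightarrow> \<not> ltR x y \<and> \<not> ltR y x"
    using xy unfolding eqR_def ltR_def abs_le_iff not_ex by (auto simp: not_less algebra_simps; smt (verit))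
  then show ?thesis using xy by (simp add: ltR_iff)
qed

lemma dlR_iff:
  assumes "x \<in> RR" "y \<in> RR" "z \<in> RR"
  shows "dlR x y z \<longleftrightarrow> (\<exists>d>0. ev (\<lambda>n. \<bar>sq x n - sq y n\<bar> + d < sq z n))"
proof
  assume "dlR x y z"
  then obtain n where n: "\<bar>sq x n - sq y n\<bar> < sq z n - 3 * hh n" by (auto simp: dlR_def)
  have "ev (\<lambda>k. \<bar>sq x k - sq y k\<bar> + (sq z n - 3 * hh n - \<bar>sq x n - sq y n\<bar>) < sq z k)"
    by (rule ev_mp2[OF ev_cauchy[OF assms(1), of n] ev_conj[OF ev_cauchy[OF assms(2), of n] ev_cauchy[OF assms(3), of n]]])
      linarith
  then show "\<exists>d>0. ev (\<lambda>n. \<bar>sq x n - sq y n\<bar> + d < sq z n)"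
    using n by (intro exI[of _ "sq z n - 3 * hh n - \<bar>sq x n - sq y n\<bar>"]) auto
next
  assume "\<exists>d>0. ev (\<lambda>n. \<bar>sq x n - sq y n\<bar> + d < sq z n)"
  then obtain d where d: "0 < d" "ev (\<lambda>n. \<bar>sq x n - sq y n\<bar> + d < sq z n)" by auto
  have "ev (\<lambda>n. \<bar>sq x n - sq y n\<bar> < sq z n - 3 * hh n)"
    by (rule ev_mp2[OF d(2) ev_hh[of "d / 3"]]) (use d(1) in \<open>auto simp: field_simps\<close>)
  then show "dlR x y z" using ev_ex assms by (fastforce simp: dlR_def)
qed

lemma dlR_kst: "x \<in> RR \<Longrightarrow> y \<in> RR \<Longrightarrow> isc k \<Longrightarrow> dlR x y (kst k) \<longleftrightarrow> dl x y (rt k)"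
  by (simp add: dlR_iff dl_def)

lemma PosReal_lower:
  assumes "z \<in> RR" "ltR zeroR z"
  obtains r where "0 < r" "\<And>x y. x \<in> RR \<Longrightarrow> y \<in> RR \<Longrightarrow> dl x y r \<Longrightarrow> dlR x y z"
proof -
  obtain r where r: "0 < r" "ev (\<lambda>n. r < sq z n)" using assms by (auto simp: ltR_iff lt_def)
  have "dlR x y z" if "x \<in> RR" "y \<in> RR" "dl x y r" for x y
  proof -
    obtain d where d: "0 < d" "ev (\<lambda>n. \<bar>sq x n - sq y n\<bar> + d < r)" using \<open>dl x y r\<close> by (auto simp: dl_def)
    have "ev (\<lambda>n. \<bar>sq x n - sq y n\<bar> + d < sq z n)" by (rule ev_mp2[OF d(2) r(2)]) simp
    with d(1) show ?thesis using that assms by (auto simp: dlR_iff)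
  qed
  with r(1) that show thesis by blast
qed

lemma ex_kst:
  fixes r :: "'n zz fract"
  obtains k where "isc k" "rt k = r"
  using ex_code by blast

lemma kst_pos: "isc k \<Longrightarrow> ltR zeroR (kst k) \<longleftrightarrow> 0 < rt k"
  by (auto simp: ltR_iff lt_def ev_def intro: exI[of _ "rt k / 2"])

lemma dl_sym: "dl x y r \<longleftrightarrow> dl y x r"
  by (simp add: dl_def abs_minus_commute)

lemma dl_mono: "dl x y r \<Longrightarrow> r \<le> s \<Longrightarrow> dl x y s"
  unfolding dl_def by (elim exE conjE, rule exI, rule conjI, assumption, erule ev_mp) linarith

lemma dl_trans: "dl x y r \<Longrightarrow> dl y z s \<Longrightarrow> dl x z (r + s)"
proof -
  assume "dl x y r" "dl y z s"
  then obtain d d' where d: "0 < d" "ev (\<lambda>n. \<bar>sq x n - sq y n\<bar> + d < r)" "0 < d'" "ev (\<lambda>n. \<bar>sq y n - sq z n\<bar> + d' < s)"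
    by (auto simp: dl_def)
  have "ev (\<lambda>n. \<bar>sq x n - sq z n\<bar> + d < r + s)" by (rule ev_mp2[OF d(2) d(4)]) (use d in linarith)
  with d(1) show ?thesis by (auto simp: dl_def)
qed

lemma dl_refl: "0 < r \<Longrightarrow> dl x x r"
  by (auto simp: dl_def ev_def intro: exI[of _ "r / 2"])

lemma eqR_dl: "x \<in> RR \<Longrightarrow> y \<in> RR \<Longrightarrow> eqR x y \<Longrightarrow> 0 < r \<Longrightarrow> dl x y r"
proof -
  assume *: "x \<in> RR" "y \<in> RR" "eqR x y" "0 < r"
  have "ev (\<lambda>n. \<bar>sq x n - sq y n\<bar> + r / 2 < r)"
  proof (rule ev_mp[OF ev_hh[of "r / 4"]])
    fix n assume "hh n < r / 4"
    moreover have "\<bar>sq x n - sq y n\<bar> \<le> 2 * hh n" using *(3) by (simp add: eqR_def)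
    moreover have "r / 2 = r / 4 + r / 4" "r = r / 2 + r / 2" by simp_all
    ultimately show "\<bar>sq x n - sq y n\<bar> + r / 2 < r" by linarith
  qed (use * in simp)
  then show ?thesis using * by (auto simp: dl_def intro!: exI[of _ "r / 2"])
qed

lemma not_eqR: "x \<in> RR \<Longrightarrow> y \<in> RR \<Longrightarrow> \<not> eqR x y \<longleftrightarrow> lt x y \<or> lt y x"
  by (auto simp: eqR_iff)

lemma lt_not_dl: "lt x y \<Longrightarrow> \<exists>r>0. \<not> dl x y r"
proof -
  assume "lt x y"
  then obtain d where d: "0 < d" "ev (\<lambda>n. sq x n + d < sq y n)" by (auto simp: lt_def)
  have "\<not> dl x y d"
  proof
    assume "dl x y d"
    then obtain d' where d': "0 < d'" "ev (\<lambda>n. \<bar>sq x n - sq y n\<bar> + d' < d)" by (auto simp: dl_def)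
    have "ev (\<lambda>n. False)" by (rule ev_mp2[OF d(2) d'(2)]) (use d d' in linarith)
    then show False by (auto simp: ev_def)
  qed
  with d(1) show ?thesis by blast
qed

lemma eqR_iff_dl: "x \<in> RR \<Longrightarrow> y \<in> RR \<Longrightarrow> eqR x y \<longleftrightarrow> (\<forall>r>0. dl x y r)"
  using eqR_dl lt_not_dl not_eqR dl_sym by metis

lemma eqR_refl [simp]: "x \<in> RR \<Longrightarrow> eqR x x"
  by (simp add: eqR_iff_dl dl_refl)

lemma eqR_sym: "x \<in> RR \<Longrightarrow> y \<in> RR \<Longrightarrow> eqR x y \<Longrightarrow> eqR y x"
  by (auto simp: eqR_iff)

lemma eqR_trans: "x \<in> RR \<Longrightarrow> y \<in> RR \<Longrightarrow> z \<in> RR \<Longrightarrow> eqR x y \<Longrightarrow> eqR y z \<Longrightarrow> eqR x z"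
proof -
  assume *: "x \<in> RR" "y \<in> RR" "z \<in> RR" "eqR x y" "eqR y z"
  have "dl x z (r / 2 + r / 2)" if "0 < r" for r
    using * that by (intro dl_trans[of x y _ z]) (auto simp: eqR_iff_dl)
  then show ?thesis using * by (simp add: eqR_iff_dl)
qed

lemma lt_irrefl: "\<not> lt x x"
  by (auto simp: lt_def ev_def)

lemma lt_trans: "lt x y \<Longrightarrow> lt y z \<Longrightarrow> lt x z"
proof -
  assume "lt x y" "lt y z"
  then obtain d d' where d: "0 < d" "ev (\<lambda>n. sq x n + d < sq y n)" "0 < d'" "ev (\<lambda>n. sq y n + d' < sq z n)"
    by (auto simp: lt_def)
  have "ev (\<lambda>n. sq x n + d < sq z n)" by (rule ev_mp2[OF d(2) d(4)]) (use d in linarith)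
  with d(1) show ?thesis by (auto simp: lt_def)
qed

lemma lt_cong: "x \<in> RR \<Longrightarrow> y \<in> RR \<Longrightarrow> z \<in> RR \<Longrightarrow> eqR x y \<Longrightarrow> lt x z \<longleftrightarrow> lt y z"
  "x \<in> RR \<Longrightarrow> y \<in> RR \<Longrightarrow> z \<in> RR \<Longrightarrow> eqR x y \<Longrightarrow> lt z x \<longleftrightarrow> lt z y"
proof -
  have *: "lt y z" if xy: "x \<in> RR" "y \<in> RR" "eqR x y" "lt x z" for x y z
  proof -
    obtain d where d: "0 < d" "ev (\<lambda>n. sq x n + d < sq z n)" using xy(4) by (auto simp: lt_def)
    obtain d' where d': "0 < d'" "ev (\<lambda>n. \<bar>sq x n - sq y n\<bar> + d' < d / 2)"
      using eqR_dl[OF xy(1-3), of "d / 2"] d(1) by (auto simp: dl_def)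
    have "ev (\<lambda>n. sq y n + d / 2 < sq z n)"
    proof (rule ev_mp2[OF d(2) d'(2)])
      fix n assume "sq x n + d < sq z n" "\<bar>sq x n - sq y n\<bar> + d' < d / 2"
      moreover have "d = d / 2 + d / 2" by simp
      ultimately show "sq y n + d / 2 < sq z n" using d' by linarith
    qed
    with d(1) show ?thesis by (auto simp: lt_def intro: exI[of _ "d / 2"])
  qed
  have **: "lt z y" if xy: "x \<in> RR" "y \<in> RR" "eqR x y" "lt z x" for x y z
  proof -
    obtain d where d: "0 < d" "ev (\<lambda>n. sq z n + d < sq x n)" using xy(4) by (auto simp: lt_def)
    obtain d' where d': "0 < d'" "ev (\<lambda>n. \<bar>sq x n - sq y n\<bar> + d' < d / 2)"
      using eqR_dl[OF xy(1-3), of "d / 2"] d(1) by (auto simp: dl_def)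
    have "ev (\<lambda>n. sq z n + d / 2 < sq y n)"
    proof (rule ev_mp2[OF d(2) d'(2)])
      fix n assume "sq z n + d < sq x n" "\<bar>sq x n - sq y n\<bar> + d' < d / 2"
      moreover have "d = d / 2 + d / 2" by simp
      ultimately show "sq z n + d / 2 < sq y n" using d' by linarith
    qed
    with d(1) show ?thesis by (auto simp: lt_def intro: exI[of _ "d / 2"])
  qed
  show "x \<in> RR \<Longrightarrow> y \<in> RR \<Longrightarrow> z \<in> RR \<Longrightarrow> eqR x y \<Longrightarrow> lt x z \<longleftrightarrow> lt y z"
    "x \<in> RR \<Longrightarrow> y \<in> RR \<Longrightarrow> z \<in> RR \<Longrightarrow> eqR x y \<Longrightarrow> lt z x \<longleftrightarrow> lt z y"
    using * ** eqR_sym by blast+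
qed

lemma dl_cong: "x \<in> RR \<Longrightarrow> x' \<in> RR \<Longrightarrow> eqR x x' \<Longrightarrow> dl x y r \<longleftrightarrow> dl x' y r"
proof -
  have *: "dl x' y r" if xy: "x \<in> RR" "x' \<in> RR" "eqR x x'" "dl x y r" for x x'
  proof -
    obtain d where d: "0 < d" "ev (\<lambda>n. \<bar>sq x n - sq y n\<bar> + d < r)" using xy(4) by (auto simp: dl_def)
    obtain d' where d': "0 < d'" "ev (\<lambda>n. \<bar>sq x n - sq x' n\<bar> + d' < d / 2)"
      using eqR_dl[OF xy(1-3), of "d / 2"] d(1) by (auto simp: dl_def)
    have "ev (\<lambda>n. \<bar>sq x' n - sq y n\<bar> + d / 2 < r)"
    proof (rule ev_mp2[OF d(2) d'(2)])
      fix n assume "\<bar>sq x n - sq y n\<bar> + d < r" "\<bar>sq x n - sq x' n\<bar> + d' < d / 2"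
      moreover have "d = d / 2 + d / 2" by simp
      ultimately show "\<bar>sq x' n - sq y n\<bar> + d / 2 < r" using d' by linarith
    qed
    with d(1) show ?thesis by (auto simp: dl_def intro: exI[of _ "d / 2"])
  qed
  show "x \<in> RR \<Longrightarrow> x' \<in> RR \<Longrightarrow> eqR x x' \<Longrightarrow> dl x y r \<longleftrightarrow> dl x' y r" using * eqR_sym by blast
qed

lemma lt_open:
  assumes "lt x y"
  obtains r where "0 < r" "\<And>x'. dl x x' r \<Longrightarrow> lt x' y" "\<And>y'. dl y y' r \<Longrightarrow> lt x y'"
proof -
  obtain d where d: "0 < d" "ev (\<lambda>n. sq x n + d < sq y n)" using assms by (auto simp: lt_def)
  have "lt x' y" if "dl x x' d" for x'
  proof -
    obtain d' where d': "0 < d'" "ev (\<lambda>n. \<bar>sq x n - sq x' n\<bar> + d' < d)" using \<open>dl x x' d\<close> by (auto simp: dl_def)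
    have "ev (\<lambda>n. sq x' n + d' < sq y n)" by (rule ev_mp2[OF d(2) d'(2)]) linarith
    with d'(1) show ?thesis by (auto simp: lt_def)
  qed
  moreover have "lt x y'" if "dl y y' d" for y'
  proof -
    obtain d' where d': "0 < d'" "ev (\<lambda>n. \<bar>sq y n - sq y' n\<bar> + d' < d)" using \<open>dl y y' d\<close> by (auto simp: dl_def)
    have "ev (\<lambda>n. sq x n + d' < sq y' n)" by (rule ev_mp2[OF d(2) d'(2)]) linarith
    with d'(1) show ?thesis by (auto simp: lt_def)
  qed
  ultimately show thesis using d(1) that by blast
qed

lemma lt_between:
  assumes x: "x \<in> RR" and y: "y \<in> RR" and "lt x y" "0 < r"
  obtains k where "isc k" "lt x (kst k)" "lt (kst k) y" "dl x (kst k) r"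
proof -
  obtain d where d: "0 < d" "ev (\<lambda>n. sq x n + d < sq y n)" using assms by (auto simp: lt_def)
  \<comment> \<open>The approximation at n is within s of x. A rational placed 2s above it lies more
    than s above x and less than 3s away from x, which leaves a margin s below y as well as in the
    distance r.\<close>
  define s where "s = min d r / 4"
  have s: "0 < s" "4 * s \<le> d" "4 * s \<le> r" using d(1) assms(4) by (auto simp: s_def)
  obtain n where n: "hh n < s" using hh_small[OF s(1)] by blast
  obtain k where k: "isc k" "rt k = sq x n + 2 * s" using ex_kst by blast
  have e: "ev (\<lambda>k. \<bar>sq x n - sq x k\<bar> < s)" by (rule ev_mp[OF ev_cauchy[OF x, of n]]) (use n in linarith)
  have "ev (\<lambda>j. sq x j + s < sq (kst k) j)"
  proof (rule ev_mp[OF e])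
    fix j assume "\<bar>sq x n - sq x j\<bar> < s"
    then have "sq x j < sq x n + s" by linarith
    then show "sq x j + s < sq (kst k) j" by (simp add: k)
  qed
  moreover have "ev (\<lambda>j. sq (kst k) j + s < sq y j)"
  proof (rule ev_mp2[OF e d(2)])
    fix j assume "\<bar>sq x n - sq x j\<bar> < s" "sq x j + d < sq y j"
    moreover have "sq (kst k) j = sq x n + s + s" by (simp add: k)
    ultimately show "sq (kst k) j + s < sq y j" using s by linarith
  qed
  moreover have "ev (\<lambda>j. \<bar>sq x j - sq (kst k) j\<bar> + s < r)"
  proof (rule ev_mp[OF e])
    fix j assume "\<bar>sq x n - sq x j\<bar> < s"
    moreover have "sq (kst k) j = sq x n + s + s" by (simp add: k)
    ultimately show "\<bar>sq x j - sq (kst k) j\<bar> + s < r" using s by linarith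
  qed
  ultimately show thesis using that[OF k(1)] s(1) by (auto simp: lt_def dl_def)
qed


subsection \<open>Definability of relations between reals\<close>

text \<open>These substitution rules allow each relation to be shown definable once, in the context
  of its own arguments, and then to be used with definable arguments in any context.\<close>

lemma dp_subst0: "dp [T0] (\<lambda>e. P (nm (hd e))) \<Longrightarrow> dn \<Gamma> F \<Longrightarrow> dp \<Gamma> (\<lambda>e. P (F e))"
  by (rule dset_subst)

lemma dn_subst0: "dn [T0] (\<lambda>e. f (nm (hd e))) \<Longrightarrow> dn \<Gamma> F \<Longrightarrow> dn \<Gamma> (\<lambda>e. f (F e))"
proof -
  assume "dn [T0] (\<lambda>e. f (nm (hd e)))" and F: "dn \<Gamma> F"
  from this(1)[unfolded dn_def] obtain c where c: "c \<in> D T1" "\<And>x. x \<in> D T0 \<Longrightarrow> c \<bullet> x = un (f (nm x))"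
    by (rule dfn1E) simp
  have "dn \<Gamma> (\<lambda>e. fn c (F e))" by (intro dn_fn dfn_const c F)
  then show ?thesis by (rule dn_cong) (simp add: fn_def c)
qed

lemma dp_subst1: "dp [T1] (\<lambda>e. P (hd e)) \<Longrightarrow> dfn \<Gamma> T1 X \<Longrightarrow> dp \<Gamma> (\<lambda>e. P (X e))"
proof -
  assume "dp [T1] (\<lambda>e. P (hd e))" and X: "dfn \<Gamma> T1 X"
  from this(1)[unfolded dp_def dn_def] obtain c where c: "c \<in> D T2" "\<And>x. x \<in> D T1 \<Longrightarrow> c \<bullet> x = un (if P x then 1 else 0)"
    by (rule dfn1E) simp
  have "dn \<Gamma> (\<lambda>e. nm (c \<bullet> X e))" by (intro dn_app c X)
  then show ?thesis unfolding dp_def by (rule dn_cong) (simp add: c dfn_in[OF X])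
qed

lemma dp_subst2: "dp [T1, T1] (\<lambda>e. P (hd (tl e)) (hd e)) \<Longrightarrow> dfn \<Gamma> T1 X \<Longrightarrow> dfn \<Gamma> T1 Y \<Longrightarrow> dp \<Gamma> (\<lambda>e. P (X e) (Y e))"
proof -
  assume "dp [T1, T1] (\<lambda>e. P (hd (tl e)) (hd e))" and X: "dfn \<Gamma> T1 X" and Y: "dfn \<Gamma> T1 Y"
  from this(1)[unfolded dp_def dn_def] obtain c where c: "c \<in> D (T1 \<Rrightarrow> T1 \<Rrightarrow> T0)"
    "\<And>x y. x \<in> D T1 \<Longrightarrow> y \<in> D T1 \<Longrightarrow> c \<bullet> x \<bullet> y = un (if P x y then 1 else 0)"
    by (rule dfn2E) simp
  have "dn \<Gamma> (\<lambda>e. nm (c \<bullet> X e \<bullet> Y e))"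
    by (intro dn_nm dfn_app[of \<Gamma> T1 T0] dfn_app[of \<Gamma> T1 T2] dfn_const c X Y)
  then show ?thesis unfolding dp_def by (rule dn_cong) (simp add: c dfn_in[OF X] dfn_in[OF Y])
qed

lemma dp_subst21:
  "dp [T0, T1, T1] (\<lambda>e. P (hd (tl (tl e))) (hd (tl e)) (nm (hd e))) \<Longrightarrow> dfn \<Gamma> T1 X \<Longrightarrow> dfn \<Gamma> T1 Y \<Longrightarrow> dn \<Gamma> F \<Longrightarrow>
   dp \<Gamma> (\<lambda>e. P (X e) (Y e) (F e))"
proof -
  assume "dp [T0, T1, T1] (\<lambda>e. P (hd (tl (tl e))) (hd (tl e)) (nm (hd e)))"
    and X: "dfn \<Gamma> T1 X" and Y: "dfn \<Gamma> T1 Y" and F: "dn \<Gamma> F"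
  from this(1)[unfolded dp_def dn_def] obtain c where c: "c \<in> D (T1 \<Rrightarrow> T1 \<Rrightarrow> T0 \<Rrightarrow> T0)"
    "\<And>x y z. x \<in> D T1 \<Longrightarrow> y \<in> D T1 \<Longrightarrow> z \<in> D T0 \<Longrightarrow> c \<bullet> x \<bullet> y \<bullet> z = un (if P x y (nm z) then 1 else 0)"
    by (rule dfn3E) simp
  have "dn \<Gamma> (\<lambda>e. nm (c \<bullet> X e \<bullet> Y e \<bullet> un (F e)))"
    by (intro dn_nm dfn_app[of \<Gamma> T0 T0] dfn_un dfn_app[of \<Gamma> T1 T1] dfn_app[of \<Gamma> T1 "T1 \<Rrightarrow> T1"] dfn_const c X Y F)
  then show ?thesis unfolding dp_def by (rule dn_cong) (simp add: c dfn_in[OF X] dfn_in[OF Y])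
qed

text \<open>The field is not a domain of the model. A function into it counts as definable through
  the numbers of a representing fraction, which may differ from the components of any code.\<close>

definition dq :: "ty list \<Rightarrow> ('u list \<Rightarrow> 'n zz fract) \<Rightarrow> bool" where
  "dq \<Gamma> Q \<longleftrightarrow> (\<exists>A B C. dn \<Gamma> A \<and> dn \<Gamma> B \<and> dn \<Gamma> C \<and>
     (\<forall>e\<in>envs \<Gamma>. 0 < C e \<and> Q e = (rn (A e) - rn (B e)) / rn (C e)))"

lemma dqI: "dn \<Gamma> A \<Longrightarrow> dn \<Gamma> B \<Longrightarrow> dn \<Gamma> C \<Longrightarrow> (\<And>e. e \<in> envs \<Gamma> \<Longrightarrow> 0 < C e) \<Longrightarrow>
   (\<And>e. e \<in> envs \<Gamma> \<Longrightarrow> Q e = (rn (A e) - rn (B e)) / rn (C e)) \<Longrightarrow> dq \<Gamma> Q"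
  unfolding dq_def by blast

lemma dqE:
  assumes "dq \<Gamma> Q"
  obtains A B C where "dn \<Gamma> A" "dn \<Gamma> B" "dn \<Gamma> C"
    "\<And>e. e \<in> envs \<Gamma> \<Longrightarrow> 0 < C e" "\<And>e. e \<in> envs \<Gamma> \<Longrightarrow> Q e = (rn (A e) - rn (B e)) / rn (C e)"
  using assms unfolding dq_def by blast

lemma add_one_pos: "0 < (n::'n) + 1"
  using less_add_one_iff ds_nonneg by blast

lemma dq_add [dfn_intros]: "dq \<Gamma> Q \<Longrightarrow> dq \<Gamma> R \<Longrightarrow> dq \<Gamma> (\<lambda>e. Q e + R e)"
proof -
  assume Q: "dq \<Gamma> Q" and R: "dq \<Gamma> R"
  obtain A B C where *: "dn \<Gamma> A" "dn \<Gamma> B" "dn \<Gamma> C"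
    "\<And>e. e \<in> envs \<Gamma> \<Longrightarrow> 0 < C e" "\<And>e. e \<in> envs \<Gamma> \<Longrightarrow> Q e = (rn (A e) - rn (B e)) / rn (C e)"
    using dqE[OF Q] by metis
  obtain A' B' C' where **: "dn \<Gamma> A'" "dn \<Gamma> B'" "dn \<Gamma> C'"
    "\<And>e. e \<in> envs \<Gamma> \<Longrightarrow> 0 < C' e" "\<And>e. e \<in> envs \<Gamma> \<Longrightarrow> R e = (rn (A' e) - rn (B' e)) / rn (C' e)"
    using dqE[OF R] by metis
  show ?thesis
  proof (rule dqI[of _ "\<lambda>e. A e * C' e + A' e * C e" "\<lambda>e. B e * C' e + B' e * C e" "\<lambda>e. C e * C' e"])
    fix e assume e: "e \<in> envs \<Gamma>"
    then have "rn (C e) \<noteq> 0" "rn (C' e) \<noteq> 0" using *(4)[OF e] **(4)[OF e] by auto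
    then show "Q e + R e = (rn (A e * C' e + A' e * C e) - rn (B e * C' e + B' e * C e)) / rn (C e * C' e)"
      unfolding *(5)[OF e] **(5)[OF e] by (simp add: field_simps)
  qed (intro dn_add dn_mult ds_mult_pos * **; assumption)+
qed

lemma dq_uminus [dfn_intros]: "dq \<Gamma> Q \<Longrightarrow> dq \<Gamma> (\<lambda>e. - Q e)"
proof -
  assume "dq \<Gamma> Q"
  then obtain A B C where *: "dn \<Gamma> A" "dn \<Gamma> B" "dn \<Gamma> C"
    "\<And>e. e \<in> envs \<Gamma> \<Longrightarrow> 0 < C e" "\<And>e. e \<in> envs \<Gamma> \<Longrightarrow> Q e = (rn (A e) - rn (B e)) / rn (C e)"
    using dqE by metis
  show ?thesis by (rule dqI[OF *(2,1,3,4)]) (use *(5) in \<open>auto simp: minus_divide_left\<close>)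
qed

lemma dq_diff [dfn_intros]: "dq \<Gamma> Q \<Longrightarrow> dq \<Gamma> R \<Longrightarrow> dq \<Gamma> (\<lambda>e. Q e - R e)"
  unfolding diff_conv_add_uminus by (intro dq_add dq_uminus)

lemma dq_mult_const [dfn_intros]: "dq \<Gamma> Q \<Longrightarrow> dq \<Gamma> (\<lambda>e. c * Q e)"
proof -
  assume "dq \<Gamma> Q"
  then obtain A B C where *: "dn \<Gamma> A" "dn \<Gamma> B" "dn \<Gamma> C"
    "\<And>e. e \<in> envs \<Gamma> \<Longrightarrow> 0 < C e" "\<And>e. e \<in> envs \<Gamma> \<Longrightarrow> Q e = (rn (A e) - rn (B e)) / rn (C e)"
    using dqE by metis
  obtain i j k :: 'n where c: "c = (rn i - rn j) / (rn k + 1)" by (rule fract_rn_exhaust)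
  show ?thesis
  proof (rule dqI[of _ "\<lambda>e. i * A e + j * B e" "\<lambda>e. i * B e + j * A e" "\<lambda>e. (k + 1) * C e"])
    fix e assume e: "e \<in> envs \<Gamma>"
    show "0 < (k + 1) * C e" using *(4)[OF e] by (simp add: ds_mult_pos add_one_pos)
    show "c * Q e = (rn (i * A e + j * B e) - rn (i * B e + j * A e)) / rn ((k + 1) * C e)"
      using *(5)[OF e] by (simp add: c algebra_simps)
  qed (intro dn_add dn_mult dn_const *)+
qed

lemma dq_inverse [dfn_intros]: "dn \<Gamma> C \<Longrightarrow> (\<And>e. e \<in> envs \<Gamma> \<Longrightarrow> 0 < C e) \<Longrightarrow> dn \<Gamma> A \<Longrightarrow> dq \<Gamma> (\<lambda>e. rn (A e) / rn (C e))"
  by (rule dqI[of _ A "\<lambda>_. 0" C]) (simp_all add: dn_const)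

lemma dq_hh [dfn_intros]: "dn \<Gamma> F \<Longrightarrow> dq \<Gamma> (\<lambda>e. hh (F e))"
  using dq_inverse[OF dn_pw pw_pos dn_const[of _ 1]] by (simp add: hh_def)

lemma dp_qless [dfn_intros]: "dq \<Gamma> Q \<Longrightarrow> dq \<Gamma> R \<Longrightarrow> dp \<Gamma> (\<lambda>e. Q e < R e)"
proof -
  assume Q: "dq \<Gamma> Q" and R: "dq \<Gamma> R"
  obtain A B C where *: "dn \<Gamma> A" "dn \<Gamma> B" "dn \<Gamma> C"
    "\<And>e. e \<in> envs \<Gamma> \<Longrightarrow> 0 < C e" "\<And>e. e \<in> envs \<Gamma> \<Longrightarrow> Q e = (rn (A e) - rn (B e)) / rn (C e)"
    using dqE[OF Q] by metis
  obtain A' B' C' where **: "dn \<Gamma> A'" "dn \<Gamma> B'" "dn \<Gamma> C'"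
    "\<And>e. e \<in> envs \<Gamma> \<Longrightarrow> 0 < C' e" "\<And>e. e \<in> envs \<Gamma> \<Longrightarrow> R e = (rn (A' e) - rn (B' e)) / rn (C' e)"
    using dqE[OF R] by metis
  have "dp \<Gamma> (\<lambda>e. A e * C' e + B' e * C e < A' e * C e + B e * C' e)"
    by (intro dp_less dn_add dn_mult * **)
  then show ?thesis
  proof (rule dp_cong)
    fix e assume e: "e \<in> envs \<Gamma>"
    have C: "0 < rn (C e)" "0 < rn (C' e)" using *(4)[OF e] **(4)[OF e] by auto
    have "Q e < R e \<longleftrightarrow> (rn (A e) - rn (B e)) * rn (C' e) < (rn (A' e) - rn (B' e)) * rn (C e)"
      using C *(5)[OF e] **(5)[OF e] by (simp add: divide_less_eq less_divide_eq)
    also have "\<dots> \<longleftrightarrow> rn (A e * C' e + B' e * C e) < rn (A' e * C e + B e * C' e)"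
      by (simp only: rn_simps(3,4)) (simp add: algebra_simps)
    finally show "(A e * C' e + B' e * C e < A' e * C e + B e * C' e) = (Q e < R e)" by (simp only: rn_simps(5))
  qed
qed

lemma dp_qle [dfn_intros]: "dq \<Gamma> Q \<Longrightarrow> dq \<Gamma> R \<Longrightarrow> dp \<Gamma> (\<lambda>e. Q e \<le> R e)"
  unfolding not_less[symmetric] by (intro dfn_intros)

lemma dp_qabs [dfn_intros]:
  "dq \<Gamma> Q \<Longrightarrow> dq \<Gamma> R \<Longrightarrow> dp \<Gamma> (\<lambda>e. \<bar>Q e\<bar> < R e)"
  "dq \<Gamma> Q \<Longrightarrow> dq \<Gamma> R \<Longrightarrow> dp \<Gamma> (\<lambda>e. \<bar>Q e\<bar> \<le> R e)"
  unfolding abs_less_iff abs_le_iff by (intro dfn_intros; assumption)+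

lemma dp_isc [dfn_intros]: "dn \<Gamma> F \<Longrightarrow> dp \<Gamma> (\<lambda>e. isc (F e))"
  by (rule dp_subst0) (unfold isc_def code_def pair_def, intro dfn_intros)

lemma dq_rt [dfn_intros]: "dn \<Gamma> F \<Longrightarrow> dq \<Gamma> (\<lambda>e. rt (F e))"
proof -
  assume F: "dn \<Gamma> F"
  \<comment> \<open>The implication makes each search succeed on non-codes too, with result 0, as
    \<open>dn_Least\<close> requires a witness in every environment.\<close>
  let ?A = "\<lambda>k. LEAST a. isc k \<longrightarrow> (\<exists>b c. k = code a b c)"
  let ?B = "\<lambda>k. LEAST b. isc k \<longrightarrow> (\<exists>a c. k = code a b c)"
  let ?C = "\<lambda>k. LEAST c. isc k \<longrightarrow> (\<exists>a b. k = code a b c)"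
  have "dn \<Gamma> (\<lambda>e. ?A (F e))"
    by (rule dn_subst0[OF dn_Least F]) (unfold code_def pair_def, intro dfn_intros, auto simp: isc_def code_def pair_def)
  moreover have "dn \<Gamma> (\<lambda>e. ?B (F e))"
    by (rule dn_subst0[OF dn_Least F]) (unfold code_def pair_def, intro dfn_intros, auto simp: isc_def code_def pair_def)
  moreover have "dn \<Gamma> (\<lambda>e. ?C (F e))"
    by (rule dn_subst0[OF dn_Least F]) (unfold code_def pair_def, intro dfn_intros, auto simp: isc_def code_def pair_def)
  ultimately show ?thesis
  proof (intro dqI[of _ "\<lambda>e. ?A (F e)" "\<lambda>e. ?B (F e)" "\<lambda>e. ?C (F e) + 1"] dn_add dn_const)
    fix e
    show "0 < ?C (F e) + 1" by (rule add_one_pos)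
    show "rt (F e) = (rn (?A (F e)) - rn (?B (F e))) / rn (?C (F e) + 1)"
    proof (cases "isc (F e)")
      case True
      then obtain a b c where *: "F e = code a b c" by (auto simp: isc_def)
      have "?A (F e) = a" "?B (F e) = b" "?C (F e) = c"
        by (rule Least_equality; auto simp: * code_inject)+
      then show ?thesis by (simp add: *)
    next
      case False
      then have "?A (F e) = 0" "?B (F e) = 0"
        by (auto intro!: Least_equality ds_nonneg)
      with False show ?thesis by (simp add: rt_def)
    qed
  qed
qed

lemma dq_sq [dfn_intros]: "dfn \<Gamma> T1 X \<Longrightarrow> dn \<Gamma> F \<Longrightarrow> dq \<Gamma> (\<lambda>e. sq (X e) (F e))"
  unfolding sq_def by (intro dfn_intros)

lemma dfn_kst [dfn_intros]: "dn \<Gamma> F \<Longrightarrow> dfn \<Gamma> T1 (\<lambda>e. kst (F e))"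
  unfolding kst_def by (intro dfn_app[of \<Gamma> T0] dfn_const CK_in dfn_un)

text \<open>An arithmetical substitute for \<open>dl x y (hh k)\<close>, whose own definition
  quantifies over field elements. One index suffices, since \<open>2 * hh n\<close> covers the later
  movement of both sequences.\<close>

definition dlh :: "'u \<Rightarrow> 'u \<Rightarrow> 'n \<Rightarrow> bool" where
  "dlh x y k \<longleftrightarrow> (\<exists>n. \<bar>sq x n - sq y n\<bar> < hh k - 2 * hh n)"

lemma dlh_iff: "x \<in> RR \<Longrightarrow> y \<in> RR \<Longrightarrow> dlh x y k \<longleftrightarrow> dl x y (hh k)"
proof
  assume xy: "x \<in> RR" "y \<in> RR"
  show "dl x y (hh k)" if a: "dlh x y k"
  proof -
    obtain n where n: "\<bar>sq x n - sq y n\<bar> < hh k - 2 * hh n" using a by (auto simp: dlh_def)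
    have "ev (\<lambda>j. \<bar>sq x j - sq y j\<bar> + (hh k - 2 * hh n - \<bar>sq x n - sq y n\<bar>) < hh k)"
      by (rule ev_mp2[OF ev_cauchy[OF xy(1), of n] ev_cauchy[OF xy(2), of n]]) linarith
    then show ?thesis unfolding dl_def using n by (intro exI[of _ "hh k - 2 * hh n - \<bar>sq x n - sq y n\<bar>"]) auto
  qed
  show "dlh x y k" if a: "dl x y (hh k)"
  proof -
    obtain d where d: "0 < d" "ev (\<lambda>n. \<bar>sq x n - sq y n\<bar> + d < hh k)" using a by (auto simp: dl_def)
    have "ev (\<lambda>n. \<bar>sq x n - sq y n\<bar> < hh k - 2 * hh n)"
      by (rule ev_mp2[OF d(2) ev_hh[of "d / 2"]]) (use d(1) in \<open>auto simp: field_simps\<close>)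
    then show ?thesis using ev_ex by (fastforce simp: dlh_def)
  qed
qed

lemma dp_eqR [dfn_intros]: "dfn \<Gamma> T1 X \<Longrightarrow> dfn \<Gamma> T1 Y \<Longrightarrow> dp \<Gamma> (\<lambda>e. eqR (X e) (Y e))"
  by (rule dp_subst2) (unfold eqR_def, intro dfn_intros)

lemma dp_ltR [dfn_intros]: "dfn \<Gamma> T1 X \<Longrightarrow> dfn \<Gamma> T1 Y \<Longrightarrow> dp \<Gamma> (\<lambda>e. ltR (X e) (Y e))"
  by (rule dp_subst2) (unfold ltR_def, intro dfn_intros)

lemma dp_dlh [dfn_intros]:
  "dfn \<Gamma> T1 X \<Longrightarrow> dfn \<Gamma> T1 Y \<Longrightarrow> dn \<Gamma> F \<Longrightarrow> dp \<Gamma> (\<lambda>e. dlh (X e) (Y e) (F e))"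
  by (rule dp_subst21) (unfold dlh_def, intro dfn_intros)

lemma dp_RR [dfn_intros]: "dfn \<Gamma> T1 X \<Longrightarrow> dp \<Gamma> (\<lambda>e. X e \<in> RR)"
proof (rule dp_subst1)
  have "dp [T1] (\<lambda>e. (\<forall>n. isc (fn (hd e) n)) \<and> (\<forall>n i. \<bar>sq (hd e) n - sq (hd e) (n + i)\<bar> < hh n))"
    by (intro dfn_intros)
  then show "dp [T1] (\<lambda>e. hd e \<in> RR)"
  proof (rule dp_cong)
    fix e assume "e \<in> envs [T1]"
    then have "hd e \<in> D T1" by (auto simp: envs_Cons)
    then show "((\<forall>n. isc (fn (hd e) n)) \<and> (\<forall>n i. \<bar>sq (hd e) n - sq (hd e) (n + i)\<bar> < hh n)) = (hd e \<in> RR)"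
      unfolding RR_def by blast
  qed
qed

lemma dp_IV [dfn_intros]: "dfn \<Gamma> T1 X \<Longrightarrow> dfn \<Gamma> T1 A \<Longrightarrow> dfn \<Gamma> T1 B \<Longrightarrow> dp \<Gamma> (\<lambda>e. X e \<in> IV (A e) (B e))"
  unfolding IV_def mem_Collect_eq by (intro dfn_intros)


subsection \<open>Semantics of the principles\<close>

lemma den_var [simp]: "k = length e \<Longrightarrow> den S (v # e) (var k) = v"
  by (simp add: den_simps)

lemma app_in_simps [simp]:
  "f \<in> D (T1 \<Rrightarrow> T1) \<Longrightarrow> x \<in> D T1 \<Longrightarrow> f \<bullet> x \<in> D T1"
  "w \<in> D (T0 \<Rrightarrow> T1) \<Longrightarrow> w \<bullet> un n \<in> D T1"
  "F \<in> D (T0 \<Rrightarrow> T0 \<Rrightarrow> T1) \<Longrightarrow> F \<bullet> un p \<bullet> un q \<in> D T1"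
  "X \<in> D (T0 \<Rrightarrow> T2) \<Longrightarrow> X \<bullet> un n \<in> D T2"
  "X \<in> D T2 \<Longrightarrow> x \<in> D T1 \<Longrightarrow> X \<bullet> x \<in> D T0"
  by (meson app_in un_in)+

definition PR :: "'u set" where "PR = {z \<in> RR. ltR zeroR z}"

lemma ball_RR: "(\<forall>x\<in>D T1. x \<in> RR \<longrightarrow> P x) \<longleftrightarrow> (\<forall>x\<in>RR. P x)"
  and bex_RR: "(\<exists>x\<in>D T1. x \<in> RR \<and> P x) \<longleftrightarrow> (\<exists>x\<in>RR. P x)"
  by auto

lemma ball_IV: "(\<forall>x\<in>D T1. x \<in> IV a b \<longrightarrow> P x) \<longleftrightarrow> (\<forall>x\<in>IV a b. P x)"
  and bex_IV: "(\<exists>x\<in>D T1. x \<in> IV a b \<and> P x) \<longleftrightarrow> (\<exists>x\<in>IV a b. P x)"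
  by (auto simp: IV_def)

lemma ball_PR: "(\<forall>x\<in>D T1. x \<in> RR \<and> ltR zeroR x \<longrightarrow> P x) \<longleftrightarrow> (\<forall>x\<in>PR. P x)"
  and bex_PR: "(\<exists>x\<in>RR. ltR zeroR x \<and> P x) \<longleftrightarrow> (\<exists>x\<in>PR. P x)"
  by (auto simp: PR_def)

lemma IV_in: "x \<in> IV a b \<Longrightarrow> x \<in> D T1" "x \<in> IV a b \<Longrightarrow> x \<in> RR"
  by (auto simp: IV_def)

lemma UI_in [simp]: "x \<in> UI \<Longrightarrow> x \<in> D T1" "x \<in> UI \<Longrightarrow> x \<in> RR"
  using IV_in by blast+

lemma RR_in [simp]: "x \<in> RR \<Longrightarrow> x \<in> D T1"
  by auto

lemma PR_in [simp]: "x \<in> PR \<Longrightarrow> x \<in> D T1" "x \<in> PR \<Longrightarrow> x \<in> RR"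
  by (auto simp: PR_def)

lemma hol_ball_Real: "hol S e (o_ball Real P) \<longleftrightarrow> (\<forall>x\<in>RR. hol S (x # e) (P (var (length e))))"
  and hol_bex_Real: "hol S e (o_bex Real P) \<longleftrightarrow> (\<exists>x\<in>RR. hol S (x # e) (P (var (length e))))"
  and hol_ball_PosReal: "hol S e (o_ball PosReal P) \<longleftrightarrow> (\<forall>x\<in>PR. hol S (x # e) (P (var (length e))))"
  and hol_bex_PosReal: "hol S e (o_bex PosReal P) \<longleftrightarrow> (\<exists>x\<in>PR. hol S (x # e) (P (var (length e))))"
  and hol_ball_interval: "stab S e a \<Longrightarrow> den S e a \<in> D T1 \<Longrightarrow> stab S e b \<Longrightarrow> den S e b \<in> D T1 \<Longrightarrow>
    hol S e (o_ball (interval a b) P) \<longleftrightarrow> (\<forall>x\<in>IV (den S e a) (den S e b). hol S (x # e) (P (var (length e))))"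
  and hol_bex_interval: "stab S e a \<Longrightarrow> den S e a \<in> D T1 \<Longrightarrow> stab S e b \<Longrightarrow> den S e b \<in> D T1 \<Longrightarrow>
    hol S e (o_bex (interval a b) P) \<longleftrightarrow> (\<exists>x\<in>IV (den S e a) (den S e b). hol S (x # e) (P (var (length e))))"
  by (simp_all add: hol_ball hol_bex stab_simps den_Cons stab_Cons ball_RR bex_RR ball_IV bex_IV ball_PR bex_PR cong: conj_cong)

lemmas sem = hol_ball_Real hol_bex_Real hol_ball_PosReal hol_bex_PosReal hol_ball_interval hol_bex_interval
  hol_all hol_ex hol_connectives(1,2,4-8) den_simps(1,2) den_Cons stab_simps stab_Cons ball_T0 bex_T0 eqr_eq

text \<open>The bound is a number of the model and \<open>w\<close> a sequence of the model, so this
  is internal finiteness; the set may be infinite in the metatheory.\<close>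

definition finR :: "('u \<Rightarrow> bool) \<Rightarrow> bool" where
  "finR P \<longleftrightarrow> (\<exists>N. \<forall>w\<in>D (T0 \<Rrightarrow> T1). (\<forall>i\<le>N. w \<bullet> un i \<in> RR) \<and>
     (\<forall>i j. i < j \<and> j \<le> N \<longrightarrow> \<not> eqR (w \<bullet> un i) (w \<bullet> un j)) \<longrightarrow> (\<exists>i\<le>N. \<not> P (w \<bullet> un i)))"

lemma hol_finite_set:
  assumes "\<And>v1 v2 v3 x. stab S (v1 # v2 # v3 # e) x \<Longrightarrow> den S (v1 # v2 # v3 # e) x \<in> D T1 \<Longrightarrow>
    hol S (v1 # v2 # v3 # e) (A x) \<longleftrightarrow> P (den S (v1 # v2 # v3 # e) x)"
  shows "hol S e (finite_set A) \<longleftrightarrow> finR P"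
  by (simp add: finite_set_def sem assms finR_def)

definition setR :: "'u \<Rightarrow> bool" where
  "setR X \<longleftrightarrow> (\<forall>x\<in>RR. X \<bullet> x = un 0 \<or> X \<bullet> x = un 1) \<and> (\<forall>x\<in>RR. \<forall>y\<in>RR. eqR x y \<longrightarrow> X \<bullet> x = X \<bullet> y)"

lemma hol_is_set: "stab S e X \<Longrightarrow> hol S e (is_set X) \<longleftrightarrow> setR (den S e X)"
  by (simp add: is_set_def sem setR_def)

lemma FIN_union_sem:
  assumes "X \<in> D (T0 \<Rrightarrow> T2)" "\<And>n. setR (X \<bullet> un n)" "\<And>n. finR (\<lambda>x. X \<bullet> un n \<bullet> x = un 1)"
  shows "finR (\<lambda>x. \<exists>n\<le>k. X \<bullet> un n \<bullet> x = un 1)"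
proof -
  have "hol S [un n, X] (finite_set (elem (var 0 \<cdot> var (Suc 0)))) \<longleftrightarrow> finR (\<lambda>x. X \<bullet> un n \<bullet> x = un 1)" for n
    by (rule hol_finite_set) (simp add: elem_def sem)
  moreover have "hol S [un k, X] (finite_set (\<lambda>x. \<^bold>\<exists>n\<^bold>:T0. n \<^bold>\<le> var (Suc 0) \<^bold>\<and> elem (var 0 \<cdot> n) x))
      \<longleftrightarrow> finR (\<lambda>x. \<exists>n\<le>k. X \<bullet> un n \<bullet> x = un 1)" for k
    by (rule hol_finite_set) (simp add: elem_def sem)
  ultimately show ?thesis
    using hol_FIN_union assms by (simp add: FIN_union_def sem hol_is_set)
qed

lemma FIN_enum_sem:
  assumes "X \<in> D T2" "setR X" "finR (\<lambda>x. X \<bullet> x = un 1)"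
  obtains w m where "w \<in> D (T0 \<Rrightarrow> T1)" "\<And>i. i < m \<Longrightarrow> w \<bullet> un i \<in> RR"
    "\<And>x. x \<in> RR \<Longrightarrow> X \<bullet> x = un 1 \<Longrightarrow> \<exists>i<m. eqR x (w \<bullet> un i)"
proof -
  have "hol S [X] (finite_set (elem (var 0))) \<longleftrightarrow> finR (\<lambda>x. X \<bullet> x = un 1)"
    by (rule hol_finite_set) (simp add: elem_def sem)
  then have "\<exists>w\<in>D (T0 \<Rrightarrow> T1). \<exists>m. (\<forall>i<m. w \<bullet> un i \<in> RR) \<and>
      (\<forall>x\<in>RR. X \<bullet> x = un 1 \<longrightarrow> (\<exists>i<m. eqR x (w \<bullet> un i)))"
    using hol_FIN_enum assms by (simp add: FIN_enum_def sem hol_is_set elem_def)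
  with that show thesis by blast
qed

definition ninR :: bool where
  "ninR \<longleftrightarrow> \<not> (\<exists>H\<in>D T2. (\<forall>x\<in>RR. \<forall>y\<in>RR. eqR x y \<longrightarrow> H \<bullet> x = H \<bullet> y) \<and>
     (\<forall>n. finR (\<lambda>x. x \<in> UI \<and> nm (H \<bullet> x) < n)))"

lemma hol_NIN_alt: "hol S [] NIN_alt \<longleftrightarrow> ninR"
proof -
  have "hol S [un n, H] (finite_set (\<lambda>x. Unit x \<^bold>\<and> var 0 \<cdot> x \<^bold>< var (Suc 0))) \<longleftrightarrow> finR (\<lambda>x. x \<in> UI \<and> nm (H \<bullet> x) < n)"
    if "H \<in> D T2" for n H
    by (rule hol_finite_set) (simp add: sem that)
  then show ?thesis
    by (simp add: NIN_alt_def height_countable_def sem ninR_def)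
qed

definition unitR :: "'u \<Rightarrow> bool" where
  "unitR f \<longleftrightarrow> (\<forall>x\<in>UI. f \<bullet> x \<in> RR) \<and> (\<forall>x\<in>UI. \<forall>y\<in>UI. eqR x y \<longrightarrow> eqR (f \<bullet> x) (f \<bullet> y))"

lemma hol_unit_fun: "stab S e f \<Longrightarrow> den S e f \<in> D (T1 \<Rrightarrow> T1) \<Longrightarrow> hol S e (unit_fun f) \<longleftrightarrow> unitR (den S e f)"
  by (simp add: unit_fun_def sem unitR_def)

definition contR :: "'u \<Rightarrow> 'u \<Rightarrow> bool" where
  "contR f x \<longleftrightarrow> (\<forall>\<epsilon>\<in>PR. \<exists>\<delta>\<in>PR. \<forall>y\<in>UI. dlR x y \<delta> \<longrightarrow> dlR (f \<bullet> x) (f \<bullet> y) \<epsilon>)"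

lemma hol_continuous_at:
  "stab S e f \<Longrightarrow> den S e f \<in> D (T1 \<Rrightarrow> T1) \<Longrightarrow> stab S e x \<Longrightarrow> den S e x \<in> D T1 \<Longrightarrow>
   hol S e (continuous_at f x) \<longleftrightarrow> contR (den S e f) (den S e x)"
  by (simp add: continuous_at_def sem contR_def)

definition rlimR :: "'u \<Rightarrow> 'u \<Rightarrow> 'u \<Rightarrow> bool" where
  "rlimR f x l \<longleftrightarrow> (\<forall>\<epsilon>\<in>PR. \<exists>\<delta>\<in>PR. \<forall>y\<in>UI. ltR x y \<and> dlR x y \<delta> \<longrightarrow> dlR (f \<bullet> y) l \<epsilon>)"
definition llimR :: "'u \<Rightarrow> 'u \<Rightarrow> 'u \<Rightarrow> bool" where
  "llimR f x l \<longleftrightarrow> (\<forall>\<epsilon>\<in>PR. \<exists>\<delta>\<in>PR. \<forall>y\<in>UI. ltR y x \<and> dlR x y \<delta> \<longrightarrow> dlR (f \<bullet> y) l \<epsilon>)"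
definition regR :: "'u \<Rightarrow> bool" where
  "regR f \<longleftrightarrow> (\<forall>x\<in>UI. (ltR x oneR \<longrightarrow> (\<exists>l\<in>RR. rlimR f x l)) \<and> (ltR zeroR x \<longrightarrow> (\<exists>l\<in>RR. llimR f x l)))"

lemma hol_regulated: "stab S e f \<Longrightarrow> den S e f \<in> D (T1 \<Rrightarrow> T1) \<Longrightarrow> hol S e (regulated f) \<longleftrightarrow> regR (den S e f)"
  by (simp add: regulated_def right_limit_def left_limit_def sem regR_def rlimR_def llimR_def)

definition supR :: "'u \<Rightarrow> 'u \<Rightarrow> 'u \<Rightarrow> 'u \<Rightarrow> bool" where
  "supR f a b s \<longleftrightarrow> (\<forall>x\<in>IV a b. \<not> ltR s (f \<bullet> x)) \<and> (\<forall>t\<in>RR. (\<forall>x\<in>IV a b. \<not> ltR t (f \<bullet> x)) \<longrightarrow> \<not> ltR t s)"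
definition supfR :: "'u \<Rightarrow> bool" where
  "supfR f \<longleftrightarrow> (\<exists>F\<in>D (T0 \<Rrightarrow> T0 \<Rrightarrow> T1).
     (\<forall>p q. isc p \<and> isc q \<longrightarrow> F \<bullet> un p \<bullet> un q \<in> RR \<and>
       (\<forall>p' q'. isc p' \<and> isc q' \<and> eqR (kst p) (kst p') \<and> eqR (kst q) (kst q') \<longrightarrow>
          eqR (F \<bullet> un p \<bullet> un q) (F \<bullet> un p' \<bullet> un q'))) \<and>
     (\<forall>p q. isc p \<and> isc q \<and> kst p \<in> UI \<and> kst q \<in> UI \<and> \<not> ltR (kst q) (kst p) \<longrightarrow>
        supR f (kst p) (kst q) (F \<bullet> un p \<bullet> un q)))"

lemma hol_sup: "stab S e f \<Longrightarrow> den S e f \<in> D (T1 \<Rrightarrow> T1) \<Longrightarrow> hol S e (has_supremum_functional f) \<longleftrightarrow> supfR (den S e f)"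
  using IV_in by (simp add: has_supremum_functional_def supremum_functional_def rat_fun2_def is_supremum_def sem supfR_def supR_def)

definition lscR :: "'u \<Rightarrow> bool" where
  "lscR f \<longleftrightarrow> (\<forall>x\<in>UI. \<forall>a\<in>RR. ltR a (f \<bullet> x) \<longrightarrow>
     (\<exists>\<delta>\<in>PR. \<forall>y\<in>UI. \<not> eqR y x \<and> dlR x y \<delta> \<longrightarrow> \<not> ltR (f \<bullet> y) a))"

lemma hol_lsc: "stab S e f \<Longrightarrow> den S e f \<in> D (T1 \<Rrightarrow> T1) \<Longrightarrow> hol S e (lower_semicontinuous f) \<longleftrightarrow> lscR (den S e f)"
  by (simp add: lower_semicontinuous_def sem lscR_def)

definition symR :: "'u \<Rightarrow> bool" where
  "symR f \<longleftrightarrow> (\<forall>x\<in>UI. \<forall>\<epsilon>\<in>PR. \<exists>\<delta>\<in>PR. \<forall>z\<in>RR. \<forall>u\<in>UI. \<forall>v\<in>UI.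
     dlR z zeroR \<delta> \<and> smR x z u \<and> smR v z x \<longrightarrow> dlR (f \<bullet> u) (f \<bullet> v) \<epsilon>)"

lemma hol_symm: "stab S e f \<Longrightarrow> den S e f \<in> D (T1 \<Rrightarrow> T1) \<Longrightarrow> hol S e (symmetrically_continuous f) \<longleftrightarrow> symR (den S e f)"
  by (simp add: symmetrically_continuous_def sem symR_def)

lemma hol_cont_point:
  "hol S [] cont_point_sup \<longleftrightarrow> (\<forall>f\<in>D (T1 \<Rrightarrow> T1). unitR f \<and> regR f \<and> supfR f \<longrightarrow> (\<exists>x\<in>UI. contR f x))"
  "hol S [] cont_point_lsc_sup \<longleftrightarrow> (\<forall>f\<in>D (T1 \<Rrightarrow> T1). unitR f \<and> regR f \<and> lscR f \<and> supfR f \<longrightarrow> (\<exists>x\<in>UI. contR f x))"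
  "hol S [] cont_point_symm \<longleftrightarrow> (\<forall>f\<in>D (T1 \<Rrightarrow> T1). unitR f \<and> regR f \<and> symR f \<longrightarrow> (\<exists>x\<in>UI. contR f x))"
  by (simp_all add: cont_point_sup_def cont_point_lsc_sup_def cont_point_symm_def sem hol_unit_fun hol_regulated
      hol_sup hol_lsc hol_symm hol_continuous_at)


section \<open>Continuity in terms of rational bounds\<close>

lemma PR_rational:
  assumes "0 < r"
  shows "\<exists>z\<in>PR. \<forall>x\<in>RR. \<forall>y\<in>RR. dlR x y z \<longleftrightarrow> dl x y r"
proof -
  obtain k where k: "isc k" "rt k = r" using ex_kst by blast
  have "kst k \<in> PR" using assms k kst_pos[of k] by (simp add: PR_def del: PR_in)
  moreover have "\<forall>x\<in>RR. \<forall>y\<in>RR. dlR x y (kst k) \<longleftrightarrow> dl x y r" using dlR_kst k by simp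
  ultimately show ?thesis by blast
qed

lemma PR_lower: "z \<in> PR \<Longrightarrow> \<exists>r>0. \<forall>x\<in>RR. \<forall>y\<in>RR. dl x y r \<longrightarrow> dlR x y z"
proof -
  assume "z \<in> PR"
  then have "z \<in> RR" "ltR zeroR z" by (auto simp: PR_def simp del: PR_in)
  then show ?thesis by (rule PosReal_lower) blast
qed

text \<open>A positive real has a positive rational below it, and a positive rational is a constant
  real, so both tolerances may be taken rational. The general form covers continuity and, by
  restricting the set \<open>A\<close>, both one-sided limits.\<close>

lemma eps_delta_iff:
  assumes "\<And>y. y \<in> A \<Longrightarrow> a y \<in> RR \<and> b y \<in> RR \<and> p y \<in> RR \<and> q y \<in> RR"
  shows "(\<forall>\<epsilon>\<in>PR. \<exists>\<delta>\<in>PR. \<forall>y\<in>A. dlR (a y) (b y) \<delta> \<longrightarrow> dlR (p y) (q y) \<epsilon>) \<longleftrightarrow>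
    (\<forall>r>0. \<exists>d>0. \<forall>y\<in>A. dl (a y) (b y) d \<longrightarrow> dl (p y) (q y) r)" (is "?L \<longleftrightarrow> ?R")
proof
  assume ?L
  show ?R
  proof (intro allI impI)
    fix r :: "'n zz fract" assume "0 < r"
    then obtain z where z: "z \<in> PR" "\<forall>x\<in>RR. \<forall>y\<in>RR. dlR x y z \<longleftrightarrow> dl x y r"
      using PR_rational by blast
    with \<open>?L\<close> obtain \<delta> where d: "\<delta> \<in> PR" "\<forall>y\<in>A. dlR (a y) (b y) \<delta> \<longrightarrow> dlR (p y) (q y) z" by blast
    obtain d where d': "0 < d" "\<forall>x\<in>RR. \<forall>y\<in>RR. dl x y d \<longrightarrow> dlR x y \<delta>"
      using PR_lower[OF d(1)] by blast
    have "dl (p y) (q y) r" if y: "y \<in> A" "dl (a y) (b y) d" for y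
      using d'(2) d(2) z(2) assms[OF y(1)] y by blast
    with d'(1) show "\<exists>d>0. \<forall>y\<in>A. dl (a y) (b y) d \<longrightarrow> dl (p y) (q y) r" by blast
  qed
next
  assume ?R
  show ?L
  proof
    fix \<epsilon> assume "\<epsilon> \<in> PR"
    then obtain r where r: "0 < r" "\<forall>x\<in>RR. \<forall>y\<in>RR. dl x y r \<longrightarrow> dlR x y \<epsilon>"
      using PR_lower by blast
    with \<open>?R\<close> obtain d where d: "0 < d" "\<forall>y\<in>A. dl (a y) (b y) d \<longrightarrow> dl (p y) (q y) r" by blast
    obtain z where z: "z \<in> PR" "\<forall>x\<in>RR. \<forall>y\<in>RR. dlR x y z \<longleftrightarrow> dl x y d"
      using PR_rational[OF d(1)] by blast
    have "dlR (p y) (q y) \<epsilon>" if y: "y \<in> A" "dlR (a y) (b y) z" for y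
      using z(2) d(2) r(2) assms[OF y(1)] y by blast
    with z(1) show "\<exists>\<delta>\<in>PR. \<forall>y\<in>A. dlR (a y) (b y) \<delta> \<longrightarrow> dlR (p y) (q y) \<epsilon>" by blast
  qed
qed

lemma UI_iff: "x \<in> UI \<longleftrightarrow> x \<in> RR \<and> \<not> lt x zeroR \<and> \<not> lt oneR x"
  by (auto simp: IV_def ltR_iff simp del: UI_in)

lemma unitR_in [simp]: "unitR f \<Longrightarrow> x \<in> UI \<Longrightarrow> f \<bullet> x \<in> RR"
  by (simp add: unitR_def)

lemma contR_iff:
  "unitR f \<Longrightarrow> x \<in> UI \<Longrightarrow> contR f x \<longleftrightarrow> (\<forall>r>0. \<exists>d>0. \<forall>y\<in>UI. dl x y d \<longrightarrow> dl (f \<bullet> x) (f \<bullet> y) r)"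
  unfolding contR_def by (rule eps_delta_iff) simp

lemma rlimR_iff: "unitR f \<Longrightarrow> x \<in> UI \<Longrightarrow> l \<in> RR \<Longrightarrow> rlimR f x l \<longleftrightarrow>
    (\<forall>r>0. \<exists>d>0. \<forall>y\<in>UI. lt x y \<and> dl x y d \<longrightarrow> dl (f \<bullet> y) l r)"
proof -
  assume *: "unitR f" "x \<in> UI" "l \<in> RR"
  have "(\<forall>\<epsilon>\<in>PR. \<exists>\<delta>\<in>PR. \<forall>y\<in>{y \<in> UI. lt x y}. dlR x y \<delta> \<longrightarrow> dlR (f \<bullet> y) l \<epsilon>) \<longleftrightarrow>
    (\<forall>r>0. \<exists>d>0. \<forall>y\<in>{y \<in> UI. lt x y}. dl x y d \<longrightarrow> dl (f \<bullet> y) l r)"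
    by (rule eps_delta_iff) (use * in auto)
  moreover have "(\<forall>y\<in>{y \<in> UI. lt x y}. C y \<longrightarrow> E y) \<longleftrightarrow> (\<forall>y\<in>UI. lt x y \<and> C y \<longrightarrow> E y)" for C E by blast
  ultimately have "(\<forall>\<epsilon>\<in>PR. \<exists>\<delta>\<in>PR. \<forall>y\<in>UI. lt x y \<and> dlR x y \<delta> \<longrightarrow> dlR (f \<bullet> y) l \<epsilon>) \<longleftrightarrow>
    (\<forall>r>0. \<exists>d>0. \<forall>y\<in>UI. lt x y \<and> dl x y d \<longrightarrow> dl (f \<bullet> y) l r)" by (simp only:)
  then show ?thesis using * by (simp add: rlimR_def ltR_iff)
qed

lemma llimR_iff: "unitR f \<Longrightarrow> x \<in> UI \<Longrightarrow> l \<in> RR \<Longrightarrow> llimR f x l \<longleftrightarrow>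
    (\<forall>r>0. \<exists>d>0. \<forall>y\<in>UI. lt y x \<and> dl x y d \<longrightarrow> dl (f \<bullet> y) l r)"
proof -
  assume *: "unitR f" "x \<in> UI" "l \<in> RR"
  have "(\<forall>\<epsilon>\<in>PR. \<exists>\<delta>\<in>PR. \<forall>y\<in>{y \<in> UI. lt y x}. dlR x y \<delta> \<longrightarrow> dlR (f \<bullet> y) l \<epsilon>) \<longleftrightarrow>
    (\<forall>r>0. \<exists>d>0. \<forall>y\<in>{y \<in> UI. lt y x}. dl x y d \<longrightarrow> dl (f \<bullet> y) l r)"
    by (rule eps_delta_iff) (use * in auto)
  moreover have "(\<forall>y\<in>{y \<in> UI. lt y x}. C y \<longrightarrow> E y) \<longleftrightarrow> (\<forall>y\<in>UI. lt y x \<and> C y \<longrightarrow> E y)" for C E by blast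
  ultimately have "(\<forall>\<epsilon>\<in>PR. \<exists>\<delta>\<in>PR. \<forall>y\<in>UI. lt y x \<and> dlR x y \<delta> \<longrightarrow> dlR (f \<bullet> y) l \<epsilon>) \<longleftrightarrow>
    (\<forall>r>0. \<exists>d>0. \<forall>y\<in>UI. lt y x \<and> dl x y d \<longrightarrow> dl (f \<bullet> y) l r)" by (simp only:)
  then show ?thesis using * by (simp add: llimR_def ltR_iff)
qed

lemma dl_open:
  assumes "dl x y r"
  obtains d where "0 < d" "\<And>y'. dl y y' d \<Longrightarrow> dl x y' r"
proof -
  obtain d where d: "0 < d" "ev (\<lambda>n. \<bar>sq x n - sq y n\<bar> + d < r)" using assms by (auto simp: dl_def)
  have "dl x y' r" if y': "dl y y' d" for y'
  proof -
    obtain d' where d': "0 < d'" "ev (\<lambda>n. \<bar>sq y n - sq y' n\<bar> + d' < d)" using y' by (auto simp: dl_def)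
    have "ev (\<lambda>n. \<bar>sq x n - sq y' n\<bar> + d' < r)" by (rule ev_mp2[OF d(2) d'(2)]) linarith
    with d'(1) show ?thesis by (auto simp: dl_def)
  qed
  with d(1) that show thesis by blast
qed

lemma lt_le_trans: "x \<in> RR \<Longrightarrow> y \<in> RR \<Longrightarrow> z \<in> RR \<Longrightarrow> lt x y \<Longrightarrow> \<not> lt z y \<Longrightarrow> lt x z"
  using not_eqR[of y z] lt_trans[of x y z] lt_cong(2)[of y z x] by blast

lemma le_lt_trans: "x \<in> RR \<Longrightarrow> y \<in> RR \<Longrightarrow> z \<in> RR \<Longrightarrow> \<not> lt y x \<Longrightarrow> lt y z \<Longrightarrow> lt x z"
  using not_eqR[of x y] lt_trans[of x y z] lt_cong(1)[of x y z] by blast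

lemma not_lt_ev: "x \<in> RR \<Longrightarrow> y \<in> RR \<Longrightarrow> \<not> lt x y \<Longrightarrow> 0 < d \<Longrightarrow> ev (\<lambda>n. sq y n < sq x n + d)"
proof -
  assume xy: "x \<in> RR" "y \<in> RR" "\<not> lt x y" "0 < d"
  show ?thesis
  proof (cases "eqR x y")
    case True
    then obtain d' where "0 < d'" "ev (\<lambda>n. \<bar>sq x n - sq y n\<bar> + d' < d)"
      using eqR_dl[OF xy(1,2) _ xy(4)] by (auto simp: dl_def)
    then show ?thesis by (elim ev_mp) linarith
  next
    case False
    then obtain d' where "0 < d'" "ev (\<lambda>n. sq y n + d' < sq x n)" using not_eqR xy by (auto simp: lt_def)
    then show ?thesis using xy(4) by (elim ev_mp) linarith
  qed
qed

lemma lt_between_left: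
  assumes x: "x \<in> RR" and y: "y \<in> RR" and "lt y x" "0 < r"
  obtains k where "isc k" "lt y (kst k)" "lt (kst k) x" "dl x (kst k) r"
proof -
  obtain d where d: "0 < d" "ev (\<lambda>n. sq y n + d < sq x n)" using assms by (auto simp: lt_def)
  define s where "s = min d r / 4"
  have s: "0 < s" "4 * s \<le> d" "4 * s \<le> r" using d(1) assms(4) by (auto simp: s_def)
  obtain n where n: "hh n < s" using hh_small[OF s(1)] by blast
  obtain k where k: "isc k" "rt k = sq x n - 2 * s" using ex_kst by blast
  have k': "sq (kst k) j = sq x n - s - s" for j by (simp add: k)
  have e: "ev (\<lambda>k. \<bar>sq x n - sq x k\<bar> < s)" by (rule ev_mp[OF ev_cauchy[OF x, of n]]) (use n in linarith)
  have "ev (\<lambda>j. sq (kst k) j + s < sq x j)" unfolding k' by (rule ev_mp[OF e]) linarith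
  moreover have "ev (\<lambda>j. sq y j + s < sq (kst k) j)"
    unfolding k' by (rule ev_mp2[OF e d(2)]) (use s in linarith)
  moreover have "ev (\<lambda>j. \<bar>sq x j - sq (kst k) j\<bar> + s < r)"
    unfolding k' by (rule ev_mp[OF e]) (use s in linarith)
  ultimately show thesis using that[OF k(1)] s(1) by (auto simp: lt_def dl_def)
qed

text \<open>Only the strict bound on the right leaves a positive margin; the weak bound on the left
  is met up to any s, which is chosen small against that margin.\<close>

lemma dl_cell:
  assumes x: "x \<in> RR" and a: "isc a" and "\<not> lt x (kst a)" "lt x (kst b)" "rt b = rt a + h" "0 < h"
  shows "dl x (kst a) h"
proof -
  obtain d where d: "0 < d" "ev (\<lambda>n. sq x n + d < rt b)" using assms(4) by (auto simp: lt_def)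
  define s where "s = min d h / 4"
  have s: "0 < s" "4 * s \<le> d" "4 * s \<le> h" using d(1) assms(6) by (auto simp: s_def)
  have "ev (\<lambda>n. rt a < sq x n + s)" using not_lt_ev[OF x _ assms(3) s(1)] a by simp
  then have "ev (\<lambda>n. \<bar>sq x n - sq (kst a) n\<bar> + s < h)"
  proof (rule ev_mp2[OF _ d(2)])
    fix n assume *: "rt a < sq x n + s" "sq x n + d < rt b"
    then have "sq x n + d < rt a + h" by (simp add: assms(5))
    with * s have "\<bar>sq x n - rt a\<bar> + s < h" by linarith
    then show "\<bar>sq x n - sq (kst a) n\<bar> + s < h" by simp
  qed
  with s(1) show ?thesis by (auto simp: dl_def)
qed

text \<open>Both one-sided limits in Cauchy form and with one radius: two points on the same side of
  x have values close to the same limit. At an endpoint the side without a limit contains no points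
  of the interval.\<close>

lemma one_sided:
  assumes f: "unitR f" "regR f" and x: "x \<in> UI" and s: "0 < s"
  obtains d where "0 < d"
    "\<And>y y'. y \<in> UI \<Longrightarrow> y' \<in> UI \<Longrightarrow> lt x y \<and> lt x y' \<or> lt y x \<and> lt y' x \<Longrightarrow> dl x y d \<Longrightarrow> dl x y' d \<Longrightarrow>
       dl (f \<bullet> y) (f \<bullet> y') s"
proof -
  have s2: "0 < s / 2" "s / 2 + s / 2 = s" using s by simp_all
  have "\<exists>d>0. \<exists>l. \<forall>y\<in>UI. lt x y \<and> dl x y d \<longrightarrow> dl (f \<bullet> y) l (s / 2)"
  proof (cases "lt x oneR")
    case True
    then obtain l where "l \<in> RR" "rlimR f x l" using f(2) x by (auto simp: regR_def ltR_iff)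
    then show ?thesis using f(1) x s2(1) rlimR_iff by blast
  next
    case False
    then have "\<not> lt x y" if "y \<in> UI" for y using that x lt_le_trans[of x y oneR] by (auto simp: UI_iff simp del: UI_in)
    then show ?thesis by (intro exI[of _ 1]) auto
  qed
  then obtain d1 l1 where 1: "0 < d1" "\<And>y. y \<in> UI \<Longrightarrow> lt x y \<Longrightarrow> dl x y d1 \<Longrightarrow> dl (f \<bullet> y) l1 (s / 2)" by blast
  have "\<exists>d>0. \<exists>l. \<forall>y\<in>UI. lt y x \<and> dl x y d \<longrightarrow> dl (f \<bullet> y) l (s / 2)"
  proof (cases "lt zeroR x")
    case True
    then obtain l where "l \<in> RR" "llimR f x l" using f(2) x by (auto simp: regR_def ltR_iff)
    then show ?thesis using f(1) x s2(1) llimR_iff by blast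
  next
    case False
    then have "\<not> lt y x" if "y \<in> UI" for y using that x le_lt_trans[of zeroR y x] by (auto simp: UI_iff simp del: UI_in)
    then show ?thesis by (intro exI[of _ 1]) auto
  qed
  then obtain d2 l2 where 2: "0 < d2" "\<And>y. y \<in> UI \<Longrightarrow> lt y x \<Longrightarrow> dl x y d2 \<Longrightarrow> dl (f \<bullet> y) l2 (s / 2)" by blast
  show thesis
  proof (rule that[of "min d1 d2"])
    fix y y' assume y: "y \<in> UI" "y' \<in> UI" "lt x y \<and> lt x y' \<or> lt y x \<and> lt y' x"
      "dl x y (min d1 d2)" "dl x y' (min d1 d2)"
    then have "dl x y d1" "dl x y d2" "dl x y' d1" "dl x y' d2" using dl_mono by (meson min.cobounded1 min.cobounded2)+
    then have "\<exists>l. dl (f \<bullet> y) l (s / 2) \<and> dl (f \<bullet> y') l (s / 2)" using y 1(2) 2(2) by blast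
    then show "dl (f \<bullet> y) (f \<bullet> y') s" using dl_trans[of "f \<bullet> y" _ "s / 2" "f \<bullet> y'" "s / 2"] dl_sym s2(2) by metis
  qed (use 1 2 in simp)
qed

section \<open>Points of large oscillation\<close>

text \<open>The value at x is compared with values at rational points arbitrarily close to x. The
  quantifiers thus range over precisions and codes, and with \<open>dlh\<close> for the distances
  the relation is definable from f.\<close>

definition osc :: "'u \<Rightarrow> 'n \<Rightarrow> 'u \<Rightarrow> bool" where
  "osc f n x \<longleftrightarrow> x \<in> UI \<and>
     (\<forall>k. \<exists>q. isc q \<and> kst q \<in> UI \<and> dlh x (kst q) k \<and> \<not> dlh (f \<bullet> x) (f \<bullet> kst q) n)"

lemma dp_osc [dfn_intros]: "f \<in> D (T1 \<Rrightarrow> T1) \<Longrightarrow> dn \<Gamma> N \<Longrightarrow> dfn \<Gamma> T1 X \<Longrightarrow> dp \<Gamma> (\<lambda>e. osc f (N e) (X e))"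
proof -
  assume f: "f \<in> D (T1 \<Rrightarrow> T1)" and NX: "dn \<Gamma> N" "dfn \<Gamma> T1 X"
  have "dp [T0, T1, T1] (\<lambda>e. osc f (nm (hd e)) (hd (tl e)))"
    unfolding osc_def by (intro dfn_intros f) simp_all
  from dp_subst21[of "\<lambda>_ x n. osc f n x", OF this NX(2,2,1)] show ?thesis .
qed

lemma UI_cong: "x \<in> UI \<Longrightarrow> y \<in> RR \<Longrightarrow> eqR x y \<Longrightarrow> y \<in> UI"
  using lt_cong(1)[of x y zeroR] lt_cong(2)[of x y oneR] by (auto simp: UI_iff simp del: UI_in)

lemma osc_iff: "unitR f \<Longrightarrow> osc f n x \<longleftrightarrow> x \<in> UI \<and>
     (\<forall>k. \<exists>q. isc q \<and> kst q \<in> UI \<and> dl x (kst q) (hh k) \<and> \<not> dl (f \<bullet> x) (f \<bullet> kst q) (hh n))"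
proof -
  assume f: "unitR f"
  have "dlh x (kst q) k \<longleftrightarrow> dl x (kst q) (hh k)" "dlh (f \<bullet> x) (f \<bullet> kst q) n \<longleftrightarrow> dl (f \<bullet> x) (f \<bullet> kst q) (hh n)"
    if "x \<in> UI" "kst q \<in> UI" for q k
    using dlh_iff[OF UI_in(2) UI_in(2)] dlh_iff[OF unitR_in unitR_in] that f by blast+
  then show ?thesis unfolding osc_def by blast
qed

lemma osc_cong: "unitR f \<Longrightarrow> x \<in> RR \<Longrightarrow> y \<in> RR \<Longrightarrow> eqR x y \<Longrightarrow> osc f n x \<longleftrightarrow> osc f n y"
proof -
  have *: "osc f n y" if "unitR f" "y \<in> RR" "eqR x y" "osc f n x" for x y
  proof -
    have x: "x \<in> UI" using that by (simp add: osc_def)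
    have y: "y \<in> UI" using UI_cong x that by blast
    have "eqR (f \<bullet> x) (f \<bullet> y)" using that x y by (simp add: unitR_def)
    then have "dl (f \<bullet> x) z r \<longleftrightarrow> dl (f \<bullet> y) z r" "dl x z r \<longleftrightarrow> dl y z r" for z r
      using dl_cong that x y by simp_all
    then show ?thesis using that y by (simp add: osc_iff)
  qed
  show "unitR f \<Longrightarrow> x \<in> RR \<Longrightarrow> y \<in> RR \<Longrightarrow> eqR x y \<Longrightarrow> osc f n x \<longleftrightarrow> osc f n y"
    using * eqR_sym by blast
qed

lemma osc_mono: "unitR f \<Longrightarrow> osc f m x \<Longrightarrow> m \<le> n \<Longrightarrow> osc f n x"
  unfolding osc_iff using dl_mono hh_mono by meson

lemma near_right:
  assumes "x \<in> UI" "b \<in> UI" "lt x b" "0 < d"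
  obtains q where "isc q" "kst q \<in> UI" "lt x (kst q)" "lt (kst q) b" "dl x (kst q) d"
proof -
  obtain q where q: "isc q" "lt x (kst q)" "lt (kst q) b" "dl x (kst q) d"
    using lt_between[OF _ _ assms(3,4)] assms(1,2) by (metis UI_in(2))
  then have "kst q \<in> UI" using assms le_lt_trans[of zeroR x "kst q"] lt_trans[of oneR "kst q" b] lt_trans[of x "kst q" zeroR]
    by (auto simp: UI_iff simp del: UI_in)
  with q that show thesis by blast
qed

lemma near_left:
  assumes "x \<in> UI" "b \<in> UI" "lt b x" "0 < d"
  obtains q where "isc q" "kst q \<in> UI" "lt (kst q) x" "dl x (kst q) d"
proof -
  obtain q where q: "isc q" "lt b (kst q)" "lt (kst q) x" "dl x (kst q) d"
    using lt_between_left[OF _ _ assms(3,4)] assms(1,2) by (metis UI_in(2))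
  then have "kst q \<in> UI" using assms lt_le_trans[of "kst q" x oneR] lt_trans[of oneR "kst q" x] lt_trans[of b "kst q" zeroR]
    by (auto simp: UI_iff simp del: UI_in)
  with q that show thesis by blast
qed

text \<open>Discontinuity gives points y near x whose values differ from that at x by r or more. A
  rational q on the same side of x as y has a value within r/2 of that at y, so f(q) keeps a
  distance of at least r/2, which exceeds \<open>hh n\<close>, from f(x).\<close>

lemma discontinuous_osc:
  assumes f: "unitR f" "regR f" and x: "x \<in> UI" and "\<not> contR f x"
  shows "\<exists>n. osc f n x"
proof -
  obtain r where r: "0 < r" "\<And>d. 0 < d \<Longrightarrow> \<exists>y\<in>UI. dl x y d \<and> \<not> dl (f \<bullet> x) (f \<bullet> y) r"
    using assms(4) contR_iff[OF f(1) x] by blast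
  have r2: "0 < r / 2" "r / 2 + r / 2 = r" using r(1) by simp_all
  obtain n where n: "hh n < r / 2" using hh_small[OF r2(1)] by blast
  obtain d where d: "0 < d" "\<And>y y'. y \<in> UI \<Longrightarrow> y' \<in> UI \<Longrightarrow> lt x y \<and> lt x y' \<or> lt y x \<and> lt y' x \<Longrightarrow> dl x y d \<Longrightarrow> dl x y' d \<Longrightarrow>
       dl (f \<bullet> y) (f \<bullet> y') (r / 2)"
    using one_sided[OF f x r2(1)] by blast
  have "\<exists>q. isc q \<and> kst q \<in> UI \<and> dl x (kst q) (hh k) \<and> \<not> dl (f \<bullet> x) (f \<bullet> kst q) (hh n)" for k
  proof -
    have dk: "0 < min d (hh k)" using d(1) by simp
    obtain y where y: "y \<in> UI" "dl x y (min d (hh k))" "\<not> dl (f \<bullet> x) (f \<bullet> y) r" using r(2)[OF dk] by blast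
    have "\<not> eqR x y" using y f(1) x r(1) eqR_dl[of "f \<bullet> x" "f \<bullet> y" r] by (auto simp: unitR_def)
    then have "lt x y \<or> lt y x" using not_eqR x y(1) by simp
    then obtain q where q: "isc q" "kst q \<in> UI" "lt x y \<and> lt x (kst q) \<or> lt y x \<and> lt (kst q) x" "dl x (kst q) (min d (hh k))"
    proof
      assume xy: "lt x y"
      show thesis by (rule near_right[OF x y(1) xy dk]) (use that xy in blast)
    next
      assume xy: "lt y x"
      show thesis by (rule near_left[OF x y(1) xy dk]) (use that xy in blast)
    qed
    have "dl (f \<bullet> y) (f \<bullet> kst q) (r / 2)"
      using d(2)[OF y(1) q(2) q(3)] dl_mono[OF y(2)] dl_mono[OF q(4)] by (meson min.cobounded1)
    then have "\<not> dl (f \<bullet> x) (f \<bullet> kst q) (hh n)"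
      using y(3) dl_trans[of "f \<bullet> x" "f \<bullet> kst q" "r / 2" "f \<bullet> y" "r / 2"] dl_mono[of "f \<bullet> x" "f \<bullet> kst q" "hh n" "r / 2"]
        dl_sym[of "f \<bullet> y"] n r2(2) by auto
    moreover have "dl x (kst q) (hh k)" using dl_mono[OF q(4)] by simp
    ultimately show ?thesis using q by blast
  qed
  then show ?thesis using x osc_iff[OF f(1)] by blast
qed

text \<open>Close to z and on one side of it, values differ by less than \<open>hh n\<close>. A
  point y there has a whole neighbourhood on the same side, so no rational near y can witness large
  oscillation at y.\<close>

lemma osc_isolated:
  assumes f: "unitR f" "regR f" and z: "z \<in> UI"
  obtains d where "0 < d" "\<And>y. y \<in> UI \<Longrightarrow> dl z y d \<Longrightarrow> \<not> eqR z y \<Longrightarrow> \<not> osc f n y"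
proof -
  obtain d where d: "0 < d" "\<And>y y'. y \<in> UI \<Longrightarrow> y' \<in> UI \<Longrightarrow> lt z y \<and> lt z y' \<or> lt y z \<and> lt y' z \<Longrightarrow> dl z y d \<Longrightarrow> dl z y' d \<Longrightarrow>
       dl (f \<bullet> y) (f \<bullet> y') (hh n)"
    using one_sided[OF f z, of "hh n"] by auto
  show thesis
  proof (rule that[OF d(1)])
    fix y assume y: "y \<in> UI" "dl z y d" "\<not> eqR z y"
    have "\<exists>r>0. \<forall>y'. dl y y' r \<longrightarrow> lt z y \<and> lt z y' \<or> lt y z \<and> lt y' z"
      using y z not_eqR[of z y] lt_open by (metis UI_in(2))
    then obtain r where r: "0 < r" "\<And>y'. dl y y' r \<Longrightarrow> lt z y \<and> lt z y' \<or> lt y z \<and> lt y' z" by blast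
    obtain s where s: "0 < s" "\<And>y'. dl y y' s \<Longrightarrow> dl z y' d" using dl_open[OF y(2)] by blast
    obtain k where k: "hh k < min r s" using hh_small[of "min r s"] r s by auto
    show "\<not> osc f n y"
    proof
      assume "osc f n y"
      then obtain q where q: "kst q \<in> UI" "dl y (kst q) (hh k)" "\<not> dl (f \<bullet> y) (f \<bullet> kst q) (hh n)"
        using osc_iff[OF f(1)] by blast
      have "dl y (kst q) r" "dl y (kst q) s" using dl_mono[OF q(2)] k by auto
      then show False using q d(2)[OF y(1) q(1) r(2) y(2) s(2)] by blast
    qed
  qed
qed


section \<open>Sequential compactness\<close>

lemma pw_neq_0 [simp]: "pw n \<noteq> 0"
  using pw_pos[of n] by (metis less_irrefl)

text \<open>Codes store a denominator diminished by one, so the code \<open>grid m a\<close> of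
  \<open>a * 2^-m\<close> needs the predecessor of \<open>2^m\<close>. Numbers have no subtraction,
  hence the search.\<close>

definition pm :: "'n \<Rightarrow> 'n" where "pm n = (LEAST p. p + 1 = pw n)"

lemma pm_Suc: "pm n + 1 = pw n"
proof -
  obtain p where "1 + p = pw n" using ds_le_add[OF ds_discrete[OF pw_pos]] by metis
  then have "p + 1 = pw n" by (simp add: add.commute)
  moreover then have "pm n = p" unfolding pm_def by (intro Least_equality) (auto simp flip: \<open>p + 1 = pw n\<close>)
  ultimately show ?thesis by simp
qed

lemma dn_pm [dfn_intros]: "dn \<Gamma> F \<Longrightarrow> dn \<Gamma> (\<lambda>e. pm (F e))"
proof (rule dn_subst0[of pm])
  show "dn [T0] (\<lambda>e. pm (nm (hd e)))"
    unfolding pm_def by (rule dn_Least) (intro dfn_intros, use pm_Suc in blast)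
qed

definition grid :: "'n \<Rightarrow> 'n \<Rightarrow> 'n" where "grid m a = code a 0 (pm m)"

lemma isc_grid [simp]: "isc (grid m a)"
  by (simp add: grid_def)

lemma rt_grid: "rt (grid m a) = rn a * hh m"
proof -
  have "rn (pm m) + 1 = rn (pw m)" by (simp flip: pm_Suc)
  then show ?thesis by (simp add: grid_def hh_def)
qed

lemma dn_grid [dfn_intros]: "dn \<Gamma> M \<Longrightarrow> dn \<Gamma> A \<Longrightarrow> dn \<Gamma> (\<lambda>e. grid (M e) (A e))"
  unfolding grid_def code_def pair_def by (intro dfn_intros)

lemma hh_pw [simp]: "rn (pw m) * hh m = 1"
  using pw_pos[of m] by (auto simp: hh_def simp del: pw_pos)

lemma UI_lt_grid: "x \<in> UI \<Longrightarrow> lt x (kst (grid m (pw m + 1)))"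
proof -
  assume x: "x \<in> UI"
  have "lt oneR (kst (grid m (pw m + 1)))"
    unfolding lt_def by (rule exI[of _ "hh m / 2"]) (simp add: rt_grid ev_def distrib_right)
  with x show ?thesis using le_lt_trans[of x oneR "kst (grid m (pw m + 1))"] by (simp add: UI_iff del: UI_in)
qed

lemma UI_not_lt_grid: "x \<in> UI \<Longrightarrow> \<not> lt x (kst (grid m 0))"
proof
  assume x: "x \<in> UI" and "lt x (kst (grid m 0))"
  then obtain d where "0 < d" "ev (\<lambda>n. sq x n + d < sq zeroR n)" by (auto simp: lt_def rt_grid)
  then have "lt x zeroR" unfolding lt_def by blast
  with x show False by (simp add: UI_iff del: UI_in)
qed

lemma not_lt_lt_kst: "x \<in> RR \<Longrightarrow> isc p \<Longrightarrow> isc q \<Longrightarrow> \<not> lt x (kst p) \<Longrightarrow> lt x (kst q) \<Longrightarrow> rt p < rt q"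
proof -
  assume "x \<in> RR" "isc p" "isc q" "\<not> lt x (kst p)" "lt x (kst q)"
  then have "lt (kst p) (kst q)" using le_lt_trans[of "kst p" x "kst q"] by simp
  then show "rt p < rt q" by (auto simp: lt_def ev_def intro: less_trans)
qed

lemma dl_grid: "x \<in> RR \<Longrightarrow> \<not> lt x (kst (grid m a)) \<Longrightarrow> lt x (kst (grid m (a + 1))) \<Longrightarrow> dl x (kst (grid m a)) (hh m)"
  by (rule dl_cell[OF _ isc_grid, where b = "grid m (a + 1)"]) (simp_all add: rt_grid distrib_right)

lemma pred_cases: "(a::'n) = 0 \<or> (\<exists>b. a = b + 1)"
  using ds_discrete[of a] ds_nonneg[of a] ds_le_add[of 1 a] by (metis add.commute le_less)

text \<open>The point found is the limit superior. For each m let \<open>A m\<close> be the least a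
  such that the sequence is eventually below \<open>(a + 1) * 2^-m\<close>; it then returns
  cofinally often to the cell starting at \<open>A m * 2^-m\<close>. All levels are obtained at once
  by minimization, so no nested intervals have to be built by recursion.\<close>

lemma cluster_point:
  assumes Z: "Z \<in> D (T0 \<Rrightarrow> T1)" "\<And>k. Z \<bullet> un k \<in> UI"
  obtains z where "z \<in> UI" "\<And>r K. 0 < r \<Longrightarrow> \<exists>k\<ge>K. dl z (Z \<bullet> un k) r"
proof -
  define P where "P m a \<longleftrightarrow> (\<exists>K. \<forall>k. K \<le> k \<longrightarrow> ltR (Z \<bullet> un k) (kst (grid m (a + 1))))" for m a
  define A where "A m = (LEAST a. P m a)" for m
  have Z': "Z \<bullet> un k \<in> RR" for k using Z(2) by (rule UI_in)
  have P_iff: "P m a \<longleftrightarrow> (\<exists>K. \<forall>k\<ge>K. lt (Z \<bullet> un k) (kst (grid m (a + 1))))" for m a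
    unfolding P_def using Z' by (simp add: ltR_iff)
  have dP: "dp [T0, T0] (\<lambda>e. P (nm (hd (tl e))) (nm (hd e)))"
    unfolding P_def by (intro dfn_intros Z(1))
  have Ppw: "P m (pw m)" for m unfolding P_iff using UI_lt_grid[OF Z(2)] by blast
  have dset: "dset (P m)" for m
    using dset_section[of "[T0]" "\<lambda>e. P (nm (hd e))" "[un m]"] dP by simp
  have PA: "P m (A m)" for m unfolding A_def by (rule internal_Least(1)[OF dset Ppw])
  have A_le: "A m \<le> pw m" for m unfolding A_def by (rule internal_Least(2)[OF dset Ppw])
  have A_least: "\<not> P m b" if "b < A m" for m b
    using internal_Least(2)[OF dset, of m b] that unfolding A_def by (auto simp: not_less[symmetric])
  have cof: "\<exists>k\<ge>K. \<not> lt (Z \<bullet> un k) (kst (grid m (A m)))" for m K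
  proof (cases "A m = 0")
    case True
    then show ?thesis using UI_not_lt_grid[OF Z(2)] by auto
  next
    case False
    then obtain b where b: "A m = b + 1" using pred_cases by blast
    then have "b < A m" using less_add_one_iff by simp
    from A_least[OF this] show ?thesis unfolding P_iff b by blast
  qed
  have cell: "\<exists>k\<ge>K. \<not> lt (Z \<bullet> un k) (kst (grid m (A m))) \<and> lt (Z \<bullet> un k) (kst (grid m' (A m' + 1)))" for K m m'
  proof -
    obtain K' where K': "\<forall>k\<ge>K'. lt (Z \<bullet> un k) (kst (grid m' (A m' + 1)))" using PA[of m'] unfolding P_iff by blast
    obtain k where "max K K' \<le> k" "\<not> lt (Z \<bullet> un k) (kst (grid m (A m)))" using cof by blast
    with K' show ?thesis by auto
  qed
  \<comment> \<open>One term of the sequence lies at or above the lower end of the cell at level m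
    and below the upper end of the cell at level m', which compares the two ends.\<close>
  have less: "rn (A m) * hh m < (rn (A m') + 1) * hh m'" for m m'
  proof -
    obtain k where "\<not> lt (Z \<bullet> un k) (kst (grid m (A m)))" "lt (Z \<bullet> un k) (kst (grid m' (A m' + 1)))"
      using cell[of 0 m m'] by blast
    then have "rt (grid m (A m)) < rt (grid m' (A m' + 1))" by (rule not_lt_lt_kst[OF Z' isc_grid isc_grid])
    then show ?thesis by (simp add: rt_grid)
  qed
  have "dn [T0] (\<lambda>e. grid (nm (hd e)) (A (nm (hd e))))"
    unfolding A_def
  proof (intro dn_grid dn_Least)
    show "dp (T0 # [T0]) (\<lambda>e. P (nm (hd (tl e))) (nm (hd e)))" by (rule dP)
    show "dn [T0] (\<lambda>e. nm (hd e))" by (intro dfn_intros)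
    show "\<exists>a. P (nm (hd e)) a" for e :: "'u list" using Ppw by blast
  qed
  from this[unfolded dn_def] obtain z where z: "z \<in> D T1" "\<And>v. v \<in> D T0 \<Longrightarrow> z \<bullet> v = un (grid (nm v) (A (nm v)))"
    by (rule dfn1E) simp
  have fz: "fn z m = grid m (A m)" for m by (simp add: fn_def z(2))
  have sz: "sq z m = rn (A m) * hh m" for m by (simp add: sq_def fz rt_grid)
  have "\<bar>sq z m - sq z (m + i)\<bar> < hh m" for m i
  proof -
    \<comment> \<open>In units of \<open>hh (m + i)\<close> both ends are integers, so discreteness
      turns the strict comparison into a weak one. Hence the approximations are nondecreasing, and
      the other comparison bounds their growth strictly by \<open>hh m\<close>.\<close>
    have h: "hh m = rn (pw i) * hh (m + i)" by (simp add: hh_def pw_add)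
    have "rn (A m) * rn (pw i) * hh (m + i) < (rn (A (m + i)) + 1) * hh (m + i)"
      using less[of m "m + i"] by (simp add: h mult.assoc)
    then have "rn (A m * pw i) < rn (A (m + i)) + 1" by (simp add: mult_less_cancel_right_pos)
    then have "A m * pw i \<le> A (m + i)" by (simp only: rn_less_Suc_iff)
    then have "rn (A m) * rn (pw i) \<le> rn (A (m + i))" by (metis rn_simps(4,6))
    then have "sq z m \<le> sq z (m + i)" unfolding sz h mult.assoc[symmetric] by (simp add: mult_right_mono less_imp_le)
    moreover have "sq z (m + i) < sq z m + hh m" using less[of "m + i" m] by (simp add: sz distrib_right)
    ultimately show ?thesis by simp
  qed
  then have zR: "z \<in> RR" unfolding RR_def using z(1) fz isc_grid by simp
  have zU: "z \<in> UI"
  proof -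
    have "0 \<le> sq z n" "sq z n \<le> 1" for n
    proof -
      show "0 \<le> sq z n" by (simp add: sz less_imp_le)
      have "rn (A n) * hh n \<le> rn (pw n) * hh n" using A_le[of n] by (intro mult_right_mono) (simp_all add: less_imp_le)
      then show "sq z n \<le> 1" by (simp add: sz)
    qed
    note * = this
    have "\<not> lt z zeroR"
    proof
      assume "lt z zeroR"
      then obtain d where "0 < d" "ev (\<lambda>n. sq z n + d < 0)" by (auto simp: lt_def)
      then obtain n where "sq z n + d < 0" using ev_ex by blast
      with *(1)[of n] \<open>0 < d\<close> show False by linarith
    qed
    moreover have "\<not> lt oneR z"
    proof
      assume "lt oneR z"
      then obtain d where "0 < d" "ev (\<lambda>n. 1 + d < sq z n)" by (auto simp: lt_def)
      then obtain n where "1 + d < sq z n" using ev_ex by blast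
      with *(2)[of n] \<open>0 < d\<close> show False by linarith
    qed
    ultimately show ?thesis using zR by (simp add: UI_iff del: UI_in)
  qed
  show thesis
  proof (rule that[OF zU])
    fix r :: "'n zz fract" and K assume r: "0 < r"
    then obtain m where m: "hh m < r / 2" using hh_small[of "r / 2"] by auto
    have m': "hh m < r - hh m" using m by (simp add: field_simps)
    obtain k where k: "K \<le> k" "\<not> lt (Z \<bullet> un k) (kst (grid m (A m)))" "lt (Z \<bullet> un k) (kst (grid m (A m + 1)))"
      using cell by blast
    have 1: "dl (Z \<bullet> un k) (kst (grid m (A m))) (hh m)" by (rule dl_grid[OF Z' k(2,3)])
    have "ev (\<lambda>n. \<bar>sq z n - sq (kst (grid m (A m))) n\<bar> + (r - hh m - hh m) < r - hh m)"
    proof (rule ev_mp[OF ev_cauchy[OF zR, of m]])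
      fix n assume "\<bar>sq z m - sq z n\<bar> < hh m"
      moreover have "sq (kst (grid m (A m))) n = sq z m" by (simp add: sz rt_grid)
      ultimately show "\<bar>sq z n - sq (kst (grid m (A m))) n\<bar> + (r - hh m - hh m) < r - hh m" by linarith
    qed
    then have "dl z (kst (grid m (A m))) (r - hh m)" unfolding dl_def using m' by (intro exI[of _ "r - hh m - hh m"]) simp
    then have "dl z (Z \<bullet> un k) (r - hh m + hh m)" using 1 dl_sym dl_trans by blast
    then show "\<exists>k\<ge>K. dl z (Z \<bullet> un k) r" using k(1) by auto
  qed
qed

subsection \<open>Pairs of type 1 objects\<close>

text \<open>The choice scheme yields one type 1 object for each number, whereas a pair of points has
  to be chosen. Two objects are merged by pairing their values pointwise, and E and F undo
  this.\<close>

lemma pairing_functionals: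
  obtains E F where "E \<in> D (T1 \<Rrightarrow> T1)" "F \<in> D (T1 \<Rrightarrow> T1)"
    "\<And>x y. x \<in> D T1 \<Longrightarrow> y \<in> D T1 \<Longrightarrow> \<exists>u\<in>D T1. E \<bullet> u = x \<and> F \<bullet> u = y"
proof -
  let ?a = "\<lambda>k. LEAST a. (\<exists>i j. k = pair i j) \<longrightarrow> (\<exists>b. k = pair a b)"
  let ?b = "\<lambda>k. LEAST b. (\<exists>i j. k = pair i j) \<longrightarrow> (\<exists>a. k = pair a b)"
  have ab: "?a (pair i j) = i" "?b (pair i j) = j" for i j
    by (rule Least_equality; auto simp: pair_inject)+
  have "dn [T0] (\<lambda>e. ?a (nm (hd e)))" by (rule dn_Least, unfold pair_def, intro dfn_intros, blast)
  then have 1: "dn [T0, T1] (\<lambda>e. ?a (fn (hd (tl e)) (nm (hd e))))" by (rule dn_subst0[of ?a]) (intro dfn_intros)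
  have "dn [T0] (\<lambda>e. ?b (nm (hd e)))" by (rule dn_Least, unfold pair_def, intro dfn_intros, blast)
  then have 2: "dn [T0, T1] (\<lambda>e. ?b (fn (hd (tl e)) (nm (hd e))))" by (rule dn_subst0[of ?b]) (intro dfn_intros)
  note * = 1[unfolded dn_def] 2[unfolded dn_def]
  obtain E where E: "E \<in> D (T1 \<Rrightarrow> T1)" "\<And>u v. u \<in> D T1 \<Longrightarrow> v \<in> D T0 \<Longrightarrow> E \<bullet> u \<bullet> v = un (?a (fn u (nm v)))"
    by (rule dfn2E[OF *(1)]) simp
  obtain F where F: "F \<in> D (T1 \<Rrightarrow> T1)" "\<And>u v. u \<in> D T1 \<Longrightarrow> v \<in> D T0 \<Longrightarrow> F \<bullet> u \<bullet> v = un (?b (fn u (nm v)))"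
    by (rule dfn2E[OF *(2)]) simp
  have "\<exists>u\<in>D T1. E \<bullet> u = x \<and> F \<bullet> u = y" if xy: "x \<in> D T1" "y \<in> D T1" for x y
  proof -
    have "dn [T0] (\<lambda>e. pair (fn x (nm (hd e))) (fn y (nm (hd e))))"
      unfolding pair_def by (intro dfn_intros xy)
    from this[unfolded dn_def] obtain u where u: "u \<in> D T1" "\<And>v. v \<in> D T0 \<Longrightarrow> u \<bullet> v = un (pair (fn x (nm v)) (fn y (nm v)))"
      by (rule dfn1E) simp
    have "fn u n = pair (fn x n) (fn y n)" for n by (simp add: fn_def[of u] u(2))
    then have "fn (E \<bullet> u) n = fn x n" "fn (F \<bullet> u) n = fn y n" for n
      using E(2)[OF u(1), of "un n"] F(2)[OF u(1), of "un n"] by (simp_all add: fn_def[of "E \<bullet> u"] fn_def[of "F \<bullet> u"] ab)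
    then have "E \<bullet> u = x" "F \<bullet> u = y" using E(1) F(1) u(1) xy by (auto intro!: fn_ext)
    with u(1) show ?thesis by blast
  qed
  with E(1) F(1) that show thesis by blast
qed

section \<open>From uncountability to points of continuity\<close>

lemma finR_mono: "finR P \<Longrightarrow> (\<And>x. x \<in> RR \<Longrightarrow> Q x \<Longrightarrow> P x) \<Longrightarrow> finR Q"
  unfolding finR_def by meson

text \<open>Take the least j with \<open>x < (j + 1) * 2^-m\<close>. The right endpoint 1 attains
  the extreme value j = \<open>pw m\<close>.\<close>

lemma grid_cell:
  assumes x: "x \<in> UI"
  shows "\<exists>j\<le>pw m. dl x (kst (grid m j)) (hh m)"
proof -
  have xR: "x \<in> RR" "x \<in> D T1" using x by simp_all
  let ?P = "\<lambda>j. ltR x (kst (grid m (j + 1)))"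
  have d: "dset ?P" by (intro dfn_intros xR)
  have "?P (pw m)" using UI_lt_grid[OF x, of m] xR by (simp add: ltR_iff)
  note L = internal_least[OF d this]
  obtain j where j: "?P j" "\<And>k. k < j \<Longrightarrow> \<not> ?P k" using L by blast
  have "j \<le> pw m" using j(2)[of "pw m"] \<open>?P (pw m)\<close> by (auto simp: not_less[symmetric])
  moreover have "\<not> lt x (kst (grid m j))"
  proof (cases "j = 0")
    case True
    then show ?thesis using UI_not_lt_grid[OF x] by simp
  next
    case False
    then obtain b where b: "j = b + 1" using pred_cases by blast
    then have "b < j" using less_add_one_iff by simp
    from j(2)[OF this] show ?thesis using xR b by (simp add: ltR_iff)
  qed
  ultimately show ?thesis using dl_grid[OF xR(1)] j(1) xR by (auto simp: ltR_iff)
qed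

text \<open>Suppose members closer than \<open>hh k\<close> are equal. The ball of radius
  \<open>hh (k + 1)\<close> about a grid point then has at most one member, so it is finite with
  bound 1, and \<open>FIN_union\<close> makes the whole set finite. It replaces a pigeonhole
  argument over a possibly nonstandard number of balls.\<close>

lemma osc_close_pair:
  assumes f: "f \<in> D (T1 \<Rrightarrow> T1)" "unitR f" and inf: "\<not> finR (osc f n)"
  shows "\<exists>x\<in>D T1. \<exists>y\<in>D T1. osc f n x \<and> osc f n y \<and> \<not> eqR x y \<and> dl x y (hh k)"
proof (rule ccontr)
  assume neg: "\<not> ?thesis"
  have *: "eqR x y" if "osc f n x" "osc f n y" "dl x y (hh k)" for x y
  proof -
    have "x \<in> D T1" "y \<in> D T1" using that by (simp_all add: osc_def)
    with neg that show ?thesis by blast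
  qed
  have "dp [T1, T0] (\<lambda>e. osc f n (hd e) \<and> dlh (hd e) (kst (grid (k + 1) (nm (hd (tl e))))) (k + 1))"
    by (intro dfn_intros f)
  from this[unfolded dp_def dn_def] obtain X where X: "X \<in> D (T0 \<Rrightarrow> T2)"
    "\<And>j x. j \<in> D T0 \<Longrightarrow> x \<in> D T1 \<Longrightarrow> X \<bullet> j \<bullet> x = un (if osc f n x \<and> dlh x (kst (grid (k + 1) (nm j))) (k + 1) then 1 else 0)"
    by (rule dfn2E) simp
  have Xiff: "X \<bullet> un j \<bullet> x = un 1 \<longleftrightarrow> osc f n x \<and> dl x (kst (grid (k + 1) j)) (hh (k + 1))" if "x \<in> RR" for j x
    using X(2)[of "un j" x] that by (simp add: dlh_iff)
  have X01: "X \<bullet> un j \<bullet> x = un 0 \<or> X \<bullet> un j \<bullet> x = un 1" if "x \<in> RR" for j x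
    using X(2)[of "un j" x] that by simp
  have "finR (\<lambda>x. \<exists>j\<le>pw (k + 1). X \<bullet> un j \<bullet> x = un 1)"
  proof (rule FIN_union_sem[OF X(1)])
    fix j
    show "setR (X \<bullet> un j)"
      unfolding setR_def
    proof (intro conjI ballI impI)
      show "X \<bullet> un j \<bullet> x = un 0 \<or> X \<bullet> un j \<bullet> x = un 1" if "x \<in> RR" for x by (rule X01[OF that])
      fix x y assume xy: "x \<in> RR" "y \<in> RR" "eqR x y"
      then have "X \<bullet> un j \<bullet> x = un 1 \<longleftrightarrow> X \<bullet> un j \<bullet> y = un 1"
        using osc_cong[OF f(2) xy] dl_cong[OF xy] by (simp add: Xiff)
      then show "X \<bullet> un j \<bullet> x = X \<bullet> un j \<bullet> y" using X01[of x j] X01[of y j] xy by auto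
    qed
    show "finR (\<lambda>x. X \<bullet> un j \<bullet> x = un 1)"
      unfolding finR_def
    proof (rule exI[of _ 1], intro ballI impI)
      fix w assume w: "(\<forall>i\<le>1. w \<bullet> un i \<in> RR) \<and> (\<forall>i j. i < j \<and> j \<le> 1 \<longrightarrow> \<not> eqR (w \<bullet> un i) (w \<bullet> un j))"
      then have w01: "w \<bullet> un 0 \<in> RR" "w \<bullet> un 1 \<in> RR" "\<not> eqR (w \<bullet> un 0) (w \<bullet> un 1)"
        using ds_zero_less_one ds_nonneg by auto
      show "\<exists>i\<le>1. X \<bullet> un j \<bullet> (w \<bullet> un i) \<noteq> un 1"
      proof (rule ccontr)
        assume "\<not> ?thesis"
        then have "X \<bullet> un j \<bullet> (w \<bullet> un 0) = un 1" "X \<bullet> un j \<bullet> (w \<bullet> un 1) = un 1" using ds_nonneg by auto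
        then have o: "osc f n (w \<bullet> un 0)" "osc f n (w \<bullet> un 1)" "dl (w \<bullet> un 0) (kst (grid (k + 1) j)) (hh (k + 1))"
          "dl (w \<bullet> un 1) (kst (grid (k + 1) j)) (hh (k + 1))" using w01 by (simp_all add: Xiff)
        have "dl (w \<bullet> un 0) (w \<bullet> un 1) (hh (k + 1) + hh (k + 1))"
          using dl_trans[OF o(3)] o(4) dl_sym by blast
        moreover have "hh (k + 1) + hh (k + 1) = hh k" by (simp add: hh_def pw_Suc)
        ultimately show False using * o(1,2) w01(3) by simp
      qed
    qed
  qed
  then have "finR (osc f n)"
  proof (rule finR_mono)
    fix x assume x: "x \<in> RR" "osc f n x"
    then have "x \<in> UI" by (simp add: osc_def)
    then show "\<exists>j\<le>pw (k + 1). X \<bullet> un j \<bullet> x = un 1" using grid_cell[of x "k + 1"] x by (simp add: Xiff)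
  qed
  with inf show False by blast
qed

text \<open>Once both members of a chosen pair are within the isolating radius of the cluster point
  z, each of them must equal z. The radius is split in half between the distance of the first member
  from z and the distance within the pair.\<close>

lemma finR_osc:
  assumes f: "f \<in> D (T1 \<Rrightarrow> T1)" "unitR f" "regR f"
  shows "finR (osc f n)"
proof (rule ccontr)
  assume inf: "\<not> ?thesis"
  obtain E F where EF: "E \<in> D (T1 \<Rrightarrow> T1)" "F \<in> D (T1 \<Rrightarrow> T1)"
    "\<And>x y. x \<in> D T1 \<Longrightarrow> y \<in> D T1 \<Longrightarrow> \<exists>u\<in>D T1. E \<bullet> u = x \<and> F \<bullet> u = y"
    using pairing_functionals by blast
  let ?B = "\<lambda>k u. osc f n (E \<bullet> u) \<and> osc f n (F \<bullet> u) \<and> \<not> eqR (E \<bullet> u) (F \<bullet> u) \<and> dlh (E \<bullet> u) (F \<bullet> u) k"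
  have "dp [T1, T0] (\<lambda>e. ?B (nm (hd (tl e))) (hd e))" by (intro dfn_intros f EF)
  from this[unfolded dp_def dn_def] obtain c where c: "c \<in> D (T0 \<Rrightarrow> T1 \<Rrightarrow> T0)"
    "\<And>j u. j \<in> D T0 \<Longrightarrow> u \<in> D T1 \<Longrightarrow> c \<bullet> j \<bullet> u = un (if ?B (nm j) u then 1 else 0)"
    by (rule dfn2E) simp
  have "\<exists>u\<in>D T1. c \<bullet> un k \<bullet> u = un 1" for k
  proof -
    obtain x y where xy: "x \<in> D T1" "y \<in> D T1" "osc f n x" "osc f n y" "\<not> eqR x y" "dl x y (hh k)"
      using osc_close_pair[OF f(1,2) inf] by blast
    obtain u where u: "u \<in> D T1" "E \<bullet> u = x" "F \<bullet> u = y" using EF(3)[OF xy(1,2)] by blast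
    have "x \<in> RR" "y \<in> RR" using xy(3,4) by (simp_all add: osc_def)
    then have "?B k u" using xy u by (simp add: dlh_iff)
    then show ?thesis using u(1) c(2)[of "un k" u] by auto
  qed
  then obtain Y where Y: "Y \<in> D (T0 \<Rrightarrow> T1)" "\<And>k. c \<bullet> un k \<bullet> (Y \<bullet> un k) = un 1" using choice_01[OF c(1)] by blast
  have B: "?B k (Y \<bullet> un k)" for k
  proof (rule ccontr)
    assume "\<not> ?thesis"
    then have "c \<bullet> un k \<bullet> (Y \<bullet> un k) = un 0" using c(2)[of "un k" "Y \<bullet> un k"] Y(1) by auto
    with Y(2)[of k] show False by simp
  qed
  have "dfn [T0] T1 (\<lambda>e. E \<bullet> (Y \<bullet> un (nm (hd e))))" by (intro dfn_intros EF Y)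
  then obtain Z where Z: "Z \<in> D (T0 \<Rrightarrow> T1)" "\<And>v. v \<in> D T0 \<Longrightarrow> Z \<bullet> v = E \<bullet> (Y \<bullet> un (nm v))"
    by (rule dfn1E) simp
  let ?x = "\<lambda>k. E \<bullet> (Y \<bullet> un k)" let ?y = "\<lambda>k. F \<bullet> (Y \<bullet> un k)"
  have U: "?x k \<in> UI" "?y k \<in> UI" for k using B[of k] by (simp_all add: osc_def)
  have "Z \<bullet> un k \<in> UI" for k using U(1) Z(2) by simp
  then obtain z where z: "z \<in> UI" "\<And>r K. 0 < r \<Longrightarrow> \<exists>k\<ge>K. dl z (Z \<bullet> un k) r"
    using cluster_point[OF Z(1)] by blast
  obtain d where d: "0 < d" "\<And>y. y \<in> UI \<Longrightarrow> dl z y d \<Longrightarrow> \<not> eqR z y \<Longrightarrow> \<not> osc f n y"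
    using osc_isolated[OF f(2,3) z(1)] by blast
  have d2: "0 < d / 2" "d / 2 + d / 2 = d" using d(1) by simp_all
  obtain K where K: "hh K < d / 2" using hh_small[OF d2(1)] by blast
  obtain k where k: "K \<le> k" "dl z (?x k) (d / 2)" using z(2)[OF d2(1)] Z(2) by auto
  have "dl (?x k) (?y k) (hh k)" using B[of k] U by (simp add: dlh_iff)
  then have "dl (?x k) (?y k) (d / 2)" using dl_mono hh_mono[OF k(1)] K by (meson le_less_trans less_imp_le)
  then have "dl z (?y k) d" using dl_trans[OF k(2)] d2(2) by metis
  moreover have "dl z (?x k) d" using dl_mono[OF k(2)] d(1) by simp
  ultimately have "eqR z (?x k)" "eqR z (?y k)" using d(2) U B[of k] by blast+
  then have "eqR (?x k) (?y k)" using eqR_trans[of "?x k" z "?y k"] eqR_sym[of z "?x k"] z(1) U by simp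
  with B[of k] show False by blast
qed

theorem ninR_continuity_point:
  assumes nin: ninR and f: "f \<in> D (T1 \<Rrightarrow> T1)" "unitR f" "regR f"
  shows "\<exists>x\<in>UI. contR f x"
proof (rule ccontr)
  assume "\<not> ?thesis"
  then have ex: "\<exists>n. osc f n x" if "x \<in> UI" for x using discontinuous_osc[OF f(2,3) that] that by blast
  \<comment> \<open>The premise gives the search a witness for every object of type 1, also outside
    the unit interval, so that \<open>?h\<close> becomes a total functional of the model.\<close>
  let ?h = "\<lambda>x. LEAST n. (\<exists>m. osc f m x) \<longrightarrow> osc f n x"
  have "dn [T1] (\<lambda>e. ?h (hd e))"
    by (rule dn_Least, intro dfn_intros f, blast)
  from this[unfolded dn_def] obtain H where H: "H \<in> D T2" "\<And>x. x \<in> D T1 \<Longrightarrow> H \<bullet> x = un (?h x)"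
    by (rule dfn1E) simp
  have "eqR x y \<Longrightarrow> H \<bullet> x = H \<bullet> y" if "x \<in> RR" "y \<in> RR" for x y
    using osc_cong[OF f(2) that] that by (simp add: H(2))
  \<comment> \<open>Height below n means that some index below n already detects the oscillation,
    and larger indices only relax the condition.\<close>
  moreover have "finR (\<lambda>x. x \<in> UI \<and> nm (H \<bullet> x) < n)" for n
  proof (rule finR_mono[OF finR_osc[OF f, of n]])
    fix x assume x: "x \<in> RR" "x \<in> UI \<and> nm (H \<bullet> x) < n"
    then have xD: "x \<in> D T1" by simp
    have "dset (\<lambda>n. osc f n x)" by (intro dfn_intros f xD)
    moreover obtain m where "osc f m x" using ex x by blast
    ultimately have "osc f (LEAST n. osc f n x) x" by (rule internal_Least(1))
    moreover have "?h x = (LEAST n. osc f n x)" using \<open>osc f m x\<close> by (metis (no_types, lifting))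
    ultimately have "osc f (nm (H \<bullet> x)) x" using H(2)[OF xD] by simp
    then show "osc f n x" using osc_mono[OF f(2)] x less_imp_le by blast
  qed
  ultimately show False using nin H(1) unfolding ninR_def by blast
qed


section \<open>A nowhere continuous function from a height function\<close>

lemma dl_kst [simp]: "dl (kst p) (kst q) r \<longleftrightarrow> \<bar>rt p - rt q\<bar> < r"
proof
  assume "\<bar>rt p - rt q\<bar> < r"
  then have "0 < (r - \<bar>rt p - rt q\<bar>) / 2" "\<bar>rt p - rt q\<bar> + (r - \<bar>rt p - rt q\<bar>) / 2 < r" by (auto simp: field_simps)
  then show "dl (kst p) (kst q) r" unfolding dl_def by (intro exI[of _ "(r - \<bar>rt p - rt q\<bar>) / 2"]) (simp add: ev_def)
qed (auto simp: dl_def ev_def)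

lemma lt_kst [simp]: "lt (kst p) (kst q) \<longleftrightarrow> rt p < rt q"
proof
  assume "rt p < rt q"
  then show "lt (kst p) (kst q)" unfolding lt_def by (intro exI[of _ "(rt q - rt p) / 2"]) (auto simp: ev_def field_simps)
qed (auto simp: lt_def ev_def intro: less_trans)

lemma lt_zero_one: "lt zeroR oneR"
  by (simp add: zeroR_def oneR_def)

lemma real01_UI: "zeroR \<in> UI" "oneR \<in> UI"
  using lt_zero_one lt_trans[of zeroR oneR zeroR] lt_irrefl by (auto simp: UI_iff simp del: UI_in)

lemma UI_not_isolated:
  assumes x: "x \<in> UI" and d: "0 < d"
  obtains y where "y \<in> UI" "\<not> eqR x y" "dl x y d"
proof (cases "lt x oneR")
  case True
  from near_right[OF x real01_UI(2) True d] show thesis using that x not_eqR by (metis UI_in(2))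
next
  case False
  then have "lt zeroR x" using lt_le_trans[of zeroR oneR x] lt_zero_one x by simp
  from near_left[OF x real01_UI(1) this d] show thesis using that x not_eqR by (metis UI_in(2))
qed

text \<open>If b is the sum of a and z, then the distance of a and b is the absolute value of z. The
  tolerance \<open>3 * hh n\<close> falls below half of the margin \<open>d'\<close> as soon as
  \<open>hh n\<close> is below \<open>d' / 6\<close>.\<close>

lemma smR_dl:
  assumes "smR a z b"
  shows "dl z zeroR d \<Longrightarrow> dl a b d" and "dl a b d \<Longrightarrow> dl z zeroR d"
proof -
  have s: "\<bar>sq a n + sq z n - sq b n\<bar> \<le> 3 * hh n" for n using assms by (simp add: smR_def)
  show "dl a b d" if zd: "dl z zeroR d"
  proof -
    obtain d' where d': "0 < d'" "ev (\<lambda>n. \<bar>sq z n\<bar> + d' < d)" using zd by (auto simp: dl_def)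
    have "ev (\<lambda>n. \<bar>sq a n - sq b n\<bar> + d' / 2 < d)"
    proof (rule ev_mp2[OF d'(2) ev_hh[of "d' / 6"]])
      fix n assume "\<bar>sq z n\<bar> + d' < d" "hh n < d' / 6"
      moreover have "d' = d' / 2 + d' / 2" by simp
      moreover have "3 * hh n < d' / 2" using \<open>hh n < d' / 6\<close> by (simp add: field_simps)
      ultimately show "\<bar>sq a n - sq b n\<bar> + d' / 2 < d" using s[of n] by linarith
    qed (use d' in simp)
    then show ?thesis unfolding dl_def using d'(1) by (intro exI[of _ "d' / 2"]) simp
  qed
  show "dl z zeroR d" if ab: "dl a b d"
  proof -
    obtain d' where d': "0 < d'" "ev (\<lambda>n. \<bar>sq a n - sq b n\<bar> + d' < d)" using ab by (auto simp: dl_def)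
    have "ev (\<lambda>n. \<bar>sq z n\<bar> + d' / 2 < d)"
    proof (rule ev_mp2[OF d'(2) ev_hh[of "d' / 6"]])
      fix n assume "\<bar>sq a n - sq b n\<bar> + d' < d" "hh n < d' / 6"
      moreover have "d' = d' / 2 + d' / 2" by simp
      moreover have "3 * hh n < d' / 2" using \<open>hh n < d' / 6\<close> by (simp add: field_simps)
      ultimately show "\<bar>sq z n\<bar> + d' / 2 < d" using s[of n] by linarith
    qed (use d' in simp)
    then show ?thesis unfolding dl_def using d'(1) by (intro exI[of _ "d' / 2"]) simp
  qed
qed

end

locale height_model = model S un for S :: "'u struct" and un :: "'n::discrete_semiring \<Rightarrow> 'u" +
  fixes H :: 'u
  assumes H_in: "H \<in> D T2"
    and H_cong: "x \<in> RR \<Longrightarrow> y \<in> RR \<Longrightarrow> eqR x y \<Longrightarrow> H \<bullet> x = H \<bullet> y"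
    and H_fin: "finR (\<lambda>x. x \<in> UI \<and> nm (H \<bullet> x) < n)"
begin

text \<open>The points of height below n are covered by a list of length m. Each listed point other
  than x has positive distance from x, but m may be nonstandard and no minimum of these distances
  can be taken outside; a common dyadic bound is found by internal induction along the list.\<close>

lemma height_nbhd:
  assumes x: "x \<in> UI"
  obtains d where "0 < d" "\<And>y. y \<in> UI \<Longrightarrow> \<not> eqR x y \<Longrightarrow> dl x y d \<Longrightarrow> n \<le> nm (H \<bullet> y)"
proof -
  have xD: "x \<in> RR" "x \<in> D T1" using x by simp_all
  have "dp [T1] (\<lambda>e. hd e \<in> UI \<and> nm (H \<bullet> hd e) < n)" by (intro dfn_intros H_in real01_in)
  from this[unfolded dp_def dn_def] obtain X where X: "X \<in> D T2"
    "\<And>y. y \<in> D T1 \<Longrightarrow> X \<bullet> y = un (if y \<in> UI \<and> nm (H \<bullet> y) < n then 1 else 0)"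
    by (rule dfn1E) simp
  have X1: "X \<bullet> y = un 1 \<longleftrightarrow> y \<in> UI \<and> nm (H \<bullet> y) < n" if "y \<in> RR" for y using X(2)[of y] that by simp
  have "setR X"
    unfolding setR_def
  proof (intro conjI ballI impI)
    show "X \<bullet> y = un 0 \<or> X \<bullet> y = un 1" if "y \<in> RR" for y using X(2)[of y] that by simp
    fix y y' assume yy: "y \<in> RR" "y' \<in> RR" "eqR y y'"
    then have "y \<in> UI \<longleftrightarrow> y' \<in> UI" using UI_cong eqR_sym by blast
    then show "X \<bullet> y = X \<bullet> y'" using X(2)[of y] X(2)[of y'] H_cong[OF yy] yy by simp
  qed
  moreover have "finR (\<lambda>y. X \<bullet> y = un 1)"
    by (rule finR_mono[OF H_fin[of n]]) (use X1 in blast)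
  ultimately obtain w m where w: "w \<in> D (T0 \<Rrightarrow> T1)" "\<And>i. i < m \<Longrightarrow> w \<bullet> un i \<in> RR"
    "\<And>x. x \<in> RR \<Longrightarrow> X \<bullet> x = un 1 \<Longrightarrow> \<exists>i<m. eqR x (w \<bullet> un i)"
    using FIN_enum_sem[OF X(1)] by blast
  \<comment> \<open>The guard \<open>m' \<le> m\<close> keeps the induction among the indices at
    which \<open>w\<close> is known to yield reals.\<close>
  have "m' \<le> m \<longrightarrow> (\<exists>k. \<forall>i. i < m' \<longrightarrow> \<not> eqR x (w \<bullet> un i) \<longrightarrow> \<not> dlh x (w \<bullet> un i) k)" (is "?P m'") for m'
  proof (rule internal_induct[of ?P])
    show "dset ?P" by (intro dfn_intros w xD)
    show "?P 0" using ds_nonneg by (auto simp: not_less[symmetric])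
    fix j assume IH: "?P j"
    show "?P (j + 1)"
    proof
      assume "j + 1 \<le> m"
      then have j: "j < m" using less_add_one_iff[of j j] by (auto intro: less_le_trans)
      then have "j \<le> m" by simp
      with IH obtain k where k: "\<And>i. i < j \<Longrightarrow> \<not> eqR x (w \<bullet> un i) \<Longrightarrow> \<not> dlh x (w \<bullet> un i) k" by blast
      have "\<exists>k'. \<not> eqR x (w \<bullet> un j) \<longrightarrow> \<not> dl x (w \<bullet> un j) (hh k')"
      proof (cases "eqR x (w \<bullet> un j)")
        case False
        then obtain r where "0 < r" "\<not> dl x (w \<bullet> un j) r" using eqR_iff_dl[OF xD(1) w(2)[OF j]] by blast
        then show ?thesis using hh_small[of r] dl_mono less_imp_le by blast
      qed simp
      then obtain k' where k': "\<not> eqR x (w \<bullet> un j) \<Longrightarrow> \<not> dl x (w \<bullet> un j) (hh k')" by blast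
      have "\<not> dlh x (w \<bullet> un i) (max k k')" if "i < j + 1" "\<not> eqR x (w \<bullet> un i)" for i
      proof -
        have i: "i \<le> j" using that(1) less_add_one_iff by simp
        then have "w \<bullet> un i \<in> RR" using w(2) j by simp
        moreover have "\<not> dl x (w \<bullet> un i) (hh (max k k'))"
        proof (cases "i = j")
          case True
          then show ?thesis using k' that(2) dl_mono hh_mono[of k' "max k k'"] by auto
        next
          case False
          with i have "\<not> dlh x (w \<bullet> un i) k" using k that(2) by simp
          then show ?thesis using dlh_iff[OF xD(1) \<open>w \<bullet> un i \<in> RR\<close>] dl_mono hh_mono[of k "max k k'"] by auto
        qed
        ultimately show ?thesis using dlh_iff[OF xD(1)] by blast
      qed
      then show "\<exists>k. \<forall>i. i < j + 1 \<longrightarrow> \<not> eqR x (w \<bullet> un i) \<longrightarrow> \<not> dlh x (w \<bullet> un i) k" by blast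
    qed
  qed
  from this[of m] obtain k where k: "\<And>i. i < m \<Longrightarrow> \<not> eqR x (w \<bullet> un i) \<Longrightarrow> \<not> dl x (w \<bullet> un i) (hh k)"
    using dlh_iff[OF xD(1) w(2)] by auto
  show thesis
  proof (rule that[of "hh k"])
    fix y assume y: "y \<in> UI" "\<not> eqR x y" "dl x y (hh k)"
    show "n \<le> nm (H \<bullet> y)"
    proof (rule ccontr)
      assume "\<not> ?thesis"
      then have "X \<bullet> y = un 1" using X1[of y] y(1) by simp
      then obtain i where i: "i < m" "eqR y (w \<bullet> un i)" using w(3)[of y] y(1) by auto
      have "\<not> eqR x (w \<bullet> un i)" using y(2) eqR_trans[OF xD(1) w(2)[OF i(1)] UI_in(2)[OF y(1)]]
          eqR_sym[OF UI_in(2)[OF y(1)] w(2)[OF i(1)] i(2)] by blast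
      moreover have "dl x (w \<bullet> un i) (hh k)" using y(3) dl_cong[OF UI_in(2)[OF y(1)] w(2)[OF i(1)] i(2)] dl_sym by blast
      ultimately show False using k i(1) by blast
    qed
  qed simp
qed

text \<open>\<open>code 0 1 h\<close> is the rational -1/(h + 1). Defining values through codes
  makes the function an element of the model, constant sequences being its values.\<close>

definition gc :: "'u \<Rightarrow> 'n" where "gc x = code 0 1 (nm (H \<bullet> x))"
definition g :: "'u \<Rightarrow> 'n zz fract" where "g x = rt (gc x)"

lemma isc_gc [simp]: "isc (gc x)"
  by (simp add: gc_def)

lemma g_eq: "g x = - (1 / (rn (nm (H \<bullet> x)) + 1))"
  by (simp add: g_def gc_def)

lemma rn_add_one_pos: "0 < rn (n :: 'n) + 1"
  by (simp add: add_nonneg_pos)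

lemma g_neg: "g x < 0"
  using rn_add_one_pos by (simp add: g_eq)

lemma g_mono: "nm (H \<bullet> x) \<le> nm (H \<bullet> y) \<Longrightarrow> g x \<le> g y"
  using rn_add_one_pos by (simp add: g_eq divide_left_mono)

lemma g_small:
  assumes x: "x \<in> UI" and r: "0 < r"
  obtains d where "0 < d" "\<And>y. y \<in> UI \<Longrightarrow> \<not> eqR x y \<Longrightarrow> dl x y d \<Longrightarrow> \<bar>g y\<bar> < r"
proof -
  obtain n where n: "hh n < r" using hh_small[OF r] by blast
  obtain d where d: "0 < d" "\<And>y. y \<in> UI \<Longrightarrow> \<not> eqR x y \<Longrightarrow> dl x y d \<Longrightarrow> pw n \<le> nm (H \<bullet> y)"
    using height_nbhd[OF x] by blast
  have "\<bar>g y\<bar> < r" if "pw n \<le> nm (H \<bullet> y)" for y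
  proof -
    have "rn (pw n) \<le> rn (nm (H \<bullet> y)) + 1" using that rn_simps(6)[of "pw n" "nm (H \<bullet> y)"] by linarith
    then have "1 / (rn (nm (H \<bullet> y)) + 1) \<le> hh n"
      unfolding hh_def using rn_add_one_pos by (intro divide_left_mono) simp_all
    moreover have "\<bar>g y\<bar> = 1 / (rn (nm (H \<bullet> y)) + 1)" using rn_add_one_pos[of "nm (H \<bullet> y)"] by (simp add: g_eq)
    ultimately show ?thesis using n by simp
  qed
  with d that show thesis by blast
qed

theorem nowhere_continuous:
  obtains f where "f \<in> D (T1 \<Rrightarrow> T1)" "unitR f" "regR f" "lscR f" "symR f" "supfR f" "\<not> (\<exists>x\<in>UI. contR f x)"
proof -
  have "dfn [T1] T1 (\<lambda>e. kst (code 0 1 (nm (H \<bullet> hd e))))"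
    unfolding code_def pair_def by (intro dfn_intros H_in)
  then obtain f where f: "f \<in> D (T1 \<Rrightarrow> T1)" "\<And>x. x \<in> D T1 \<Longrightarrow> f \<bullet> x = kst (gc x)"
    unfolding gc_def by (rule dfn1E) simp
  have fU [simp]: "f \<bullet> x = kst (gc x)" if "x \<in> RR" for x using f(2) that by simp
  have dl_f: "dl (f \<bullet> x) (f \<bullet> y) r \<longleftrightarrow> \<bar>g x - g y\<bar> < r" if "x \<in> UI" "y \<in> UI" for x y r using that by (simp add: g_def)
  have f_eq: "f \<bullet> x = f \<bullet> y" if "x \<in> RR" "y \<in> RR" "eqR x y" for x y using that H_cong[OF that] by (simp add: gc_def)
  have u: "unitR f"
    unfolding unitR_def
  proof (intro conjI ballI impI)
    show fR: "f \<bullet> x \<in> RR" if "x \<in> UI" for x using that by simp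
    show "eqR (f \<bullet> x) (f \<bullet> y)" if "x \<in> UI" "y \<in> UI" "eqR x y" for x y
      using f_eq[OF UI_in(2)[OF that(1)] UI_in(2)[OF that(2)] that(3)] eqR_refl[OF fR[OF that(2)]] by (simp only:)
  qed
  have reg: "regR f"
  proof -
    have lim: "\<exists>d>0. \<forall>y\<in>UI. \<not> eqR x y \<and> dl x y d \<longrightarrow> dl (f \<bullet> y) zeroR r" if xr: "x \<in> UI" "0 < r" for x r
    proof -
      obtain d where d: "0 < d" "\<And>y. y \<in> UI \<Longrightarrow> \<not> eqR x y \<Longrightarrow> dl x y d \<Longrightarrow> \<bar>g y\<bar> < r" using g_small[OF xr] by blast
      then show ?thesis by (intro exI[of _ d]) (simp add: zeroR_def g_def)
    qed
    have "rlimR f x zeroR" "llimR f x zeroR" if x: "x \<in> UI" for x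
    proof -
      have "\<not> eqR x y" if "y \<in> UI" "lt x y \<or> lt y x" for y using not_eqR that x by simp
      then show "rlimR f x zeroR" "llimR f x zeroR"
        unfolding rlimR_iff[OF u x real01_in(3)] llimR_iff[OF u x real01_in(3)] using lim[OF x] by meson+
    qed
    then show ?thesis unfolding regR_def using real01_in(3) by blast
  qed
  have lsc: "lscR f"
    unfolding lscR_def
  proof (intro ballI impI)
    fix x a assume x: "x \<in> UI" "a \<in> RR" "ltR a (f \<bullet> x)"
    then have a: "lt a (f \<bullet> x)" by (simp add: ltR_iff)
    \<comment> \<open>Close to x all other points have at least the height of x, and -1/(h + 1)
      increases with h, so no value there lies below that at x.\<close>
    obtain d where d: "0 < d" "\<And>y. y \<in> UI \<Longrightarrow> \<not> eqR x y \<Longrightarrow> dl x y d \<Longrightarrow> nm (H \<bullet> x) \<le> nm (H \<bullet> y)"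
      using height_nbhd[OF x(1)] by blast
    obtain \<delta> where \<delta>: "\<delta> \<in> PR" "\<forall>x\<in>RR. \<forall>y\<in>RR. dlR x y \<delta> \<longleftrightarrow> dl x y d" using PR_rational[OF d(1)] by blast
    have "\<not> ltR (f \<bullet> y) a" if y: "y \<in> UI" "\<not> eqR y x" "dlR x y \<delta>" for y
    proof
      assume "ltR (f \<bullet> y) a"
      then have "lt (f \<bullet> y) (f \<bullet> x)" using a x(2) y(1) lt_trans by (simp add: ltR_iff)
      then have "g y < g x" using x y by (simp add: g_def)
      moreover have "\<not> eqR x y" "dl x y d" using y x \<delta>(2) eqR_sym[of x y] by auto
      then have "g x \<le> g y" using d(2) y(1) g_mono by blast
      ultimately show False by simp
    qed
    with \<delta>(1) show "\<exists>\<delta>\<in>PR. \<forall>y\<in>UI. \<not> eqR y x \<and> dlR x y \<delta> \<longrightarrow> \<not> ltR (f \<bullet> y) a" by blast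
  qed
  have sym: "symR f"
    unfolding symR_def
  proof (intro ballI)
    fix x \<epsilon> assume x: "x \<in> UI" and "\<epsilon> \<in> PR"
    then obtain r where r: "0 < r" "\<forall>x\<in>RR. \<forall>y\<in>RR. dl x y r \<longrightarrow> dlR x y \<epsilon>" using PR_lower by blast
    then have r2: "0 < r / 2" "r / 2 + r / 2 = r" by simp_all
    obtain d where d: "0 < d" "\<And>y. y \<in> UI \<Longrightarrow> \<not> eqR x y \<Longrightarrow> dl x y d \<Longrightarrow> \<bar>g y\<bar> < r / 2" using g_small[OF x r2(1)] by blast
    obtain \<delta> where \<delta>: "\<delta> \<in> PR" "\<forall>x\<in>RR. \<forall>y\<in>RR. dlR x y \<delta> \<longleftrightarrow> dl x y d" using PR_rational[OF d(1)] by blast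
    have "dlR (f \<bullet> u) (f \<bullet> v) \<epsilon>"
      if z: "z \<in> RR" "u \<in> UI" "v \<in> UI" "dlR z zeroR \<delta> \<and> smR x z u \<and> smR v z x" for z u v
    proof -
      have R: "x \<in> RR" "u \<in> RR" "v \<in> RR" using x z by simp_all
      have zd: "dl z zeroR d" using z \<delta>(2) by simp
      have xu: "dl x u d" and vx: "dl x v d" using smR_dl(1)[OF _ zd] z(4) dl_sym by blast+
      have "dl (f \<bullet> u) (f \<bullet> v) r"
      proof (cases "eqR x u \<or> eqR x v")
        case True
        \<comment> \<open>Both u and v have distance |z| from x. So if one of them equals x, the
          other does too, and the two values coincide; otherwise both values are small.\<close>
        have "dl x u s \<longleftrightarrow> dl x v s" for s using z(4) smR_dl dl_sym by metis
        with True have "eqR x u" "eqR x v" using eqR_iff_dl R by blast+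
        then have "f \<bullet> u = f \<bullet> v" using f_eq[of u v] eqR_trans[of u x v] eqR_sym R by blast
        then show ?thesis using dl_refl r(1) by simp
      next
        case False
        then have "\<bar>g u\<bar> < r / 2" "\<bar>g v\<bar> < r / 2" using d(2) xu vx z by blast+
        then show ?thesis using dl_f z r2(2) by (simp add: abs_less_iff)  linarith
      qed
      then show ?thesis using r(2) z(2,3) u by simp
    qed
    with \<delta>(1) show "\<exists>\<delta>\<in>PR. \<forall>z\<in>RR. \<forall>u\<in>UI. \<forall>v\<in>UI. dlR z zeroR \<delta> \<and> smR x z u \<and> smR v z x \<longrightarrow> dlR (f \<bullet> u) (f \<bullet> v) \<epsilon>"
      by blast
  qed
  have sup: "supfR f"
  proof -
    \<comment> \<open>On a degenerate interval the supremum is the value at its only point, not 0.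
      Equality of two rationals is definable, so both cases fit into one functional; the third
      argument is the index of the approximation.\<close>
    have "dn [T0, T0, T0] (\<lambda>e. if eqR (kst (nm (hd (tl (tl e))))) (kst (nm (hd (tl e))))
        then code 0 1 (nm (H \<bullet> kst (nm (hd (tl (tl e)))))) else code 0 0 0)"
      unfolding code_def pair_def by (intro dfn_intros H_in)
    from this[unfolded dn_def] obtain F where F: "F \<in> D (T0 \<Rrightarrow> T0 \<Rrightarrow> T1)"
      "\<And>p q n. p \<in> D T0 \<Longrightarrow> q \<in> D T0 \<Longrightarrow> n \<in> D T0 \<Longrightarrow> F \<bullet> p \<bullet> q \<bullet> n =
         un (if eqR (kst (nm p)) (kst (nm q)) then code 0 1 (nm (H \<bullet> kst (nm p))) else code 0 0 0)"
      by (rule dfn3E) simp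
    have Fpq: "F \<bullet> un p \<bullet> un q = (if eqR (kst p) (kst q) then f \<bullet> kst p else zeroR)" for p q
    proof (rule fn_ext)
      show "F \<bullet> un p \<bullet> un q \<in> D T1" using F(1) by simp
      show "(if eqR (kst p) (kst q) then f \<bullet> kst p else zeroR) \<in> D T1" using f(1) by simp
      show "fn (F \<bullet> un p \<bullet> un q) n = fn (if eqR (kst p) (kst q) then f \<bullet> kst p else zeroR) n" for n
        using F(2)[of "un p" "un q" "un n"] f(2)[of "kst p"] by (simp add: fn_def[of "F \<bullet> un p \<bullet> un q"] zeroR_def gc_def)
    qed
    show ?thesis
      unfolding supfR_def
    proof (rule bexI[OF _ F(1)], intro conjI allI impI; (elim conjE)?)
      fix p q assume pq: "isc p" "isc q"
      show "F \<bullet> un p \<bullet> un q \<in> RR" using pq by (simp add: Fpq)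
      fix p' q' assume pq': "isc p'" "isc q'" "eqR (kst p) (kst p')" "eqR (kst q) (kst q')"
      have "eqR (kst p) (kst q) \<longleftrightarrow> eqR (kst p') (kst q')"
        using pq pq' eqR_trans eqR_sym kst_RR by meson
      moreover have "f \<bullet> kst p = f \<bullet> kst p'" using f_eq pq pq' by simp
      ultimately show "eqR (F \<bullet> un p \<bullet> un q) (F \<bullet> un p' \<bullet> un q')" using pq pq' by (simp add: Fpq)
    next
      fix p q assume pq: "isc p" "isc q" "kst p \<in> UI" "kst q \<in> UI" "\<not> ltR (kst q) (kst p)"
      then have qp: "\<not> lt (kst q) (kst p)" by (simp add: ltR_iff)
      have pR: "kst p \<in> RR" "kst q \<in> RR" using pq by simp_all
      have IV: "x \<in> IV (kst p) (kst q) \<longleftrightarrow> x \<in> RR \<and> \<not> lt x (kst p) \<and> \<not> lt (kst q) x" for x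
        using pR by (auto simp: IV_def ltR_iff simp del: UI_in)
      show "supR f (kst p) (kst q) (F \<bullet> un p \<bullet> un q)"
      proof (cases "eqR (kst p) (kst q)")
        case True
        have "f \<bullet> x = f \<bullet> kst p" if "x \<in> IV (kst p) (kst q)" for x
        proof -
          have "\<not> lt (kst p) x" using that IV lt_cong(1)[OF pR(1,2) _ True] by simp
          then show ?thesis using that IV f_eq[OF _ pR(1)] eqR_iff[OF _ pR(1)] by blast
        qed
        moreover have "kst p \<in> IV (kst p) (kst q)" using IV pR qp lt_irrefl by blast
        moreover have "\<not> ltR (f \<bullet> kst p) (f \<bullet> kst p)" using pR by (simp add: ltR_iff)
        ultimately have "supR f (kst p) (kst q) (f \<bullet> kst p)" unfolding supR_def by metis
        then show ?thesis using True by (simp only: Fpq if_True)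
      next
        case False
        then have lpq: "lt (kst p) (kst q)" using not_eqR pR qp by blast
        have "\<not> ltR zeroR (f \<bullet> x)" if "x \<in> RR" for x
          using that g_neg[of x] by (simp add: ltR_iff) (simp add: zeroR_def g_def)
        moreover have "\<not> ltR t zeroR" if t: "t \<in> RR" "\<forall>x\<in>IV (kst p) (kst q). \<not> ltR t (f \<bullet> x)" for t
        proof
          assume "ltR t zeroR"
          then obtain d where d: "0 < d" "ev (\<lambda>n. sq t n + d < 0)" using t(1) by (auto simp: ltR_iff lt_def)
          then have d2: "0 < d / 2" "d / 2 + d / 2 = d" by simp_all
          \<comment> \<open>With t below -d, a rational point of the interval close to its left end
            but different from it has a value above -d/2 and so refutes the upper bound t.\<close>
          obtain d' where d': "0 < d'" "\<And>y. y \<in> UI \<Longrightarrow> \<not> eqR (kst p) y \<Longrightarrow> dl (kst p) y d' \<Longrightarrow> \<bar>g y\<bar> < d / 2"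
            using g_small[OF pq(3) d2(1)] by blast
          obtain y where y: "isc y" "kst y \<in> UI" "lt (kst p) (kst y)" "lt (kst y) (kst q)" "dl (kst p) (kst y) d'"
            using near_right[OF pq(3,4) lpq d'(1)] by blast
          have yR: "kst y \<in> RR" using y(1) by simp
          have "\<not> eqR (kst p) (kst y)" using not_eqR[OF pR(1) yR] y(3) by blast
          then have gy: "\<bar>g (kst y)\<bar> < d / 2" using d'(2)[OF y(2) _ y(5)] by blast
          have "ev (\<lambda>n. sq t n + d / 2 < sq (f \<bullet> kst y) n)"
          proof (rule ev_mp[OF d(2)])
            fix n assume "sq t n + d < 0"
            moreover have "sq (f \<bullet> kst y) n = g (kst y)" using y(1) by (simp add: g_def)
            ultimately show "sq t n + d / 2 < sq (f \<bullet> kst y) n" using gy d2(2) by linarith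
          qed
          then have "lt t (f \<bullet> kst y)" unfolding lt_def using d2(1) by blast
          then have "ltR t (f \<bullet> kst y)" using t(1) yR by (simp add: ltR_iff)
          moreover have "kst y \<in> IV (kst p) (kst q)" using IV[of "kst y"] yR y(3,4) lt_trans[of "kst p" "kst y" "kst p"] lt_trans[of "kst y" "kst q" "kst y"]
              lt_irrefl[of "kst p"] lt_irrefl[of "kst y"] by blast
          ultimately show False using t(2) by blast
        qed
        ultimately have "supR f (kst p) (kst q) zeroR" unfolding supR_def using IV by blast
        then show ?thesis using False by (simp only: Fpq if_False)
      qed
    qed
  qed
  have "\<not> contR f x" if x: "x \<in> UI" for x
  proof
    assume c: "contR f x"
    \<comment> \<open>Half of the distance of \<open>g x\<close> from 0: continuity would bring
      nearby values that close to \<open>g x\<close>, while they are also that close to 0.\<close>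
    have r: "0 < - g x / 2" "- g x / 2 + - g x / 2 = - g x" using g_neg[of x] by simp_all
    obtain d where d: "0 < d" "\<forall>y\<in>UI. dl x y d \<longrightarrow> dl (f \<bullet> x) (f \<bullet> y) (- g x / 2)"
      using c r(1) unfolding contR_iff[OF u x] by blast
    obtain d' where d': "0 < d'" "\<And>y. y \<in> UI \<Longrightarrow> \<not> eqR x y \<Longrightarrow> dl x y d' \<Longrightarrow> \<bar>g y\<bar> < - g x / 2" using g_small[OF x r(1)] by blast
    obtain y where y: "y \<in> UI" "\<not> eqR x y" "dl x y (min d d')" using UI_not_isolated[OF x, of "min d d'"] d d' by auto
    then have "dl x y d" "dl x y d'" using dl_mono by (meson min.cobounded1 min.cobounded2)+
    then have "\<bar>g x - g y\<bar> < - g x / 2" "\<bar>g y\<bar> < - g x / 2" using d(2) d'(2) y dl_f[OF x y(1)] by blast+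
    then show False using r by linarith
  qed
  with that f(1) u reg lsc sym sup show thesis by blast
qed

end

context model
begin

text \<open>One function satisfies the hypotheses of all three principles and violates their common
  conclusion, so a single construction settles the three implications towards
  \<open>NIN_alt\<close>.\<close>

theorem model_equivalences:
  "hol S [] (NIN_alt \<^bold>\<longleftrightarrow> cont_point_sup)"
  "hol S [] (NIN_alt \<^bold>\<longleftrightarrow> cont_point_lsc_sup)"
  "hol S [] (NIN_alt \<^bold>\<longleftrightarrow> cont_point_symm)"
proof -
  have "\<exists>f\<in>D (T1 \<Rrightarrow> T1). unitR f \<and> regR f \<and> lscR f \<and> symR f \<and> supfR f \<and> \<not> (\<exists>x\<in>UI. contR f x)" if nin: "\<not> ninR"
  proof -
    obtain H where "H \<in> D T2" "\<forall>x\<in>RR. \<forall>y\<in>RR. eqR x y \<longrightarrow> H \<bullet> x = H \<bullet> y" "\<forall>n. finR (\<lambda>x. x \<in> UI \<and> nm (H \<bullet> x) < n)"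
      using nin unfolding ninR_def by blast
    then interpret height_model S un H by unfold_locales blast+
    show ?thesis by (rule nowhere_continuous) blast
  qed
  then show "hol S [] (NIN_alt \<^bold>\<longleftrightarrow> cont_point_sup)" "hol S [] (NIN_alt \<^bold>\<longleftrightarrow> cont_point_lsc_sup)"
    "hol S [] (NIN_alt \<^bold>\<longleftrightarrow> cont_point_symm)"
    unfolding hol_connectives hol_NIN_alt hol_cont_point using ninR_continuity_point by meson+
qed

end

section \<open>Well-formedness of the axioms\<close>

text \<open>The countermodel is known to satisfy well-formed sentences only, so typing has to be
  verified for the axioms used and for the conclusions. The type is required under all extensions of
  the context, since a term written at one depth is reused under further quantifiers.\<close>

definition wt :: "ty list \<Rightarrow> otm \<Rightarrow> ty \<Rightarrow> bool" where
  "wt \<Delta> x \<tau> \<longleftrightarrow> (\<forall>vs. ty_of (vs @ \<Delta>) (x (length (vs @ \<Delta>))) = Some \<tau>)"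
definition wfo :: "ty list \<Rightarrow> ofm \<Rightarrow> bool" where
  "wfo \<Delta> P \<longleftrightarrow> wff \<Delta> (P (length \<Delta>))"
definition wtr :: "ty list \<Rightarrow> rexp \<Rightarrow> bool" where
  "wtr \<Delta> t \<longleftrightarrow> (case t of (P, M, N) \<Rightarrow> wt \<Delta> P T0 \<and> wt \<Delta> M T0 \<and> wt \<Delta> N T0)"

named_theorems wf_rules

lemma wt_var [wf_rules]: "wt (\<rho> # \<Delta>) (var (length \<Delta>)) \<rho>"
  by (simp add: wt_def var_def nth_append)

lemma wt_weak: "wt \<Delta> x \<tau> \<Longrightarrow> wt (\<rho> # \<Delta>) x \<tau>"
  unfolding wt_def
proof
  fix vs assume "\<forall>vs. ty_of (vs @ \<Delta>) (x (length (vs @ \<Delta>))) = Some \<tau>"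
  then have "ty_of ((vs @ [\<rho>]) @ \<Delta>) (x (length ((vs @ [\<rho>]) @ \<Delta>))) = Some \<tau>" by blast
  then show "ty_of (vs @ \<rho> # \<Delta>) (x (length (vs @ \<rho> # \<Delta>))) = Some \<tau>" by simp
qed

lemma wt_app [wf_rules]: "wt \<Delta> s (\<sigma> \<Rrightarrow> \<tau>) \<Longrightarrow> wt \<Delta> t \<sigma> \<Longrightarrow> wt \<Delta> (s \<cdot> t) \<tau>"
  by (simp add: wt_def o_app_def)

lemma wt_cn: "wt \<Delta> (o_cn c) (ty_cnst c)"
  by (simp add: wt_def o_cn_def)

lemma wt_consts [wf_rules]:
  "wt \<Delta> (o_cn (CK \<rho> \<tau>)) (\<rho> \<Rrightarrow> \<tau> \<Rrightarrow> \<rho>)"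
  "wt \<Delta> (o_cn (CS \<rho> \<sigma> \<tau>)) ((\<rho> \<Rrightarrow> \<sigma> \<Rrightarrow> \<tau>) \<Rrightarrow> (\<rho> \<Rrightarrow> \<sigma>) \<Rrightarrow> \<rho> \<Rrightarrow> \<tau>)"
  "wt \<Delta> (o_cn CRec) ((T0 \<Rrightarrow> T0 \<Rrightarrow> T0) \<Rrightarrow> T0 \<Rrightarrow> T0 \<Rrightarrow> T0)"
  "wt \<Delta> (o_cn CPlus) (T0 \<Rrightarrow> T0 \<Rrightarrow> T0)" "wt \<Delta> (o_cn CTimes) (T0 \<Rrightarrow> T0 \<Rrightarrow> T0)"
  "wt \<Delta> \<^bold>0 T0" "wt \<Delta> \<^bold>1 T0"
  using wt_cn[of \<Delta> "CK \<rho> \<tau>"] wt_cn[of \<Delta> "CS \<rho> \<sigma> \<tau>"] wt_cn[of \<Delta> CRec] wt_cn[of \<Delta> CPlus] wt_cn[of \<Delta> CTimes]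
    wt_cn[of \<Delta> CZero] wt_cn[of \<Delta> COne] by (simp_all add: o_zero_def o_one_def)

lemma wt_arith [wf_rules]:
  "wt \<Delta> s T0 \<Longrightarrow> wt \<Delta> t T0 \<Longrightarrow> wt \<Delta> (s \<^bold>+ t) T0"
  "wt \<Delta> s T0 \<Longrightarrow> wt \<Delta> t T0 \<Longrightarrow> wt \<Delta> (s \<^bold>* t) T0"
  unfolding o_plus_def o_times_def by (rule wf_rules | assumption)+

lemma wt_pow2 [wf_rules]: "wt \<Delta> n T0 \<Longrightarrow> wt \<Delta> (o_pow2 n) T0"
  unfolding o_pow2_def o_double_def o_ident_def by (rule wf_rules | assumption)+

lemma wt_code [wf_rules]: "wt \<Delta> a T0 \<Longrightarrow> wt \<Delta> b T0 \<Longrightarrow> wt \<Delta> c T0 \<Longrightarrow> wt \<Delta> (rat_code a b c) T0"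
  unfolding rat_code_def o_pair_def by (rule wf_rules | assumption)+

lemma wt_of_rat [wf_rules]: "wt \<Delta> q T0 \<Longrightarrow> wt \<Delta> (Defs.of_rat q) T1"
  unfolding Defs.of_rat_def by (rule wf_rules | assumption)+

lemma wt_real01 [wf_rules]: "wt \<Delta> \<^bold>0\<^sub>R T1" "wt \<Delta> \<^bold>1\<^sub>R T1"
  unfolding real0_def real1_def by (rule wf_rules | assumption)+

lemma wf_connectives [wf_rules]:
  "wfo \<Delta> o_bot"
  "wfo \<Delta> P \<Longrightarrow> wfo \<Delta> Q \<Longrightarrow> wfo \<Delta> (P \<^bold>\<longrightarrow> Q)"
  "wfo \<Delta> P \<Longrightarrow> wfo \<Delta> (\<^bold>\<not> P)"
  "wfo \<Delta> P \<Longrightarrow> wfo \<Delta> Q \<Longrightarrow> wfo \<Delta> (P \<^bold>\<or> Q)"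
  "wfo \<Delta> P \<Longrightarrow> wfo \<Delta> Q \<Longrightarrow> wfo \<Delta> (P \<^bold>\<and> Q)"
  "wfo \<Delta> P \<Longrightarrow> wfo \<Delta> Q \<Longrightarrow> wfo \<Delta> (P \<^bold>\<longleftrightarrow> Q)"
  by (simp_all add: wfo_def o_bot_def o_imp_def o_not_def o_or_def o_and_def o_iff_def)

lemma wt_ty_of: "wt \<Delta> x \<tau> \<Longrightarrow> ty_of \<Delta> (x (length \<Delta>)) = Some \<tau>"
  unfolding wt_def by (metis append_Nil)

lemma wf_prime [wf_rules]:
  "wt \<Delta> s T0 \<Longrightarrow> wt \<Delta> t T0 \<Longrightarrow> wfo \<Delta> (s \<^bold>= t)"
  "wt \<Delta> s T0 \<Longrightarrow> wt \<Delta> t T0 \<Longrightarrow> wfo \<Delta> (s \<^bold>< t)"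
  "wt \<Delta> s T0 \<Longrightarrow> wt \<Delta> t T0 \<Longrightarrow> wfo \<Delta> (s \<^bold>\<le> t)"
  by (simp_all add: wfo_def o_eq_def o_less_def o_le_def o_or_def o_not_def o_imp_def o_bot_def wt_ty_of)

lemma wf_all [wf_rules]: "wfo (\<rho> # \<Delta>) (P (var (length \<Delta>))) \<Longrightarrow> wfo \<Delta> (o_all \<rho> P)"
  by (simp add: wfo_def o_all_def var_def)

lemma wf_ex [wf_rules]: "wfo (\<rho> # \<Delta>) (P (var (length \<Delta>))) \<Longrightarrow> wfo \<Delta> (o_ex \<rho> P)"
  unfolding o_ex_def by (rule wf_rules | assumption)+

lemma wf_bounded [wf_rules]:
  "wfo (T1 # \<Delta>) (A (var (length \<Delta>))) \<Longrightarrow> wfo (T1 # \<Delta>) (P (var (length \<Delta>))) \<Longrightarrow> wfo \<Delta> (o_ball A P)"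
  "wfo (T1 # \<Delta>) (A (var (length \<Delta>))) \<Longrightarrow> wfo (T1 # \<Delta>) (P (var (length \<Delta>))) \<Longrightarrow> wfo \<Delta> (o_bex A P)"
  unfolding o_ball_def o_bex_def by (rule wf_rules | assumption)+

lemma wtr_ops:
  "wtr \<Delta> s \<Longrightarrow> wtr \<Delta> t \<Longrightarrow> wtr \<Delta> (radd s t)"
  "wtr \<Delta> t \<Longrightarrow> wtr \<Delta> (rneg t)"
  by (auto simp: wtr_def split: prod.splits intro!: wt_arith)

lemma wtr_rules [wf_rules]:
  "wtr \<Delta> s \<Longrightarrow> wtr \<Delta> t \<Longrightarrow> wtr \<Delta> (radd s t)"
  "wtr \<Delta> s \<Longrightarrow> wtr \<Delta> t \<Longrightarrow> wtr \<Delta> (rsub s t)"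
  "wt \<Delta> c T0 \<Longrightarrow> wt \<Delta> n T0 \<Longrightarrow> wtr \<Delta> (dyad c n)"
  by (simp_all add: wtr_ops rsub_def) (simp add: wtr_def dyad_def wt_consts wt_pow2)

lemma wtr_weak: "wtr \<Delta> t \<Longrightarrow> wtr (\<rho> # \<Delta>) t"
  by (auto simp: wtr_def wt_weak split: prod.splits)

lemma wf_rat_order [wf_rules]:
  "wtr \<Delta> s \<Longrightarrow> wtr \<Delta> t \<Longrightarrow> wfo \<Delta> (rless s t)"
  "wtr \<Delta> s \<Longrightarrow> wtr \<Delta> t \<Longrightarrow> wfo \<Delta> (rabs_less s t)"
  "wtr \<Delta> s \<Longrightarrow> wtr \<Delta> t \<Longrightarrow> wfo \<Delta> (rabs_le s t)"
proof -
  have *: "wfo \<Delta> (rless s t)" if "wtr \<Delta> s" "wtr \<Delta> t" for s t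
    using that by (auto simp: wtr_def split: prod.splits intro!: wf_prime wt_arith)
  show "wtr \<Delta> s \<Longrightarrow> wtr \<Delta> t \<Longrightarrow> wfo \<Delta> (rless s t)" by (rule *)
  show "wtr \<Delta> s \<Longrightarrow> wtr \<Delta> t \<Longrightarrow> wfo \<Delta> (rabs_less s t)" "wtr \<Delta> s \<Longrightarrow> wtr \<Delta> t \<Longrightarrow> wfo \<Delta> (rabs_le s t)"
    unfolding rabs_less_def rabs_le_def rle_def by (intro wf_connectives * wtr_ops; assumption)+
qed

lemma wf_decode [wf_rules]:
  assumes "wt \<Delta> q T0" "\<And>t. wtr (T0 # T0 # T0 # \<Delta>) t \<Longrightarrow> wfo (T0 # T0 # T0 # \<Delta>) (\<phi> t)"
  shows "wfo \<Delta> (decode q \<phi>)"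
proof -
  have "wtr (T0 # T0 # T0 # \<Delta>) (var (length \<Delta>), var (length (T0 # \<Delta>)), var (length (T0 # T0 # \<Delta>)) \<^bold>+ \<^bold>1)"
    unfolding wtr_def prod.case by (intro conjI wt_arith wt_consts; (rule wt_var | intro wt_weak wt_var)+)
  from assms(2)[OF this] show ?thesis
    unfolding decode_def by (intro wf_ex wf_connectives wf_prime wt_weak[OF wt_weak[OF wt_weak[OF assms(1)]]] wt_code)
      ((rule wt_var wt_weak | assumption)+)
qed

lemma wf_is_rat [wf_rules]: "wt \<Delta> q T0 \<Longrightarrow> wfo \<Delta> (is_rat q)"
  unfolding is_rat_def by (rule wf_rules wt_weak | assumption)+

lemma wf_reals [wf_rules]:
  "wt \<Delta> x T1 \<Longrightarrow> wfo \<Delta> (Real x)"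
  "wt \<Delta> x T1 \<Longrightarrow> wt \<Delta> y T1 \<Longrightarrow> wfo \<Delta> (x \<^bold>=\<^sub>R y)"
  "wt \<Delta> x T1 \<Longrightarrow> wt \<Delta> y T1 \<Longrightarrow> wfo \<Delta> (x \<^bold><\<^sub>R y)"
  "wt \<Delta> x T1 \<Longrightarrow> wt \<Delta> y T1 \<Longrightarrow> wt \<Delta> z T1 \<Longrightarrow> wfo \<Delta> (dist_less x y z)"
  "wt \<Delta> x T1 \<Longrightarrow> wt \<Delta> y T1 \<Longrightarrow> wt \<Delta> z T1 \<Longrightarrow> wfo \<Delta> (is_sum x y z)"
  unfolding Real_def real_eq_def real_less_def dist_less_def is_sum_def
  by (rule wf_rules | assumption | rule wt_weak wtr_weak)+

lemma wf_real_le [wf_rules]: "wt \<Delta> x T1 \<Longrightarrow> wt \<Delta> y T1 \<Longrightarrow> wfo \<Delta> (x \<^bold>\<le>\<^sub>R y)"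
  unfolding real_le_def by (rule wf_rules | assumption)+

lemma wf_interval [wf_rules]:
  "wt \<Delta> x T1 \<Longrightarrow> wt \<Delta> a T1 \<Longrightarrow> wt \<Delta> b T1 \<Longrightarrow> wfo \<Delta> (interval a b x)"
  "wt \<Delta> x T1 \<Longrightarrow> wfo \<Delta> (PosReal x)"
  unfolding interval_def PosReal_def by (rule wf_rules | assumption)+

lemma wf_FIN: "wfo [] FIN_union" "wfo [] FIN_enum"
  unfolding FIN_union_def FIN_enum_def finite_set_def is_set_def elem_def
  by (rule wf_rules | assumption | rule wt_weak)+

lemma wf_NIN_alt: "wfo [] NIN_alt"
  unfolding NIN_alt_def height_countable_def finite_set_def
  by (rule wf_rules | assumption | rule wt_weak)+

lemma wf_cont_point: "wfo [] cont_point_sup" "wfo [] cont_point_lsc_sup" "wfo [] cont_point_symm"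
  unfolding cont_point_sup_def cont_point_lsc_sup_def cont_point_symm_def unit_fun_def continuous_at_def
    right_limit_def left_limit_def regulated_def is_supremum_def rat_fun2_def supremum_functional_def
    has_supremum_functional_def lower_semicontinuous_def symmetrically_continuous_def
  by (rule wf_rules | assumption | rule wt_weak)+

lemma wf_Exists2: "wfo [] Exists2"
  unfolding Exists2_def by (rule wf_rules | assumption | rule wt_weak)+

lemma wf_Rec: "wfo [] Rec_axiom"
  unfolding Rec_axiom_def by (rule wf_rules | assumption | rule wt_weak)+

lemma wf_eq_at [wf_rules]: "wt \<Delta> s \<rho> \<Longrightarrow> wt \<Delta> t \<rho> \<Longrightarrow> wfo \<Delta> (eq_at \<rho> s t)"
proof (induction \<rho> arbitrary: \<Delta> s t)
  case (Arr \<rho> \<tau>)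
  show ?case
    unfolding eq_at.simps
    by (rule wf_all, rule Arr.IH) (rule wt_app, rule wt_weak, rule Arr.prems, rule wt_var)+
qed (simp add: wf_prime)

lemma wf_combinators: "wfo [] (K_axiom \<rho> \<tau>)" "wfo [] (S_axiom \<rho> \<sigma> \<tau>)" "wfo [] (extensionality \<rho> \<tau>)"
  unfolding K_axiom_def S_axiom_def extensionality_def
  by (rule wf_rules | assumption | rule wt_weak)+

lemma wf_arithmetic: "P \<in> arithmetic_axioms \<Longrightarrow> wfo [] P"
  unfolding arithmetic_axioms_def by (elim insertE emptyE; hypsubst; (rule wf_rules | rule wt_weak)+)

text \<open>Without quantifiers the substitution is never lifted, so typing of the substituted terms
  in one fixed context suffices.\<close>

lemma wff_subst_qfree:
  assumes "qfree A" "wff \<Delta> A" "\<And>i. i < length \<Delta> \<Longrightarrow> ty_of \<Delta>' (\<theta> i) = Some (\<Delta> ! i)"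
  shows "wff \<Delta>' (subst \<theta> A)"
proof -
  have t: "ty_of \<Delta> t = Some \<tau> \<Longrightarrow> ty_of \<Delta>' (subst_tm \<theta> t) = Some \<tau>" for t \<tau>
    by (induction t arbitrary: \<tau>) (auto simp: assms(3) ty_of_App simp del: ty_of.simps(4) split: if_splits)
  show ?thesis using assms(1,2) by (induction A) (auto simp: t)
qed

lemma wf_fill1 [wf_rules]: "qfree A \<and> wff [\<rho>] A \<Longrightarrow> wt \<Delta> x \<rho> \<Longrightarrow> wfo \<Delta> (fill A [x])"
  unfolding wfo_def fill_def by (rule wff_subst_qfree[of _ "[\<rho>]"]) (auto simp: wt_ty_of)

lemma wf_fill2 [wf_rules]:
  "qfree A \<and> wff [\<rho>, \<sigma>] A \<Longrightarrow> wt \<Delta> x \<rho> \<Longrightarrow> wt \<Delta> y \<sigma> \<Longrightarrow> wfo \<Delta> (fill A [x, y])"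
  unfolding wfo_def fill_def by (rule wff_subst_qfree[of _ "[\<rho>, \<sigma>]"]) (auto simp: wt_ty_of less_Suc_eq)

lemma wf_schemes:
  "qfree A \<and> wff [T0] A \<Longrightarrow> wfo [] (induction A)"
  "qfree A \<and> wff [\<rho>, \<sigma>] A \<Longrightarrow> wfo [] (choice \<rho> \<sigma> A)"
  unfolding induction_def choice_def by (rule wf_rules | assumption | rule wt_weak)+

section \<open>The numbers of a countermodel\<close>

text \<open>The class \<open>discrete_semiring\<close> relative to a carrier set, to be transferred
  to a type once the carrier is fixed.\<close>

locale ds_structure =
  fixes N :: "'a set" and z i :: 'a and pl ti :: "'a \<Rightarrow> 'a \<Rightarrow> 'a" and ls :: "'a \<Rightarrow> 'a \<Rightarrow> bool"
  assumes closed: "z \<in> N" "i \<in> N" "x \<in> N \<Longrightarrow> y \<in> N \<Longrightarrow> pl x y \<in> N" "x \<in> N \<Longrightarrow> y \<in> N \<Longrightarrow> ti x y \<in> N"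
    and arith: "\<forall>x\<in>N. \<forall>y\<in>N. \<forall>w\<in>N. pl (pl x y) w = pl x (pl y w)"
      "\<forall>x\<in>N. \<forall>y\<in>N. pl x y = pl y x"
      "\<forall>x\<in>N. pl x z = x"
      "\<forall>x\<in>N. \<forall>y\<in>N. \<forall>w\<in>N. ti (ti x y) w = ti x (ti y w)"
      "\<forall>x\<in>N. \<forall>y\<in>N. ti x y = ti y x"
      "\<forall>x\<in>N. ti x i = x"
      "\<forall>x\<in>N. ti x z = z"
      "\<forall>x\<in>N. \<forall>y\<in>N. \<forall>w\<in>N. ti x (pl y w) = pl (ti x y) (ti x w)"
    and order: "\<forall>x\<in>N. \<not> ls x x"
      "\<forall>x\<in>N. \<forall>y\<in>N. \<forall>w\<in>N. ls x y \<and> ls y w \<longrightarrow> ls x w"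
      "\<forall>x\<in>N. \<forall>y\<in>N. ls x y \<or> x = y \<or> ls y x"
      "\<forall>x\<in>N. \<forall>y\<in>N. \<forall>w\<in>N. ls x y \<longrightarrow> ls (pl x w) (pl y w)"
      "\<forall>x\<in>N. \<forall>y\<in>N. \<forall>w\<in>N. ls z w \<and> ls x y \<longrightarrow> ls (ti x w) (ti y w)"
      "\<forall>x\<in>N. \<forall>y\<in>N. ls x y \<longrightarrow> (\<exists>w\<in>N. pl x w = y)"
      "\<forall>x\<in>N. ls z x \<or> z = x"
      "ls z i"
      "\<forall>x\<in>N. ls z x \<longrightarrow> ls i x \<or> i = x"

abbreviation s_plus :: "'u struct \<Rightarrow> 'u \<Rightarrow> 'u \<Rightarrow> 'u" where "s_plus S x y \<equiv> ap S (ap S (cn S CPlus) x) y"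
abbreviation s_times :: "'u struct \<Rightarrow> 'u \<Rightarrow> 'u \<Rightarrow> 'u" where "s_times S x y \<equiv> ap S (ap S (cn S CTimes) x) y"

lemma den_var_eq: "k = length e \<Longrightarrow> den S (v # e) (var k) = v"
  by (simp add: den_simps)

text \<open>Equality is genuine in a normal structure, so the arithmetical axioms become literal
  equations and inequalities on the domain of type 0.\<close>

lemma ds_structure_struct:
  assumes S: "normal S" and A: "\<forall>P\<in>arithmetic_axioms. hol S [] P"
  shows "ds_structure (dm S T0) (cn S CZero) (cn S COne) (s_plus S) (s_times S) (lsr S)"
proof -
  have eq: "eqr S = (=)" using S by (simp add: normal_def)
  note sem = hol_all hol_ex hol_connectives den_simps(1,2) den_Cons stab_simps stab_Cons den_var_eq
    o_plus_def o_times_def o_zero_def o_one_def o_le_def eq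
  have cn: "cn S c \<in> dm S (ty_cnst c)" for c using S by (simp add: normal_def)
  have ap: "f \<in> dm S (\<rho> \<Rrightarrow> \<tau>) \<Longrightarrow> x \<in> dm S \<rho> \<Longrightarrow> ap S f x \<in> dm S \<tau>" for f x \<rho> \<tau> using S unfolding normal_def by blast
  let ?N = "dm S T0" and ?z = "cn S CZero" and ?i = "cn S COne" and ?ls = "lsr S"
  have "(\<forall>P\<in>arithmetic_axioms. hol S [] P) \<longleftrightarrow>
      (\<forall>x\<in>?N. x = x) \<and>
      (\<forall>x\<in>?N. \<forall>y\<in>?N. x = y \<longrightarrow> y = x) \<and>
      (\<forall>x\<in>?N. \<forall>y\<in>?N. \<forall>w\<in>?N. x = y \<and> y = w \<longrightarrow> x = w) \<and>
      (\<forall>x\<in>?N. \<forall>y\<in>?N. \<forall>u\<in>?N. \<forall>v\<in>?N. x = y \<and> u = v \<and> ?ls x u \<longrightarrow> ?ls y v) \<and>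
      (\<forall>x\<in>?N. \<forall>y\<in>?N. \<forall>w\<in>?N. s_plus S (s_plus S x y) w = s_plus S x (s_plus S y w)) \<and>
      (\<forall>x\<in>?N. \<forall>y\<in>?N. s_plus S x y = s_plus S y x) \<and>
      (\<forall>x\<in>?N. s_plus S x ?z = x) \<and>
      (\<forall>x\<in>?N. \<forall>y\<in>?N. \<forall>w\<in>?N. s_times S (s_times S x y) w = s_times S x (s_times S y w)) \<and>
      (\<forall>x\<in>?N. \<forall>y\<in>?N. s_times S x y = s_times S y x) \<and>
      (\<forall>x\<in>?N. s_times S x ?i = x) \<and>
      (\<forall>x\<in>?N. s_times S x ?z = ?z) \<and>
      (\<forall>x\<in>?N. \<forall>y\<in>?N. \<forall>w\<in>?N. s_times S x (s_plus S y w) = s_plus S (s_times S x y) (s_times S x w)) \<and>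
      (\<forall>x\<in>?N. \<not> ?ls x x) \<and>
      (\<forall>x\<in>?N. \<forall>y\<in>?N. \<forall>w\<in>?N. ?ls x y \<and> ?ls y w \<longrightarrow> ?ls x w) \<and>
      (\<forall>x\<in>?N. \<forall>y\<in>?N. ?ls x y \<or> x = y \<or> ?ls y x) \<and>
      (\<forall>x\<in>?N. \<forall>y\<in>?N. \<forall>w\<in>?N. ?ls x y \<longrightarrow> ?ls (s_plus S x w) (s_plus S y w)) \<and>
      (\<forall>x\<in>?N. \<forall>y\<in>?N. \<forall>w\<in>?N. ?ls ?z w \<and> ?ls x y \<longrightarrow> ?ls (s_times S x w) (s_times S y w)) \<and>
      (\<forall>x\<in>?N. \<forall>y\<in>?N. ?ls x y \<longrightarrow> (\<exists>w\<in>?N. s_plus S x w = y)) \<and>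
      (\<forall>x\<in>?N. ?ls ?z x \<or> ?z = x) \<and>
      ?ls ?z ?i \<and>
      (\<forall>x\<in>?N. ?ls ?z x \<longrightarrow> ?ls ?i x \<or> ?i = x)"
    unfolding arithmetic_axioms_def ball_simps by (simp add: sem)
  note A' = A[unfolded this]
  show ?thesis
  proof (rule ds_structure.intro)
    show "?z \<in> ?N" "?i \<in> ?N" using cn[of CZero] cn[of COne] by simp_all
    show "s_plus S x y \<in> ?N" "s_times S x y \<in> ?N" if "x \<in> ?N" "y \<in> ?N" for x y
      using that cn[of CPlus] cn[of CTimes] by (auto intro!: ap[of _ T0 T0] ap[of _ T0 "T0 \<Rrightarrow> T0"])
  qed (insert A', (elim conjE, assumption)+)
qed

section \<open>Reduction to one fixed countermodel\<close>

definition base_theory :: "fm set" where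
  "base_theory = ACA0_omega \<union> QF_AC T0 T1 \<union> FIN"
definition equivalences :: "ofm set" where
  "equivalences = {NIN_alt \<^bold>\<longleftrightarrow> cont_point_sup, NIN_alt \<^bold>\<longleftrightarrow> cont_point_lsc_sup, NIN_alt \<^bold>\<longleftrightarrow> cont_point_symm}"
text \<open>Failure of some equivalence is required, not of a given one. The structure can then be
  chosen once and for all by \<open>refuter\<close>, whose numbers must form a type without
  parameters.\<close>

definition refuting :: "trm set struct \<Rightarrow> bool" where
  "refuting S \<longleftrightarrow> normal S \<and> (\<forall>P. sentence P \<in> base_theory \<longrightarrow> wfo [] P \<longrightarrow> hol S [] P) \<and>
     (\<exists>P\<in>equivalences. \<not> hol S [] P)"
definition refuter :: "trm set struct" where "refuter = (SOME S. refuting S)"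

lemma arithmetic_base: "P \<in> arithmetic_axioms \<Longrightarrow> sentence P \<in> base_theory"
  by (simp add: base_theory_def ACA0_omega_def RCA0_omega_def)

lemma base_theory_intros:
  "sentence (K_axiom \<rho> \<tau>) \<in> base_theory" "sentence (S_axiom \<rho> \<sigma> \<tau>) \<in> base_theory"
  "sentence Rec_axiom \<in> base_theory" "sentence (extensionality \<rho> \<tau>) \<in> base_theory"
  "qfree A \<Longrightarrow> wff [T0] A \<Longrightarrow> sentence (induction A) \<in> base_theory"
  "qfree A \<Longrightarrow> wff [T1, T0] A \<Longrightarrow> sentence (choice T1 T0 A) \<in> base_theory"
  "qfree A \<Longrightarrow> wff [T0, T1] A \<Longrightarrow> sentence (choice T0 T1 A) \<in> base_theory"
  "sentence Exists2 \<in> base_theory" "sentence FIN_union \<in> base_theory" "sentence FIN_enum \<in> base_theory"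
  unfolding base_theory_def ACA0_omega_def RCA0_omega_def QF_IA_def QF_AC_def FIN_def by blast+

lemma wfo_sentence: "wff [] (sentence P) \<longleftrightarrow> wfo [] P"
  by (simp add: wfo_def sentence_def)

lemma ex_refuting:
  assumes "\<not> base_theory \<turnstile>\<^sub>0 sentence P" "P \<in> equivalences"
  shows "\<exists>S. refuting S"
proof -
  have "wff [] (sentence P)"
    using assms(2) wf_NIN_alt wf_cont_point unfolding equivalences_def wfo_sentence by (auto intro: wf_connectives)
  moreover have "sentence ` arithmetic_axioms \<subseteq> base_theory" using arithmetic_base by blast
  moreover have "wff [] (sentence (extensionality \<rho> \<tau>))" for \<rho> \<tau> unfolding wfo_sentence by (rule wf_combinators)
  ultimately obtain S :: "trm set struct" where "normal S" "\<And>\<psi>. \<psi> \<in> base_theory \<Longrightarrow> wff [] \<psi> \<Longrightarrow> sat S [] \<psi>"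
      "\<not> sat S [] (sentence P)"
    using countermodel[OF assms(1)] base_theory_intros(4) by metis
  then have "refuting S" using assms(2) unfolding refuting_def sat_sentence[symmetric] wfo_sentence[symmetric] by blast
  then show ?thesis by blast
qed

lemma refuting_structure: "refuting S \<Longrightarrow> ds_structure (dm S T0) (cn S CZero) (cn S COne) (s_plus S) (s_times S) (lsr S)"
  using ds_structure_struct arithmetic_base wf_arithmetic unfolding refuting_def by blast

text \<open>A type cannot depend on the hypothesis that a countermodel exists.  So \<open>mnum\<close> consists of the
  numbers of a countermodel if there is one, and is a copy of the natural numbers otherwise.\<close>

definition std :: "nat \<Rightarrow> trm set" where "std n = {Bnd n}"

lemma inv_std [simp]: "inv std (std n) = n"
  by (rule inv_f_f) (auto simp: inj_def std_def)

lemma std_eq [simp]: "std m = std n \<longleftrightarrow> m = n"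
  by (simp add: std_def)

definition num_set :: "trm set set" where
  "num_set = (if \<exists>S. refuting S then dm refuter T0 else range std)"
definition num_zero :: "trm set" where
  "num_zero = (if \<exists>S. refuting S then cn refuter CZero else std 0)"
definition num_one :: "trm set" where
  "num_one = (if \<exists>S. refuting S then cn refuter COne else std 1)"
definition num_plus :: "trm set \<Rightarrow> trm set \<Rightarrow> trm set" where
  "num_plus = (if \<exists>S. refuting S then s_plus refuter else (\<lambda>x y. std (inv std x + inv std y)))"
definition num_times :: "trm set \<Rightarrow> trm set \<Rightarrow> trm set" where
  "num_times = (if \<exists>S. refuting S then s_times refuter else (\<lambda>x y. std (inv std x * inv std y)))"
definition num_less :: "trm set \<Rightarrow> trm set \<Rightarrow> bool" where
  "num_less = (if \<exists>S. refuting S then lsr refuter else (\<lambda>x y. inv std x < inv std y))"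

interpretation num: ds_structure num_set num_zero num_one num_plus num_times num_less
proof (cases "\<exists>S. refuting S")
  case True
  then have "refuting refuter" unfolding refuter_def by (rule someI_ex)
  from refuting_structure[OF this] show "ds_structure num_set num_zero num_one num_plus num_times num_less"
    using True by (simp add: num_set_def num_zero_def num_one_def num_plus_def num_times_def num_less_def)
next
  case False
  moreover have "\<exists>w. x + w = y" if "x < y" for x y :: nat
    using less_imp_add_positive[OF that] by blast
  ultimately show "ds_structure num_set num_zero num_one num_plus num_times num_less"
    by unfold_locales (auto simp: num_set_def num_zero_def num_one_def num_plus_def num_times_def num_less_def
        algebra_simps)
qed

typedef mnum = num_set
  using num.closed(1) by blast

instantiation mnum :: discrete_semiring
begin

definition zero_mnum :: mnum where "0 = Abs_mnum num_zero"
definition one_mnum :: mnum where "1 = Abs_mnum num_one"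
definition plus_mnum :: "mnum \<Rightarrow> mnum \<Rightarrow> mnum" where "a + b = Abs_mnum (num_plus (Rep_mnum a) (Rep_mnum b))"
definition times_mnum :: "mnum \<Rightarrow> mnum \<Rightarrow> mnum" where "a * b = Abs_mnum (num_times (Rep_mnum a) (Rep_mnum b))"
definition less_mnum :: "mnum \<Rightarrow> mnum \<Rightarrow> bool" where "a < b \<longleftrightarrow> num_less (Rep_mnum a) (Rep_mnum b)"
definition less_eq_mnum :: "mnum \<Rightarrow> mnum \<Rightarrow> bool" where "a \<le> b \<longleftrightarrow> a < b \<or> a = (b :: mnum)"

lemma Rep_mnum_simps:
  "Rep_mnum 0 = num_zero" "Rep_mnum 1 = num_one"
  "Rep_mnum (a + b) = num_plus (Rep_mnum a) (Rep_mnum b)"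
  "Rep_mnum (a * b) = num_times (Rep_mnum a) (Rep_mnum b)"
  by (simp_all add: zero_mnum_def one_mnum_def plus_mnum_def times_mnum_def Abs_mnum_inverse num.closed Rep_mnum)

instance
proof
  fix a b c :: mnum
  note R = Rep_mnum[of a] Rep_mnum[of b] Rep_mnum[of c]
  note s = Rep_mnum_inject[symmetric] Rep_mnum_simps
  show "a + b + c = a + (b + c)" unfolding s using num.arith(1) R by blast
  show "a + b = b + a" unfolding s using num.arith(2) R by blast
  show "0 + a = a" unfolding s using num.arith(2,3) R num.closed by metis
  show "a * b * c = a * (b * c)" unfolding s using num.arith(4) R by blast
  show "a * b = b * a" unfolding s using num.arith(5) R by blast
  show "1 * a = a" unfolding s using num.arith(5,6) R num.closed by metis
  show "(a + b) * c = a * c + b * c" unfolding s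
    using num.arith(5)[rule_format, OF num.closed(3)[OF R(1,2)] R(3)] num.arith(8)[rule_format, OF R(3,1,2)]
      num.arith(5)[rule_format, OF R(1,3)] num.arith(5)[rule_format, OF R(2,3)] by simp
  show "0 * a = 0" unfolding s using num.arith(5,7) R num.closed by metis
  show "a * 0 = 0" unfolding s using num.arith(7) R by blast
  show "(0::mnum) \<noteq> 1" unfolding s using num.order(1,8) num.closed by metis
  show "(a < b) = (a \<le> b \<and> \<not> b \<le> a)"
    unfolding less_eq_mnum_def less_mnum_def using num.order(1,2) R by blast
  show "a \<le> a" by (simp add: less_eq_mnum_def)
  show "a \<le> b \<Longrightarrow> b \<le> c \<Longrightarrow> a \<le> c" unfolding less_eq_mnum_def less_mnum_def using num.order(2) R by blast
  show "a \<le> b \<Longrightarrow> b \<le> a \<Longrightarrow> a = b" unfolding less_eq_mnum_def less_mnum_def using num.order(1,2) R by blast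
  show "a \<le> b \<or> b \<le> a" unfolding less_eq_mnum_def less_mnum_def Rep_mnum_inject[symmetric] using num.order(3) R by blast
  show "a < b \<Longrightarrow> a + c < b + c" unfolding less_mnum_def s using num.order(4) R by blast
  show "0 < c \<Longrightarrow> a < b \<Longrightarrow> a * c < b * c" unfolding less_mnum_def s using num.order(5) R by blast
  show "a < b \<Longrightarrow> \<exists>c. a + c = b"
  proof -
    assume "a < b"
    then obtain w where "w \<in> num_set" "num_plus (Rep_mnum a) w = Rep_mnum b"
      unfolding less_mnum_def using num.order(6) R by blast
    then have "a + Abs_mnum w = b" unfolding s by (simp add: Abs_mnum_inverse)
    then show ?thesis by blast
  qed
  show "0 \<le> a" unfolding less_eq_mnum_def less_mnum_def s using num.order(7) R by blast
  show "(0::mnum) < 1" unfolding less_mnum_def s by (rule num.order(8))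
  show "0 < a \<Longrightarrow> 1 \<le> a" unfolding less_eq_mnum_def less_mnum_def s using num.order(9) R by blast
qed

end

lemma refuter_model:
  assumes "\<exists>S. refuting S"
  shows "model refuter Rep_mnum"
proof -
  have r: "refuting refuter" unfolding refuter_def using assms by (rule someI_ex)
  have num: "num_set = dm refuter T0" "num_zero = cn refuter CZero" "num_one = cn refuter COne"
    "num_plus = s_plus refuter" "num_times = s_times refuter" "num_less = lsr refuter"
    using assms by (simp_all add: num_set_def num_zero_def num_one_def num_plus_def num_times_def num_less_def)
  have hol: "hol refuter [] P" if "sentence P \<in> base_theory" "wfo [] P" for P
    using r that unfolding refuting_def by blast
  show ?thesis
  proof
    show "normal refuter" using r by (simp add: refuting_def)
    show "dm refuter T0 = range Rep_mnum"
      using type_definition.Rep_range[OF type_definition_mnum] num(1) by simp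
    show "inj Rep_mnum" by (simp add: inj_def Rep_mnum_inject)
    show "lsr refuter (Rep_mnum a) (Rep_mnum b) \<longleftrightarrow> a < b" for a b by (simp add: less_mnum_def num)
    show "cn refuter CZero = Rep_mnum 0" "cn refuter COne = Rep_mnum 1"
      "s_plus refuter (Rep_mnum a) (Rep_mnum b) = Rep_mnum (a + b)"
      "s_times refuter (Rep_mnum a) (Rep_mnum b) = Rep_mnum (a * b)" for a b
      by (simp_all add: Rep_mnum_simps num)
  qed (intro hol base_theory_intros wf_combinators wf_Rec wf_schemes wf_Exists2 wf_FIN conjI; assumption)+
qed

text \<open>If P is not derivable, \<open>refuter\<close> is a model and violates some equivalence,
  perhaps another one than P. As all three hold in it, this is a contradiction in any case.\<close>

lemma base_theory_proves: "P \<in> equivalences \<Longrightarrow> base_theory \<turnstile>\<^sub>0 sentence P"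
proof (rule ccontr)
  assume "P \<in> equivalences" "\<not> base_theory \<turnstile>\<^sub>0 sentence P"
  then have ex: "\<exists>S. refuting S" using ex_refuting by blast
  then have "refuting refuter" unfolding refuter_def by (rule someI_ex)
  moreover have "hol refuter [] Q" if "Q \<in> equivalences" for Q
    using that model.model_equivalences[OF refuter_model[OF ex]] unfolding equivalences_def by blast
  ultimately show False unfolding refuting_def by blast
qed

theorem theorem3p9:
  fixes T :: "fm set"
  defines "T \<equiv> ACA0_omega \<union> QF_AC T0 T1 \<union> FIN"
  shows "T \<turnstile>\<^sub>0 sentence (NIN_alt \<^bold>\<longleftrightarrow> cont_point_sup)
       \<and> T \<turnstile>\<^sub>0 sentence (NIN_alt \<^bold>\<longleftrightarrow> cont_point_lsc_sup)
       \<and> T \<turnstile>\<^sub>0 sentence (NIN_alt \<^bold>\<longleftrightarrow> cont_point_symm)"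
  unfolding T_def base_theory_def[symmetric] by (intro conjI base_theory_proves) (simp_all add: equivalences_def)

end
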